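(* Let either $d=2$ and $q\ge3$ be an odd integer, or $d=3$ and $q\in\{3,5\}$. Let $\{u_h^n\}_{n=0}^N\subset V_h$ be the solution of the fully discrete scheme $$(u_h^{n+1}-u_h^n,v_h)+\tau(\nabla u_h^{n+1},\nabla v_h)=\tau(I_hF^{n+1},v_h)+(G(u_h^n),v_h)\,\Delta W_n+\tfrac12\bigl(DG(u_h^n)G(u_h^n)[(\Delta W_n)^2-\tau],v_h\bigr)\qquad\forall v_h\in V_h,$$ $\mathbb P$-a.s. for $n=0,\dots,N-1$, with $u_h^0=P_hu_0$ and $F^{n+1}=u_h^{n+1}-(u_h^{n+1})^q$. Suppose the triangulation $\mathcal T_h$ satisfies the mesh condition $$\frac1{d(d-1)}\sum_{K\supset E}|\kappa_E^K|\cot\theta_E^K\ge0\quad\text{for every edge }E.$$ Then for any $p\ge2$ there is a constant $C>0$, independent of $\tau$ and $h$, such that $$\sup_{0\le\ell\le N}\mathbb E\bigl[\|u_h^\ell\|_{L^2}^p\bigr]\le C .$$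
   Context: $D=(0,L)^d\subset\mathbb R^d$, $T>0$, $N\in\mathbb N$, $\tau=T/N$, $t_n=n\tau$, $W$ is a real-valued Wiener process on a filtered probability space, $\Delta W_n=W(t_{n+1})-W(t_n)$, and the process $u_h^n$ is $\mathcal F_{t_n}$-adapted. $\mathcal T_h$ is a triangulation of $D$ of mesh size $h$. Mesh notation: for a simplex $K$ with vertices $a_1,\dots,a_{d+1}$, let $E=E_{ij}$ be the edge joining $a_i$ and $a_j$, $S_i$ the $(d-1)$-dimensional face opposite to $a_i$, $\theta_E^K$ the angle between the faces $S_i$ and $S_j$, and $\kappa_E^K=S_i\cap S_j$; for $d=2$ the mesh condition is the Delaunay condition. $V_h=\{v_h\in H_0^1(D):v_h|_K\in\mathcal P_1(K)\ \forall K\in\mathcal T_h\}$ is the space of continuous piecewise linear functions vanishing on $\partial D$, $I_h:C(\bar D)\to V_h$ is the nodal interpolation operator, and $P_h:L^2(D)\to V_h$ is the $L^2$-projection. The initial datum $u_0$ is sufficiently smooth. $G:H_0^1(D)\to H_0^1(D)$ satisfies the following assumptions, formulated for Hilbert spaces $\mathcal H,\mathcal K$ and $G:\mathcal H\to\mathcal K$ (they are used with $\mathcal H=\mathcal K=L^2(D)$ and with $\mathcal H=\mathcal K=H_0^1(D)$); $D^kG(u)\in\mathcal L_k(\mathcal H,\mathcal K)$ denotes the $k$-th Gateaux derivative, where $\mathcal L_k(\mathcal H,\mathcal K)$ is the space of $k$-linear maps from $\mathcal H^k$ to $\mathcal K$. There is $C>0$ such that for all $v,w\in\mathcal H$: $\|G(v)-G(w)\|_{\mathcal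 K}\le C\|v-w\|_{\mathcal H}$; $\|G(v)\|_{\mathcal K}\le C(\|v\|_{\mathcal H}+1)$; $\|DG\|_{L^\infty(\mathcal H;\mathcal L(\mathcal H,\mathcal K))}+\|D^2G\|_{L^\infty(\mathcal H;\mathcal L_2(\mathcal H,\mathcal K))}\le C$; $\|(DG(v)-DG(w))G(w)\|_{\mathcal K}\le C\|v-w\|_{\mathcal H}$. *)

theory Defs
  imports "HOL-Analysis.Analysis" "HOL-Probability.Probability"
begin

section \<open>Lebesgue and Sobolev spaces on a domain\<close>

text \<open>Elements of \<open>L\<^sup>2(D)\<close> and \<open>H\<^sub>0\<^sup>1(D)\<close> are represented by functions on the whole space whose
  values outside \<open>D\<close> are irrelevant; two representatives denote the same element iff they agree
  almost everywhere in \<open>D\<close>, i.e. iff the \<open>L\<^sup>2\<close>-norm of the difference vanishes.\<close>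

definition cube :: "real \<Rightarrow> (real ^ 'n) set" where
  "cube L = {x. \<forall>i. 0 < x $ i \<and> x $ i < L}"

definition L2_space :: "(real ^ 'n) set \<Rightarrow> (real ^ 'n \<Rightarrow> real) set" where
  "L2_space D = {f \<in> borel_measurable (lebesgue_on D). integrable (lebesgue_on D) (\<lambda>x. (f x)\<^sup>2)}"

definition l2_inner :: "(real ^ 'n) set \<Rightarrow> (real ^ 'n \<Rightarrow> real) \<Rightarrow> (real ^ 'n \<Rightarrow> real) \<Rightarrow> real" where
  "l2_inner D f g = (LINT x|lebesgue_on D. f x * g x)"

definition l2_norm :: "(real ^ 'n) set \<Rightarrow> (real ^ 'n \<Rightarrow> real) \<Rightarrow> real" where
  "l2_norm D f = sqrt (l2_inner D f f)"

definition partial :: "'n \<Rightarrow> (real ^ 'n \<Rightarrow> real) \<Rightarrow> real ^ 'n \<Rightarrow> real" where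
  "partial i f x = frechet_derivative f (at x) (axis i 1)"

primrec C_k :: "nat \<Rightarrow> (real ^ 'n \<Rightarrow> real) \<Rightarrow> bool" where
  "C_k 0 f \<longleftrightarrow> continuous_on UNIV f"
| "C_k (Suc k) f \<longleftrightarrow> (\<forall>x. f differentiable (at x)) \<and> (\<forall>i. C_k k (partial i f))"

definition test_functions :: "(real ^ 'n) set \<Rightarrow> (real ^ 'n \<Rightarrow> real) set" where
  "test_functions D =
     {\<phi>. (\<forall>k. C_k k \<phi>) \<and> (\<exists>S. compact S \<and> S \<subseteq> D \<and> (\<forall>x. x \<notin> S \<longrightarrow> \<phi> x = 0))}"

definition is_weak_partial ::
  "(real ^ 'n) set \<Rightarrow> 'n \<Rightarrow> (real ^ 'n \<Rightarrow> real) \<Rightarrow> (real ^ 'n \<Rightarrow> real) \<Rightarrow> bool" where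
  "is_weak_partial D i f g \<longleftrightarrow>
     (\<forall>\<phi> \<in> test_functions D. l2_inner D f (partial i \<phi>) = - l2_inner D g \<phi>)"

definition H1_space :: "(real ^ 'n) set \<Rightarrow> (real ^ 'n \<Rightarrow> real) set" where
  "H1_space D = {f \<in> L2_space D. \<forall>i. \<exists>g \<in> L2_space D. is_weak_partial D i f g}"

definition weak_partial :: "(real ^ 'n) set \<Rightarrow> 'n \<Rightarrow> (real ^ 'n \<Rightarrow> real) \<Rightarrow> real ^ 'n \<Rightarrow> real" where
  "weak_partial D i f = (SOME g. g \<in> L2_space D \<and> is_weak_partial D i f g)"

definition grad_inner :: "(real ^ 'n) set \<Rightarrow> (real ^ 'n \<Rightarrow> real) \<Rightarrow> (real ^ 'n \<Rightarrow> real) \<Rightarrow> real" where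
  "grad_inner D f g = (\<Sum>i\<in>UNIV. l2_inner D (weak_partial D i f) (weak_partial D i g))"

definition h1_norm :: "(real ^ 'n) set \<Rightarrow> (real ^ 'n \<Rightarrow> real) \<Rightarrow> real" where
  "h1_norm D f = sqrt (l2_inner D f f + grad_inner D f f)"

definition H10_space :: "(real ^ 'n) set \<Rightarrow> (real ^ 'n \<Rightarrow> real) set" where
  "H10_space D = {f \<in> H1_space D. \<exists>\<phi>. (\<forall>k. \<phi> k \<in> test_functions D) \<and>
                    (\<lambda>k::nat. h1_norm D (\<lambda>x. \<phi> k x - f x)) \<longlonglongrightarrow> 0}"

section \<open>Triangulations and the finite element space\<close>

text \<open>The elements are closed simplices; the library notion \<^const>\<open>triangulation\<close> says that
  there are finitely many and that any two of them intersect in a common (possibly empty) face.\<close>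

definition triangulation_of :: "(real ^ 'n) set \<Rightarrow> (real ^ 'n) set set \<Rightarrow> bool" where
  "triangulation_of D \<T> \<longleftrightarrow>
     triangulation \<T> \<and> (\<forall>K\<in>\<T>. int CARD('n) simplex K) \<and> \<Union>\<T> = closure D"

definition mesh_size :: "(real ^ 'n) set set \<Rightarrow> real" where
  "mesh_size \<T> = Max (diameter ` \<T>)"

definition vertices :: "(real ^ 'n) set \<Rightarrow> (real ^ 'n) set" where
  "vertices K = {a. a extreme_point_of K}"

definition opposite_face :: "(real ^ 'n) set \<Rightarrow> real ^ 'n \<Rightarrow> (real ^ 'n) set" where
  "opposite_face K a = convex hull (vertices K - {a})"

definition kappa :: "(real ^ 'n) set \<Rightarrow> real ^ 'n \<Rightarrow> real ^ 'n \<Rightarrow> (real ^ 'n) set" where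
  "kappa K a b = opposite_face K a \<inter> opposite_face K b"

text \<open>The \<open>(d-2)\<close>-dimensional measure for \<open>d \<in> {2, 3}\<close>: \<open>\<kappa>\<close> is a point (counting measure \<open>1\<close>)
  or a segment (length).\<close>

definition kappa_measure :: "(real ^ 'n) set \<Rightarrow> real" where
  "kappa_measure \<kappa> = (if aff_dim \<kappa> = 0 then 1 else diameter \<kappa>)"

definition vec_angle :: "real ^ 'n \<Rightarrow> real ^ 'n \<Rightarrow> real" where
  "vec_angle x y = arccos (x \<bullet> y / (norm x * norm y))"

text \<open>The (interior) dihedral angle between the faces opposite to \<open>a\<close> and \<open>b\<close>: these faces are
  spanned by \<open>\<kappa>\<close> and \<open>b\<close>, respectively \<open>\<kappa>\<close> and \<open>a\<close>, and the angle is measured between the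
  components of the two faces orthogonal to \<open>\<kappa>\<close>. In the plane, \<open>\<kappa>\<close> is the third vertex and this is
  the angle of the triangle there.\<close>

definition dihedral_angle :: "(real ^ 'n) set \<Rightarrow> real ^ 'n \<Rightarrow> real ^ 'n \<Rightarrow> real" where
  "dihedral_angle K a b =
     (let A = affine hull (kappa K a b)
      in vec_angle (a - closest_point A a) (b - closest_point A b))"

definition mesh_condition :: "(real ^ 'n) set set \<Rightarrow> bool" where
  "mesh_condition \<T> \<longleftrightarrow>
     (\<forall>a b. a \<noteq> b \<and> (\<exists>K\<in>\<T>. a \<in> vertices K \<and> b \<in> vertices K) \<longrightarrow>
        1 / (real CARD('n) * (real CARD('n) - 1)) *
          (\<Sum>K | K \<in> \<T> \<and> closed_segment a b \<subseteq> K.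
              kappa_measure (kappa K a b) * cot (dihedral_angle K a b)) \<ge> 0)"

text \<open>Functions that are affine on each closed element (hence continuous on the closure of \<open>D\<close>).
  The value \<open>0\<close> outside the closure of \<open>D\<close> only fixes the representative.\<close>

definition P1_space :: "(real ^ 'n) set \<Rightarrow> (real ^ 'n) set set \<Rightarrow> (real ^ 'n \<Rightarrow> real) set" where
  "P1_space D \<T> = {v. (\<forall>K\<in>\<T>. \<exists>c b. \<forall>x\<in>K. v x = c + b \<bullet> x) \<and> (\<forall>x. x \<notin> closure D \<longrightarrow> v x = 0)}"

definition V_h :: "(real ^ 'n) set \<Rightarrow> (real ^ 'n) set set \<Rightarrow> (real ^ 'n \<Rightarrow> real) set" where
  "V_h D \<T> = H10_space D \<inter> P1_space D \<T>"

text \<open>The nodal interpolant matches \<open>f\<close> at the interior nodes and vanishes at the nodes on the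
  boundary, so that it is an element of \<^const>\<open>V_h\<close> (determined by its nodal values).\<close>

definition I_h :: "(real ^ 'n) set \<Rightarrow> (real ^ 'n) set set \<Rightarrow> (real ^ 'n \<Rightarrow> real) \<Rightarrow> real ^ 'n \<Rightarrow> real" where
  "I_h D \<T> f = (THE v. v \<in> P1_space D \<T> \<and>
                   (\<forall>K\<in>\<T>. \<forall>a\<in>vertices K. v a = (if a \<in> D then f a else 0)))"

definition P_h :: "(real ^ 'n) set \<Rightarrow> (real ^ 'n) set set \<Rightarrow> (real ^ 'n \<Rightarrow> real) \<Rightarrow> real ^ 'n \<Rightarrow> real" where
  "P_h D \<T> f = (THE w. w \<in> V_h D \<T> \<and> (\<forall>v \<in> V_h D \<T>. l2_inner D w v = l2_inner D f v))"

section \<open>Gateaux derivatives and the assumptions on the noise coefficient\<close>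

text \<open>The Hilbert spaces \<open>\<H>\<close> and \<open>\<K>\<close> are given by a set \<open>H\<close> (resp. \<open>K\<close>) of functions and a
  seminorm \<open>nH\<close> (resp. \<open>nK\<close>) whose null functions represent zero. Accordingly, linearity and
  limits are required up to null functions. Compatibility of \<open>G\<close>, \<open>DG\<close> and \<open>D2G\<close> with equality
  almost everywhere need not be assumed: for \<open>G\<close> it follows from the Lipschitz condition, and
  for the derivatives from linearity, boundedness and uniqueness of limits.\<close>

definition linear_map_on ::
  "('a \<Rightarrow> real) set \<Rightarrow> ('a \<Rightarrow> real) set \<Rightarrow> (('a \<Rightarrow> real) \<Rightarrow> real) \<Rightarrow>
     (('a \<Rightarrow> real) \<Rightarrow> 'a \<Rightarrow> real) \<Rightarrow> bool" where
  "linear_map_on H K nK A \<longleftrightarrow> (\<forall>f\<in>H. A f \<in> K) \<and>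
     (\<forall>f\<in>H. \<forall>g\<in>H. \<forall>a b.
        nK (\<lambda>x. A (\<lambda>y. a * f y + b * g y) x - (a * A f x + b * A g x)) = 0)"

definition has_gateaux_derivative ::
  "('a \<Rightarrow> real) set \<Rightarrow> ('a \<Rightarrow> real) set \<Rightarrow> (('a \<Rightarrow> real) \<Rightarrow> real) \<Rightarrow>
     (('a \<Rightarrow> real) \<Rightarrow> 'a \<Rightarrow> real) \<Rightarrow> (('a \<Rightarrow> real) \<Rightarrow> ('a \<Rightarrow> real) \<Rightarrow> 'a \<Rightarrow> real) \<Rightarrow> bool" where
  "has_gateaux_derivative H K nK G DG \<longleftrightarrow>
     (\<forall>u\<in>H. linear_map_on H K nK (DG u) \<and>
        (\<forall>f\<in>H. ((\<lambda>t. nK (\<lambda>x. (G (\<lambda>y. u y + t * f y) x - G u x) / t - DG u f x))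
                   \<longlongrightarrow> 0) (at 0)))"

text \<open>\<open>D2G u f g\<close> is the derivative at \<open>u\<close>, in direction \<open>g\<close>, of \<open>w \<mapsto> DG w f\<close>. In the bound on
  the derivatives, \<open>A\<close> and \<open>B\<close> are bounds for the two suprema of operator norms.\<close>

definition noise_assumptions ::
  "('a \<Rightarrow> real) set \<Rightarrow> (('a \<Rightarrow> real) \<Rightarrow> real) \<Rightarrow> ('a \<Rightarrow> real) set \<Rightarrow> (('a \<Rightarrow> real) \<Rightarrow> real) \<Rightarrow>
     (('a \<Rightarrow> real) \<Rightarrow> 'a \<Rightarrow> real) \<Rightarrow>
     (('a \<Rightarrow> real) \<Rightarrow> ('a \<Rightarrow> real) \<Rightarrow> 'a \<Rightarrow> real) \<Rightarrow>
     (('a \<Rightarrow> real) \<Rightarrow> ('a \<Rightarrow> real) \<Rightarrow> ('a \<Rightarrow> real) \<Rightarrow> 'a \<Rightarrow> real) \<Rightarrow> bool" where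
  "noise_assumptions H nH K nK G DG D2G \<longleftrightarrow>
     (\<forall>v\<in>H. G v \<in> K) \<and>
     has_gateaux_derivative H K nK G DG \<and>
     (\<forall>f\<in>H. has_gateaux_derivative H K nK (\<lambda>u. DG u f) (\<lambda>u. D2G u f)) \<and>
     (\<forall>u\<in>H. \<forall>g\<in>H. linear_map_on H K nK (\<lambda>f. D2G u f g)) \<and>
     (\<exists>C>0.
        (\<forall>v\<in>H. \<forall>w\<in>H. nK (\<lambda>x. G v x - G w x) \<le> C * nH (\<lambda>x. v x - w x)) \<and>
        (\<forall>v\<in>H. nK (G v) \<le> C * (nH v + 1)) \<and>
        (\<exists>A\<ge>0. \<exists>B\<ge>0. A + B \<le> C \<and>
           (\<forall>u\<in>H. \<forall>f\<in>H. nK (DG u f) \<le> A * nH f) \<and>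
           (\<forall>u\<in>H. \<forall>f\<in>H. \<forall>g\<in>H. nK (D2G u f g) \<le> B * nH f * nH g)) \<and>
        (\<forall>v\<in>H. \<forall>w\<in>H. nK (\<lambda>x. DG v (G w) x - DG w (G w) x) \<le> C * nH (\<lambda>x. v x - w x)))"

section \<open>Wiener processes\<close>

text \<open>Only the times \<open>t \<ge> 0\<close> matter in the following two definitions.\<close>

definition filtered_prob_space :: "'w measure \<Rightarrow> (real \<Rightarrow> 'w measure) \<Rightarrow> bool" where
  "filtered_prob_space M F \<longleftrightarrow> prob_space M \<and> (\<forall>t\<ge>0. subalgebra M (F t)) \<and>
     (\<forall>s\<ge>0. \<forall>t\<ge>s. subalgebra (F t) (F s))"

definition wiener_process ::
  "'w measure \<Rightarrow> (real \<Rightarrow> 'w measure) \<Rightarrow> (real \<Rightarrow> 'w \<Rightarrow> real) \<Rightarrow> bool" where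
  "wiener_process M F W \<longleftrightarrow>
     (AE \<omega> in M. W 0 \<omega> = 0) \<and>
     (AE \<omega> in M. continuous_on {0..} (\<lambda>t. W t \<omega>)) \<and>
     (\<forall>t\<ge>0. W t \<in> borel_measurable (F t)) \<and>
     (\<forall>s\<ge>0. \<forall>t>s.
        distributed M lborel (\<lambda>\<omega>. W t \<omega> - W s \<omega>) (normal_density 0 (sqrt (t - s))) \<and>
        prob_space.indep_set M (sets (F s))
          (sets (vimage_algebra (space M) (\<lambda>\<omega>. W t \<omega> - W s \<omega>) borel)))"

section \<open>The fully discrete scheme\<close>

text \<open>Adaptedness is expressed through point evaluations, which generate the Borel
  sets of the finite-dimensional space \<^const>\<open>V_h\<close>.\<close>

definition scheme_solution ::
  "(real ^ 'n) set \<Rightarrow> (real ^ 'n) set set \<Rightarrow> real \<Rightarrow> nat \<Rightarrow> nat \<Rightarrow> (real ^ 'n \<Rightarrow> real) \<Rightarrow>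
   ((real ^ 'n \<Rightarrow> real) \<Rightarrow> real ^ 'n \<Rightarrow> real) \<Rightarrow>
   ((real ^ 'n \<Rightarrow> real) \<Rightarrow> (real ^ 'n \<Rightarrow> real) \<Rightarrow> real ^ 'n \<Rightarrow> real) \<Rightarrow>
   'w measure \<Rightarrow> (real \<Rightarrow> 'w measure) \<Rightarrow> (real \<Rightarrow> 'w \<Rightarrow> real) \<Rightarrow>
   (nat \<Rightarrow> 'w \<Rightarrow> real ^ 'n \<Rightarrow> real) \<Rightarrow> bool" where
  "scheme_solution D \<T> T N q u\<^sub>0 G DG M F W u \<longleftrightarrow>
     (let \<tau> = T / real N; t = (\<lambda>n. real n * \<tau>);
          \<Delta>W = (\<lambda>n \<omega>. W (t (Suc n)) \<omega> - W (t n) \<omega>)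
      in (\<forall>n\<le>N. \<forall>\<omega>\<in>space M. u n \<omega> \<in> V_h D \<T>) \<and>
         (\<forall>n\<le>N. \<forall>x. (\<lambda>\<omega>. u n \<omega> x) \<in> borel_measurable (F (t n))) \<and>
         (AE \<omega> in M. u 0 \<omega> = P_h D \<T> u\<^sub>0) \<and>
         (\<forall>n<N. AE \<omega> in M. \<forall>v \<in> V_h D \<T>.
            l2_inner D (\<lambda>x. u (Suc n) \<omega> x - u n \<omega> x) v + \<tau> * grad_inner D (u (Suc n) \<omega>) v
            = \<tau> * l2_inner D (I_h D \<T> (\<lambda>x. u (Suc n) \<omega> x - (u (Suc n) \<omega> x) ^ q)) v
              + l2_inner D (G (u n \<omega>)) v * \<Delta>W n \<omega>
              + 1 / 2 * l2_inner D (\<lambda>x. DG (u n \<omega>) (G (u n \<omega>)) x * ((\<Delta>W n \<omega>)\<^sup>2 - \<tau>)) v))"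

end

theory Submission
  imports Defs "HOL-Real_Asymp.Real_Asymp"
begin

text \<open>Test the scheme with \<open>v = u\<^sup>n\<^sup>+\<^sup>1\<close>. The gradient term is nonnegative, so everything
  depends on the sign of the reaction term \<open>(I\<^sub>h F, u)\<close> with \<open>F = u - u^q\<close>. On one simplex \<open>K\<close> the
  \<open>L\<^sup>2\<close>-product of two affine functions with nodal values \<open>f\<close> and \<open>g\<close> is
  \<open>B\<^sub>K (\<Sum> f g + \<Sum> f \<Sum> g)\<close> with \<open>B\<^sub>K > 0\<close> (\<open>mass_matrix\<close>). For three nodes and any odd \<open>q\<close>,
  and for four nodes and \<open>q \<in> {3, 5}\<close>, the form \<open>\<Sum> u^(q+1) + \<Sum> u^q \<Sum> u\<close> is strictly positive
  for \<open>u \<noteq> 0\<close>, hence by homogeneity at least \<open>c \<Sum> u^(q+1)\<close>; for four nodes and large powers, such as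
  \<open>q = 13\<close>, it takes negative values. Since \<open>q + 1 > 2\<close>, this term absorbs the quadratic contribution of \<open>u\<close>, so that \<open>(I\<^sub>h F, u)\<close> is bounded by a
  constant times the volume of \<open>D\<close> (\<open>mass_form_reaction_bound\<close>, \<open>reaction_bound\<close>), and the energy estimate
  holds for time steps of any size.

  The nodal interpolant is set to \<open>0\<close> at the boundary nodes, so this argument requires that functions in
  \<open>V\<^sub>h\<close> really vanish there. This is a trace theorem for continuous functions in \<open>H\<^sub>0\<^sup>1\<close>: a test function is
  at most of size \<open>\<delta>\<close> times its derivative on a strip of width \<open>\<delta>\<close> along a face, in the \<open>L\<^sup>2\<close> sense,
  whereas a continuous function that is nonzero at a boundary point has a norm of order at least
  \<open>\<delta>\<close> to the power \<open>1/2\<close> there (\<open>H10_continuous_zero_on_boundary\<close>). For the initial value one needs that the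
  projection \<open>P\<^sub>h\<close> exists, hence that \<open>V\<^sub>h\<close> is a linear space; as weak derivatives are arbitrary
  representatives, this rests on their uniqueness, i.e. on the fundamental lemma of the calculus of
  variations.

  Writing \<open>Y\<^sub>n = 1 + \<parallel>u\<^sup>n\<parallel>\<^sup>2\<close>, the energy estimate becomes
  \<open>Y\<^sub>n\<^sub>+\<^sub>1 \<le> Y\<^sub>n + a \<Delta>W + b (\<Delta>W\<^sup>2 - \<tau>) + K Y\<^sub>n (\<tau> + \<Delta>W\<^sup>2 + (\<Delta>W\<^sup>2 - \<tau>)\<^sup>2)\<close> with coefficients \<open>a\<close>, \<open>b\<close>
  that are known at time \<open>t\<^sub>n\<close> and bounded by \<open>K Y\<^sub>n\<close>. In the expectation of the \<open>m\<close>-th power the two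
  terms linear in \<open>a\<close> and \<open>b\<close> vanish by independence and everything else is of order \<open>\<tau>\<close>
  (\<open>moment_step\<close>); iterating gives the bound for all integer moments, and these dominate the real ones.\<close>

section \<open>Square-integrable functions\<close>

lemma L2_spaceI: "f \<in> borel_measurable (lebesgue_on D) \<Longrightarrow> integrable (lebesgue_on D) (\<lambda>x. (f x)\<^sup>2) \<Longrightarrow> f \<in> L2_space D"
  by (simp add: L2_space_def)

lemma L2_measurable [measurable_dest]: "f \<in> L2_space D \<Longrightarrow> f \<in> borel_measurable (lebesgue_on D)"
  by (simp add: L2_space_def)

lemma L2_square_integrable: "f \<in> L2_space D \<Longrightarrow> integrable (lebesgue_on D) (\<lambda>x. (f x)\<^sup>2)"
  by (simp add: L2_space_def)

lemma L2_mult_integrable [intro]: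
  assumes f: "f \<in> L2_space D" and g: "g \<in> L2_space D"
  shows "integrable (lebesgue_on D) (\<lambda>x. f x * g x)"
proof (rule Bochner_Integration.integrable_bound)
  show "integrable (lebesgue_on D) (\<lambda>x. (f x)\<^sup>2 + (g x)\<^sup>2)"
    using f g by (intro Bochner_Integration.integrable_add L2_square_integrable)
  show "(\<lambda>x. f x * g x) \<in> borel_measurable (lebesgue_on D)" using f g by measurable
  have "\<bar>a * b\<bar> \<le> \<bar>a\<^sup>2 + b\<^sup>2\<bar>" for a b :: real
    using sum_squares_bound[of a b] sum_squares_bound[of "-a" b] by (simp add: abs_le_iff)
  then show "AE x in lebesgue_on D. norm (f x * g x) \<le> norm ((f x)\<^sup>2 + (g x)\<^sup>2)" by simp
qed

lemma L2_lin:
  assumes f: "f \<in> L2_space D" and g: "g \<in> L2_space D"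
  shows "(\<lambda>x. a * f x + b * g x) \<in> L2_space D"
proof (rule L2_spaceI)
  show "(\<lambda>x. a * f x + b * g x) \<in> borel_measurable (lebesgue_on D)" using f g by measurable
  have "integrable (lebesgue_on D) (\<lambda>x. a\<^sup>2 * (f x)\<^sup>2 + 2 * a * b * (f x * g x) + b\<^sup>2 * (g x)\<^sup>2)"
    using f g by (intro Bochner_Integration.integrable_add integrable_mult_right L2_square_integrable L2_mult_integrable)
  then show "integrable (lebesgue_on D) (\<lambda>x. (a * f x + b * g x)\<^sup>2)"
    by (rule back_subst[of "integrable _"]) (auto simp: power2_eq_square algebra_simps)
qed

lemma L2_add: "f \<in> L2_space D \<Longrightarrow> g \<in> L2_space D \<Longrightarrow> (\<lambda>x. f x + g x) \<in> L2_space D"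
  using L2_lin[of f D g 1 1] by simp

lemma L2_diff: "f \<in> L2_space D \<Longrightarrow> g \<in> L2_space D \<Longrightarrow> (\<lambda>x. f x - g x) \<in> L2_space D"
  using L2_lin[of f D g 1 "-1"] by simp

lemma L2_cmult: "f \<in> L2_space D \<Longrightarrow> (\<lambda>x. a * f x) \<in> L2_space D"
  using L2_lin[of f D f a 0] by simp

lemma L2_zero: "(\<lambda>_. 0) \<in> L2_space D"
  by (rule L2_spaceI) auto

lemma L2_sum: "(\<And>i. i \<in> I \<Longrightarrow> f i \<in> L2_space D) \<Longrightarrow> (\<lambda>x. \<Sum>i\<in>I. f i x) \<in> L2_space D"
  by (induction I rule: infinite_finite_induct) (auto simp: L2_zero L2_add)

lemma l2_inner_commute: "l2_inner D f g = l2_inner D g f"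
  by (simp add: l2_inner_def mult.commute)

lemma l2_inner_lin_left:
  assumes "f \<in> L2_space D" "g \<in> L2_space D" "h \<in> L2_space D"
  shows "l2_inner D (\<lambda>x. a * f x + b * g x) h = a * l2_inner D f h + b * l2_inner D g h"
proof -
  have "l2_inner D (\<lambda>x. a * f x + b * g x) h = (LINT x|lebesgue_on D. a * (f x * h x) + b * (g x * h x))"
    unfolding l2_inner_def by (intro Bochner_Integration.integral_cong) (auto simp: algebra_simps)
  also have "\<dots> = a * l2_inner D f h + b * l2_inner D g h"
    unfolding l2_inner_def using assms
    by (subst Bochner_Integration.integral_add) (auto intro!: integrable_mult_right)
  finally show ?thesis .
qed

lemma l2_inner_diff_left:
  "f \<in> L2_space D \<Longrightarrow> g \<in> L2_space D \<Longrightarrow> h \<in> L2_space D \<Longrightarrow> l2_inner D (\<lambda>x. f x - g x) h = l2_inner D f h - l2_inner D g h"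
  using l2_inner_lin_left[of f D g h 1 "-1"] by simp

lemma l2_inner_cmult_left: "l2_inner D (\<lambda>x. a * f x) h = a * l2_inner D f h"
  by (simp add: l2_inner_def mult.assoc)

lemma l2_inner_diff_right:
  "f \<in> L2_space D \<Longrightarrow> g \<in> L2_space D \<Longrightarrow> h \<in> L2_space D \<Longrightarrow> l2_inner D h (\<lambda>x. f x - g x) = l2_inner D h f - l2_inner D h g"
  using l2_inner_diff_left[of f D g h] by (simp add: l2_inner_commute)

lemma l2_inner_lin_right:
  assumes "f \<in> L2_space D" "g \<in> L2_space D" "h \<in> L2_space D"
  shows "l2_inner D h (\<lambda>x. a * f x + b * g x) = a * l2_inner D h f + b * l2_inner D h g"
  using l2_inner_lin_left[OF assms, of a b] by (simp add: l2_inner_commute)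

lemma l2_inner_cmult_right: "l2_inner D h (\<lambda>x. a * f x) = a * l2_inner D h f"
  by (simp add: l2_inner_def mult.left_commute)

lemma l2_inner_self_nonneg [simp]: "0 \<le> l2_inner D f f"
  unfolding l2_inner_def by (intro integral_nonneg_AE) auto

lemma l2_norm_nonneg [simp]: "0 \<le> l2_norm D f"
  by (simp add: l2_norm_def)

lemma l2_norm_square: "(l2_norm D f)\<^sup>2 = l2_inner D f f"
  by (simp add: l2_norm_def)

text \<open>The squared norms of the combinations of \<open>f\<close> and \<open>g\<close> are nonnegative; the coefficients chosen are
  \<open>c\<close> and \<open>- b\<close>, the minimiser of the quadratic form. As \<open>l2_norm\<close> is only a seminorm, the degenerate
  case \<open>c = 0\<close> is separate.\<close>

lemma l2_Cauchy_Schwarz: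
  assumes f: "f \<in> L2_space D" and g: "g \<in> L2_space D"
  shows "\<bar>l2_inner D f g\<bar> \<le> l2_norm D f * l2_norm D g"
proof -
  define a b c where "a = l2_inner D f f" "b = l2_inner D f g" "c = l2_inner D g g"
  have nn: "0 \<le> a" "0 \<le> c" by (auto simp: a_b_c_def)
  have "(c * c) * a - 2 * (b * c) * b + b * b * c \<ge> 0" and q1: "a + 2 * t * b + t * t * c \<ge> 0" for t
  proof -
    have q: "0 \<le> s * s * a + 2 * s * t * b + t * t * c" for s t
    proof -
      have "0 \<le> l2_inner D (\<lambda>x. s * f x + t * g x) (\<lambda>x. s * f x + t * g x)" by simp
      also have "\<dots> = s * s * a + 2 * s * t * b + t * t * c"
        using f g by (simp add: l2_inner_lin_left l2_inner_lin_right L2_lin a_b_c_def l2_inner_commute[of D g f] algebra_simps)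
      finally show ?thesis .
    qed
    show "(c * c) * a - 2 * (b * c) * b + b * b * c \<ge> 0" using q[of c "- b"] by (simp add: algebra_simps)
    show "a + 2 * t * b + t * t * c \<ge> 0" using q[of 1 t] by simp
  qed
  then have q2: "0 \<le> c * (a * c - b * b)" by (simp add: algebra_simps)
  have "b\<^sup>2 \<le> a * c"
  proof (cases "c = 0")
    case True
    have "b = 0"
    proof (rule ccontr)
      assume "b \<noteq> 0"
      then show False using q1[of "- (a + 1) / (2 * b)"] True nn by (simp add: field_simps)
    qed
    then show ?thesis using True by simp
  next
    case False
    then show ?thesis using q2 nn by (simp add: zero_le_mult_iff power2_eq_square)
  qed
  then have "b\<^sup>2 \<le> (l2_norm D f * l2_norm D g)\<^sup>2"
    by (simp add: power_mult_distrib l2_norm_square a_b_c_def)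
  then show ?thesis unfolding a_b_c_def by (simp add: abs_le_square_iff[symmetric])
qed

lemma l2_norm_add_square:
  assumes "f \<in> L2_space D" "g \<in> L2_space D"
  shows "(l2_norm D (\<lambda>x. f x + g x))\<^sup>2 = (l2_norm D f)\<^sup>2 + 2 * l2_inner D f g + (l2_norm D g)\<^sup>2"
  using assms l2_inner_lin_left[of f D g "\<lambda>x. 1 * f x + 1 * g x" 1 1] l2_inner_lin_right[of f D g _ 1 1]
  by (simp add: l2_norm_square L2_add l2_inner_commute[of D g f])

lemma l2_norm_triangle:
  assumes "f \<in> L2_space D" "g \<in> L2_space D"
  shows "l2_norm D (\<lambda>x. f x + g x) \<le> l2_norm D f + l2_norm D g"
proof -
  have "(l2_norm D (\<lambda>x. f x + g x))\<^sup>2 \<le> (l2_norm D f + l2_norm D g)\<^sup>2"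
    using l2_Cauchy_Schwarz[OF assms] by (simp add: l2_norm_add_square[OF assms] power2_sum)
  then show ?thesis by (rule power2_le_imp_le) simp
qed

lemma l2_norm_cmult: "l2_norm D (\<lambda>x. a * f x) = \<bar>a\<bar> * l2_norm D f"
  by (simp add: l2_norm_def l2_inner_cmult_left l2_inner_cmult_right real_sqrt_mult flip: mult.assoc power2_eq_square)

lemma l2_norm_minus_commute: "l2_norm D (\<lambda>x. f x - g x) = l2_norm D (\<lambda>x. g x - f x)"
  by (simp add: l2_norm_def l2_inner_def algebra_simps)

lemma l2_norm_triangle_diff:
  assumes "f \<in> L2_space D" "g \<in> L2_space D"
  shows "l2_norm D f \<le> l2_norm D (\<lambda>x. f x - g x) + l2_norm D g"
  using l2_norm_triangle[OF L2_diff[OF assms] assms(2)] by simp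

lemma l2_norm_sum_le:
  assumes "finite I" "\<And>i. i \<in> I \<Longrightarrow> f i \<in> L2_space D"
  shows "l2_norm D (\<lambda>x. \<Sum>i\<in>I. f i x) \<le> (\<Sum>i\<in>I. l2_norm D (f i))"
  using assms
proof (induction I rule: finite_induct)
  case empty
  then show ?case by (simp add: l2_norm_def l2_inner_def)
next
  case (insert i I)
  then have "l2_norm D (\<lambda>x. f i x + (\<Sum>i\<in>I. f i x)) \<le> l2_norm D (f i) + l2_norm D (\<lambda>x. \<Sum>i\<in>I. f i x)"
    by (intro l2_norm_triangle L2_sum) auto
  with insert show ?case by fastforce
qed

lemma L2_bounded:
  assumes D: "D \<in> sets lebesgue" "bounded D" and f: "f \<in> borel_measurable (lebesgue_on D)"
    and b: "\<And>x. x \<in> D \<Longrightarrow> \<bar>f x\<bar> \<le> B"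
  shows "f \<in> L2_space D"
proof (rule L2_spaceI[OF f])
  interpret finite_measure "lebesgue_on D"
    by (rule finite_measure_lebesgue_on) (use D in \<open>simp add: bounded_set_imp_lmeasurable\<close>)
  have "integrable (lebesgue_on D) (\<lambda>x. B\<^sup>2)" by simp
  then show "integrable (lebesgue_on D) (\<lambda>x. (f x)\<^sup>2)"
  proof (rule Bochner_Integration.integrable_bound)
    show "AE x in lebesgue_on D. norm ((f x)\<^sup>2) \<le> norm (B\<^sup>2)"
    proof (rule AE_I2)
      fix x assume "x \<in> space (lebesgue_on D)"
      then have "\<bar>f x\<bar> \<le> \<bar>B\<bar>" using b[of x] by (auto simp: space_restrict_space)
      then show "norm ((f x)\<^sup>2) \<le> norm (B\<^sup>2)" by (simp add: abs_le_square_iff)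
    qed
  qed (use f in measurable)
qed

lemma continuous_on_closure_L2:
  assumes D: "D \<in> sets lebesgue" "bounded D" and f: "continuous_on (closure D) f"
  shows "f \<in> L2_space D"
proof -
  have "compact (closure D)" using D by simp
  then have "bounded (f ` closure D)" using f compact_continuous_image compact_imp_bounded by blast
  then obtain B where "\<And>x. x \<in> closure D \<Longrightarrow> \<bar>f x\<bar> \<le> B" by (auto simp: bounded_iff)
  moreover have "f \<in> borel_measurable (lebesgue_on D)"
    by (rule continuous_imp_measurable_on_sets_lebesgue[OF continuous_on_subset[OF f closure_subset] D(1)])
  ultimately show ?thesis using D closure_subset by (intro L2_bounded) auto
qed

section \<open>An inequality for nodal values\<close>

text \<open>Up to a positive factor, this is the \<open>L\<^sup>2\<close>-product on a simplex with vertex set \<open>C\<close> of the affine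
  functions with nodal values \<open>f\<close> and \<open>g\<close>.\<close>

definition mass_form :: "'a set \<Rightarrow> ('a \<Rightarrow> real) \<Rightarrow> ('a \<Rightarrow> real) \<Rightarrow> real" where
  "mass_form C f g = (\<Sum>a\<in>C. f a * g a) + (\<Sum>a\<in>C. f a) * (\<Sum>a\<in>C. g a)"

lemma odd_power_sum_mult_nonneg:
  fixes x y :: real assumes "odd q" shows "0 \<le> (x ^ q + y ^ q) * (x + y)"
proof (cases "- y \<le> x")
  case True
  then have "(- y) ^ q \<le> x ^ q" using assms by (rule power_mono_odd[rotated])
  then show ?thesis using True assms by simp
next
  case False
  then have "x ^ q \<le> (- y) ^ q" using assms by (intro power_mono_odd) auto
  then show ?thesis using False assms by (simp add: mult_nonpos_nonpos)
qed

text \<open>Two of the three values, say \<open>y\<close> and \<open>z\<close>, do not have opposite signs, so their mixed terms are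
  nonnegative. The mixed terms of \<open>x\<close> with \<open>y\<close> and with \<open>z\<close> are compensated by the diagonal, because
  \<open>(x^q + y^q) (x + y) \<ge> 0\<close>; the squares of \<open>y\<close> and \<open>z\<close> that are left over make the form definite.\<close>

lemma mass_form_pos_triangle:
  fixes f :: "'a \<Rightarrow> real"
  assumes q: "odd q" and C: "card C = 3" and nz: "\<exists>a\<in>C. f a \<noteq> 0"
  shows "0 < mass_form C (\<lambda>a. f a ^ q) f"
proof -
  have ev: "even (q + 1)" "even (q - 1)" using q by auto
  have key: "0 < 2 * (x ^ (q+1) + y ^ (q+1) + z ^ (q+1)) + (x ^ q * y + x * y ^ q) + (x ^ q * z + x * z ^ q) + (y ^ q * z + y * z ^ q)"
    if yz: "0 \<le> y * z" and nz: "x \<noteq> 0 \<or> y \<noteq> 0 \<or> z \<noteq> 0" for x y z :: real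
  proof -
    have s: "y ^ q * z + y * z ^ q = y * z * (y ^ (q - 1) + z ^ (q - 1))"
      using q by (cases q) (auto simp: algebra_simps)
    have "0 \<le> y ^ q * z + y * z ^ q" unfolding s by (intro mult_nonneg_nonneg[OF yz] add_nonneg_nonneg zero_le_even_power[OF ev(2)])
    moreover have "0 \<le> (x ^ q + y ^ q) * (x + y)" "0 \<le> (x ^ q + z ^ q) * (x + z)"
      using q by (rule odd_power_sum_mult_nonneg)+
    moreover have "2 * (x ^ (q+1) + y ^ (q+1) + z ^ (q+1)) + (x ^ q * y + x * y ^ q) + (x ^ q * z + x * z ^ q) + (y ^ q * z + y * z ^ q)
      = (x ^ q + y ^ q) * (x + y) + (x ^ q + z ^ q) * (x + z) + (y ^ q * z + y * z ^ q) + y ^ (q+1) + z ^ (q+1)"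
      by (simp add: algebra_simps)
    moreover have "0 \<le> y ^ (q+1)" "0 \<le> z ^ (q+1)" by (rule zero_le_even_power[OF ev(1)])+
    moreover have "y \<noteq> 0 \<Longrightarrow> 0 < y ^ (q+1)" "z \<noteq> 0 \<Longrightarrow> 0 < z ^ (q+1)" "x \<noteq> 0 \<Longrightarrow> 0 < x ^ (q+1)"
      using ev(1) zero_less_power_eq[of _ "q + 1"] by blast+
    ultimately show ?thesis
    proof (cases "y = 0 \<and> z = 0")
      case True
      then show ?thesis using nz \<open>x \<noteq> 0 \<Longrightarrow> 0 < x ^ (q+1)\<close> q by (auto simp: zero_power odd_pos)
    qed auto
  qed
  obtain i j k where ijk: "C = {i, j, k}" "i \<noteq> j" "i \<noteq> k" "j \<noteq> k"
    using C by (auto simp: card_3_iff)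
  have e: "mass_form C (\<lambda>a. f a ^ q) f = 2 * (f i ^ (q+1) + f j ^ (q+1) + f k ^ (q+1))
    + (f i ^ q * f j + f i * f j ^ q) + (f i ^ q * f k + f i * f k ^ q) + (f j ^ q * f k + f j * f k ^ q)"
    using ijk by (simp add: mass_form_def algebra_simps)
  have "0 \<le> f j * f k \<or> 0 \<le> f i * f k \<or> 0 \<le> f i * f j"
    by (auto simp: zero_le_mult_iff)
  then show ?thesis
    using key[of "f j" "f k" "f i"] key[of "f i" "f k" "f j"] key[of "f i" "f j" "f k"] nz
    unfolding e by (auto simp: ijk(1) add_ac mult.commute)
qed

lemma card_4_iff: "card C = 4 \<longleftrightarrow> (\<exists>i j k l. C = {i,j,k,l} \<and> distinct [i,j,k,l])"
proof
  assume "card C = 4"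
  then have "card C = Suc 3" by simp
  then obtain i B where B: "C = insert i B" "i \<notin> B" "card B = 3"
    by (metis card_eq_SucD)
  then obtain j k l where "B = {j,k,l}" "j \<noteq> k" "j \<noteq> l" "k \<noteq> l" by (auto simp: card_3_iff)
  then show "\<exists>i j k l. C = {i,j,k,l} \<and> distinct [i,j,k,l]" using B by auto
qed auto

text \<open>With \<open>s = \<Sum> u\<close> the form is \<open>\<Sum> (u^4 + s u^3)\<close>. Adding a multiple of \<open>\<Sum> (s/4 - u) = 0\<close> to it does
  not change it, and with the multiple \<open>s^3/8\<close> each summand becomes positive unless \<open>s = 0\<close>; the
  polynomial \<open>P\<close> below is a sum-of-squares certificate.\<close>

lemma mass_form_pos_tetrahedron_3:
  fixes f :: "'a \<Rightarrow> real"
  assumes C: "card C = 4" and nz: "\<exists>a\<in>C. f a \<noteq> 0"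
  shows "0 < mass_form C (\<lambda>a. f a ^ 3) f"
proof -
  have fin: "finite C" using C card.infinite by fastforce
  define s where "s = (\<Sum>a\<in>C. f a)"
  define P where "P u = (u\<^sup>2 + s * u / 2 - 3 / 20 * s\<^sup>2)\<^sup>2 + s\<^sup>2 * ((u + s / 4)\<^sup>2 / 20 + 9 / 1600 * s\<^sup>2)" for u
  have P: "P u = u ^ 4 + s * u ^ 3 - s ^ 3 * u / 8 + s ^ 4 / 32" for u
    unfolding P_def by (simp add: power2_eq_square power3_eq_cube power4_eq_xxxx field_simps)
  have "mass_form C (\<lambda>a. f a ^ 3) f = (\<Sum>a\<in>C. f a ^ 4 + s * f a ^ 3)"
    by (simp add: mass_form_def s_def sum.distrib power4_eq_xxxx power3_eq_cube mult.commute flip: sum_distrib_left)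
  also have "\<dots> = (\<Sum>a\<in>C. P (f a))"
  proof -
    have "(\<Sum>a\<in>C. P (f a)) = (\<Sum>a\<in>C. f a ^ 4 + s * f a ^ 3) - s ^ 3 / 8 * (\<Sum>a\<in>C. f a) + 4 * (s ^ 4 / 32)"
      using C by (simp add: P sum.distrib sum_subtractf sum_distrib_left mult_ac sum_divide_distrib flip: sum_distrib_right)
    then show ?thesis by (simp add: s_def[symmetric] power3_eq_cube power4_eq_xxxx)
  qed
  also have "\<dots> > 0"
  proof (cases "s = 0")
    case True
    then show ?thesis using nz fin by (auto simp: P intro!: sum_pos2)
  next
    case False
    then have "0 < P u" for u unfolding P_def
      by (intro add_nonneg_pos mult_pos_pos) (auto simp: add_nonneg_pos)
    then show ?thesis using fin nz by (intro sum_pos) auto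
  qed
  finally show ?thesis .
qed

text \<open>Again a multiple of \<open>\<Sum> (s/4 - u) = 0\<close> is added. The multiple \<open>s^5/16\<close> makes all summands nonnegative, but for
  \<open>s \<noteq> 0\<close> they have the zeros \<open>u = (- 1 \<plusminus> sqrt 5) s / 4\<close>. All four summands cannot vanish
  together: the four zeros would have to add up to \<open>s\<close>, which contradicts the irrationality of \<open>sqrt 5\<close>.\<close>

lemma mass_form_pos_tetrahedron_5:
  fixes f :: "'a \<Rightarrow> real"
  assumes C: "card C = 4" and nz: "\<exists>a\<in>C. f a \<noteq> 0"
  shows "0 < mass_form C (\<lambda>a. f a ^ 5) f"
proof -
  have fin: "finite C" using C card.infinite by fastforce
  define s where "s = (\<Sum>a\<in>C. f a)"
  define P where "P u = (4 * u\<^sup>2 + 2 * s * u - s\<^sup>2)\<^sup>2 * (4 * u\<^sup>2 + s\<^sup>2) / 64" for u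
  have P: "P u = u ^ 6 + s * u ^ 5 - s ^ 5 * u / 16 + s ^ 6 / 64" for u
    unfolding P_def by (simp add: eval_nat_numeral field_simps)
  have P0: "0 \<le> P u" for u by (simp add: P_def)
  have "mass_form C (\<lambda>a. f a ^ 5) f = (\<Sum>a\<in>C. f a ^ 6 + s * f a ^ 5)"
    by (simp add: mass_form_def s_def sum.distrib sum_distrib_left eval_nat_numeral mult_ac)
  also have "\<dots> = (\<Sum>a\<in>C. P (f a))"
  proof -
    have "(\<Sum>a\<in>C. P (f a)) = (\<Sum>a\<in>C. f a ^ 6 + s * f a ^ 5) - s ^ 5 / 16 * (\<Sum>a\<in>C. f a) + 4 * (s ^ 6 / 64)"
      using C by (simp add: P sum.distrib sum_subtractf sum_distrib_left mult_ac sum_divide_distrib flip: sum_distrib_right)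
    then show ?thesis by (simp add: s_def[symmetric] eval_nat_numeral)
  qed
  also have "\<dots> > 0"
  proof (cases "s = 0")
    case True
    then show ?thesis using nz fin by (auto simp: P intro!: sum_pos2)
  next
    case False
    have "\<exists>a\<in>C. P (f a) \<noteq> 0"
    proof (rule ccontr)
      assume "\<not> ?thesis"
      then have z: "P (f a) = 0" if "a \<in> C" for a using that by auto
      have w: "\<exists>e\<in>{1, - 1}. 4 * f a + s = e * sqrt 5 * s" if "a \<in> C" for a
      proof -
        have "4 * (f a)\<^sup>2 + s\<^sup>2 \<noteq> 0" using False by (simp add: add_nonneg_eq_0_iff)
        then have "4 * (f a)\<^sup>2 + 2 * s * f a - s\<^sup>2 = 0" using z[OF that] by (simp add: P_def)
        then have "(4 * f a + s)\<^sup>2 = (sqrt 5 * s)\<^sup>2"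
          by (simp add: power2_eq_square algebra_simps)
        then show ?thesis by (simp add: power2_eq_iff)
      qed
      obtain i j k l where ijkl: "C = {i,j,k,l}" "distinct [i,j,k,l]" using C by (auto simp: card_4_iff)
      obtain e1 e2 e3 e4 where e: "e1 \<in> {1, - 1}" "e2 \<in> {1, - 1}" "e3 \<in> {1, - 1}" "e4 \<in> {1, - 1}"
        and fe: "4 * f i + s = e1 * sqrt 5 * s" "4 * f j + s = e2 * sqrt 5 * s"
        "4 * f k + s = e3 * sqrt 5 * s" "4 * f l + s = e4 * sqrt 5 * s"
        using w[of i] w[of j] w[of k] w[of l] ijkl(1) by blast
      have "s = f i + f j + f k + f l" using ijkl by (simp add: s_def)
      then have "8 * s = (4 * f i + s) + (4 * f j + s) + (4 * f k + s) + (4 * f l + s)" by simp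
      also have "\<dots> = ((e1 + e2 + e3 + e4) * sqrt 5) * s" unfolding fe by (simp add: algebra_simps)
      finally have "8 = (e1 + e2 + e3 + e4) * sqrt 5" using False by simp
      \<comment> \<open>The sum of the signs is an integer, and \<open>64 = 5 k\<^sup>2\<close> has no integer solution.\<close>
      then have "8\<^sup>2 = ((e1 + e2 + e3 + e4) * sqrt 5)\<^sup>2" by (rule arg_cong)
      then have "64 = (e1 + e2 + e3 + e4)\<^sup>2 * 5" by (simp add: power_mult_distrib)
      then show False using e by auto
    qed
    then show ?thesis using fin P0 by (metis less_eq_real_def sum_pos2)
  qed
  finally show ?thesis .
qed

text \<open>The form is homogeneous of degree \<open>q + 1\<close>, so strict positivity on the compact unit sphere suffices.\<close>

lemma mass_form_coercive:
  assumes pos: "\<And>f :: 'a::finite \<Rightarrow> real. \<exists>a. f a \<noteq> 0 \<Longrightarrow> 0 < mass_form UNIV (\<lambda>a. f a ^ q) f"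
    and q: "odd q"
  obtains c where "0 < c"
    "\<And>f :: 'a \<Rightarrow> real. c * (\<Sum>a\<in>UNIV. f a ^ (q + 1)) \<le> mass_form UNIV (\<lambda>a. f a ^ q) f"
proof -
  define Q where "Q u = mass_form UNIV (\<lambda>a. (u $ a) ^ q) (($) u)" for u :: "real ^ 'a"
  define p where "p u = (\<Sum>a\<in>UNIV. (u $ a) ^ (q + 1))" for u :: "real ^ 'a"
  have cont: "continuous_on (sphere 0 1) Q"
    unfolding Q_def mass_form_def by (intro continuous_intros)
  have ne: "sphere (0 :: real ^ 'a) 1 \<noteq> {}" by simp
  obtain u0 where u0: "u0 \<in> sphere 0 1" "\<And>u. u \<in> sphere 0 1 \<Longrightarrow> Q u0 \<le> Q u"
    using continuous_attains_inf[OF compact_sphere ne cont] by blast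
  have "u0 \<noteq> 0" using u0(1) by auto
  then have Q0: "0 < Q u0" unfolding Q_def by (intro pos) (auto simp: vec_eq_iff)
  define c where "c = Q u0 / CARD('a)"
  have c0: "0 < c" using Q0 by (simp add: c_def)
  have le: "c * p u \<le> Q u" if "u \<in> sphere 0 1" for u
  proof -
    have "p u \<le> (\<Sum>a\<in>(UNIV::'a set). 1)"
    proof (unfold p_def, intro sum_mono)
      fix a
      have "\<bar>u $ a\<bar> \<le> 1" using component_le_norm_cart[of u a] that by simp
      then show "(u $ a) ^ (q + 1) \<le> 1" by (metis abs_le_iff abs_ge_zero power_abs power_le_one abs_ge_self order_trans)
    qed
    then have "c * p u \<le> c * CARD('a)" using c0 by (intro mult_left_mono) auto
    then show ?thesis using u0(2)[OF that] by (simp add: c_def)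
  qed
  have "c * (\<Sum>a\<in>UNIV. f a ^ (q + 1)) \<le> mass_form UNIV (\<lambda>a. f a ^ q) f" for f :: "'a \<Rightarrow> real"
  proof (cases "\<exists>a. f a \<noteq> 0")
    case False
    then show ?thesis using q by (auto simp: mass_form_def zero_power odd_pos)
  next
    case True
    define u :: "real ^ 'a" where "u = (\<chi> a. f a)"
    have u0: "u \<noteq> 0" using True by (auto simp: u_def vec_eq_iff)
    define t where "t = norm u"
    have t: "t > 0" using u0 by (simp add: t_def)
    define v where "v = (1 / t) *\<^sub>R u"
    have v: "v \<in> sphere 0 1" using t by (simp add: v_def t_def)
    have fv: "f a = t * v $ a" for a using t by (simp add: v_def u_def)
    have "(\<Sum>a\<in>UNIV. f a ^ (q + 1)) = t ^ (q + 1) * p v"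
      by (simp add: fv p_def power_mult_distrib sum_distrib_left mult_ac)
    moreover have "mass_form UNIV (\<lambda>a. f a ^ q) f = t ^ (q + 1) * Q v"
    proof -
      have "(\<Sum>a\<in>UNIV. f a ^ q * f a) = t ^ (q + 1) * (\<Sum>a\<in>UNIV. (v $ a) ^ q * v $ a)"
        by (simp add: fv power_mult_distrib sum_distrib_left mult_ac)
      moreover have "(\<Sum>a\<in>UNIV. f a ^ q) = t ^ q * (\<Sum>a\<in>UNIV. (v $ a) ^ q)" "(\<Sum>a\<in>UNIV. f a) = t * (\<Sum>a\<in>UNIV. v $ a)"
        by (simp_all add: fv power_mult_distrib sum_distrib_left)
      ultimately show ?thesis
        by (simp add: Q_def mass_form_def distrib_left)
    qed
    ultimately show ?thesis using le[OF v] t by (simp add: mult.left_commute[of c])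
  qed
  then show ?thesis using that c0 by blast
qed

lemma mass_form_reindex: "inj_on h B \<Longrightarrow> mass_form (h ` B) f g = mass_form B (\<lambda>a. f (h a)) (\<lambda>a. g (h a))"
  by (simp add: mass_form_def sum.reindex)

text \<open>The linear part \<open>u\<close> of the reaction contributes at most \<open>m \<Sum> u\<^sup>2\<close>, which the coercive term
  \<open>c \<Sum> u^(q+1)\<close> absorbs up to a constant. The bound depends on the number of nodes only, not on the
  shape of the simplex.\<close>

lemma mass_form_reaction_bound:
  assumes "CARD('n::finite) = 2 \<and> q \<ge> 3 \<and> odd q \<or> CARD('n) = 3 \<and> q \<in> {3, 5}"
  obtains R where "0 \<le> R"
    "\<And>(C :: 'b set) f. card C = CARD('n) + 1 \<Longrightarrow> mass_form C (\<lambda>a. f a - f a ^ q) f \<le> R"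
proof -
  let ?U = "UNIV :: 'n option set"
  have q: "odd q" "q \<ge> 3" using assms by auto
  have card: "card ?U = CARD('n) + 1" by (simp add: card_UNIV_option)
  have "0 < mass_form ?U (\<lambda>a. f a ^ q) f" if "\<exists>a. f a \<noteq> 0" for f
    using assms
  proof (elim disjE conjE)
    assume "CARD('n) = 2"
    then show ?thesis using q that card by (intro mass_form_pos_triangle) auto
  next
    assume "CARD('n) = 3" "q \<in> {3, 5}"
    then show ?thesis using that card mass_form_pos_tetrahedron_3[of ?U f] mass_form_pos_tetrahedron_5[of ?U f]
      by auto
  qed
  then obtain c where c: "0 < c" "\<And>f. c * (\<Sum>a\<in>?U. f a ^ (q + 1)) \<le> mass_form ?U (\<lambda>a. f a ^ q) f"
    using mass_form_coercive[where 'a="'n option", OF _ q(1)] by metis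
  define m where "m = real (CARD('n) + 2)"
  have m: "m > 0" by (simp add: m_def)
  define r where "r = m + m\<^sup>2 / (4 * c)"
  have r: "m * s\<^sup>2 - c * s ^ (q + 1) \<le> r" for s
  proof (cases "\<bar>s\<bar> \<le> 1")
    case True
    then have "s\<^sup>2 \<le> 1" by (simp add: abs_square_le_1)
    moreover have "0 \<le> c * s ^ (q + 1)" using c q by (intro mult_nonneg_nonneg zero_le_even_power) auto
    moreover have "m * s\<^sup>2 \<le> m" using \<open>s\<^sup>2 \<le> 1\<close> m by (simp add: mult_left_le)
    moreover have "0 \<le> m\<^sup>2 / (4 * c)" using c(1) by simp
    ultimately show ?thesis unfolding r_def by linarith
  next
    case False
    then have "\<bar>s\<bar> ^ 4 \<le> \<bar>s\<bar> ^ (q + 1)" using q by (intro power_increasing) auto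
    then have "s ^ 4 \<le> s ^ (q + 1)" using q power_even_abs[of "q + 1" s] power_even_abs[of 4 s] by simp
    then have "m * s\<^sup>2 - c * s ^ (q + 1) \<le> m * s\<^sup>2 - c * (s\<^sup>2)\<^sup>2" using c by (simp flip: power_mult)
    also have "\<dots> = m\<^sup>2 / (4 * c) - c * (s\<^sup>2 - m / (2 * c))\<^sup>2"
      using c by (simp add: power2_eq_square field_simps)
    also have "\<dots> \<le> r"
    proof -
      have "0 \<le> c * (s\<^sup>2 - m / (2 * c))\<^sup>2" using c(1) by simp
      then show ?thesis using m unfolding r_def by linarith
    qed
    finally show ?thesis .
  qed
  have "mass_form C (\<lambda>a. f a - f a ^ q) f \<le> (m - 1) * r" if C: "card C = CARD('n) + 1" for C :: "'b set" and f
  proof -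
    have fin: "finite C" using C by (metis card.infinite add_is_0 zero_neq_one)
    obtain h where h: "bij_betw h ?U C"
      using finite_same_card_bij[of ?U C] fin C card by auto
    have hC: "C = h ` ?U" "inj_on h ?U" using h by (auto simp: bij_betw_def)
    let ?g = "\<lambda>a. f (h a)"
    have "mass_form C (\<lambda>a. f a - f a ^ q) f = mass_form ?U (\<lambda>a. ?g a - ?g a ^ q) ?g"
      unfolding hC(1) by (rule mass_form_reindex[OF hC(2)])
    also have "\<dots> = (\<Sum>a\<in>?U. (?g a)\<^sup>2) + (\<Sum>a\<in>?U. ?g a)\<^sup>2 - mass_form ?U (\<lambda>a. ?g a ^ q) ?g"
      by (simp add: mass_form_def power2_eq_square sum_subtractf algebra_simps)
    also have "(\<Sum>a\<in>?U. ?g a)\<^sup>2 \<le> card ?U * (\<Sum>a\<in>?U. (?g a)\<^sup>2)"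
      using Cauchy_Schwarz_ineq_sum[of "\<lambda>_. 1" ?g ?U] by simp
    also have "(\<Sum>a\<in>?U. (?g a)\<^sup>2) + card ?U * (\<Sum>a\<in>?U. (?g a)\<^sup>2) - mass_form ?U (\<lambda>a. ?g a ^ q) ?g
      \<le> (\<Sum>a\<in>?U. (?g a)\<^sup>2) + card ?U * (\<Sum>a\<in>?U. (?g a)\<^sup>2) - c * (\<Sum>a\<in>?U. ?g a ^ (q + 1))"
      using c(2)[of ?g] by simp
    also have "\<dots> = (\<Sum>a\<in>?U. m * (?g a)\<^sup>2 - c * ?g a ^ (q + 1))"
      by (simp add: card m_def sum_subtractf sum_distrib_left sum.distrib distrib_right)
    also have "\<dots> \<le> (\<Sum>a\<in>?U. r)" by (intro sum_mono r)
    also have "\<dots> = (m - 1) * r" by (simp add: card_UNIV_option m_def)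
    finally show ?thesis by simp
  qed
  moreover have "0 \<le> (m - 1) * r" using m c by (auto simp: m_def r_def intro!: mult_nonneg_nonneg add_nonneg_nonneg)
  ultimately show ?thesis using that by blast
qed

section \<open>Affine maps and barycentric coordinates\<close>

text \<open>The image of Lebesgue measure under an invertible affine map is again translation invariant, and such a
  measure is a multiple of Lebesgue measure: evaluate the integral of \<open>1\<^sub>A(x + y) 1\<^sub>B(y)\<close> with respect to
  the product of the two measures in both orders, for a ball \<open>B = - B\<close>. The factor
  is identified later, by applying the formula to sets whose images are known.\<close>

lemma haar_linear:
  fixes L :: "'a::euclidean_space \<Rightarrow> 'a"
  assumes "linear L" "inj L"
  obtains c where "0 < c" "distr lborel borel (\<lambda>x. L x + t) = density lborel (\<lambda>_. ennreal c)"
proof -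
  define T where "T = (\<lambda>x. L x + t)"
  define \<mu> where "\<mu> = distr lborel borel T"
  obtain L' where L': "linear L'" "\<And>x. L' (L x) = x" "\<And>x. L (L' x) = x"
    using linear_injective_isomorphism[OF assms] by auto
  have cL: "continuous_on UNIV L" and cL': "continuous_on UNIV L'"
    using assms(1) L'(1) by (auto intro: linear_continuous_on simp: linear_conv_bounded_linear)
  have [measurable]: "L \<in> borel_measurable borel" "L' \<in> borel_measurable borel"
    using cL cL' by (auto intro: borel_measurable_continuous_onI)
  have [measurable]: "T \<in> borel_measurable borel" unfolding T_def by measurable
  have s\<mu>[simp, measurable_cong]: "sets \<mu> = sets borel" "space \<mu> = UNIV" by (auto simp: \<mu>_def)
  have em: "emeasure \<mu> A = emeasure lborel (L' ` (\<lambda>x. x - t) ` A)" if "A \<in> sets borel" for A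
  proof -
    have "T -` A = L' ` (\<lambda>x. x - t) ` A"
    proof (intro equalityI subsetI)
      fix x assume "x \<in> T -` A"
      then show "x \<in> L' ` (\<lambda>x. x - t) ` A"
        using L'(2)[of x] by (auto simp: T_def image_image intro!: image_eqI[of _ _ "L x + t"])
    next
      fix x assume "x \<in> L' ` (\<lambda>x. x - t) ` A"
      then show "x \<in> T -` A" using L'(3) by (auto simp: T_def)
    qed
    then show ?thesis using that by (simp add: \<mu>_def emeasure_distr)
  qed
  have fin: "emeasure \<mu> (cball 0 r) < \<infinity>" for r
  proof -
    have "continuous_on UNIV (\<lambda>x. L' (x - t))"
      by (intro continuous_on_compose2[OF cL'] continuous_intros) auto
    then have "compact (L' ` (\<lambda>x. x - t) ` cball 0 r)"
      unfolding image_image by (rule compact_continuous_image[OF continuous_on_subset]) auto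
    from emeasure_compact_finite[OF this] show ?thesis by (subst em) auto
  qed
  have sf: "sigma_finite_measure \<mu>"
  proof
    show "\<exists>A. countable A \<and> A \<subseteq> sets \<mu> \<and> \<Union> A = space \<mu> \<and> (\<forall>a\<in>A. emeasure \<mu> a \<noteq> \<infinity>)"
    proof (intro exI[of _ "range (\<lambda>n::nat. cball 0 (real n))"] conjI)
      show "\<Union> (range (\<lambda>n::nat. cball (0::'a) (real n))) = space \<mu>"
        using real_arch_simple by (fastforce simp: )
      show "\<forall>a\<in>range (\<lambda>n::nat. cball (0::'a) (real n)). emeasure \<mu> a \<noteq> \<infinity>"
        using fin by (auto simp: less_top)
    qed auto
  qed
  interpret pair_sigma_finite lborel \<mu>
    using sf by (simp add: pair_sigma_finite_def lborel.sigma_finite_measure_axioms)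
  have inv\<mu>: "(\<integral>\<^sup>+ y. f (x + y) \<partial>\<mu>) = (\<integral>\<^sup>+ y. f y \<partial>\<mu>)" if [measurable]: "f \<in> borel_measurable borel" for f x
  proof -
    have "(\<integral>\<^sup>+ y. f (x + y) \<partial>\<mu>) = (\<integral>\<^sup>+ y. f (T (L' x + y)) \<partial>lborel)"
      by (simp add: \<mu>_def nn_integral_distr T_def linear_add[OF assms(1)] L' add_ac)
    also have "\<dots> = (\<integral>\<^sup>+ y. f (T y) \<partial>distr lborel borel ((+) (L' x)))"
      by (simp add: nn_integral_distr)
    also have "\<dots> = (\<integral>\<^sup>+ y. f (T y) \<partial>lborel)"
      by (simp only: lborel_distr_plus)
    also have "\<dots> = (\<integral>\<^sup>+ y. f y \<partial>\<mu>)" by (simp add: \<mu>_def nn_integral_distr)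
    finally show ?thesis .
  qed
  have inv: "(\<integral>\<^sup>+ y. f (y + x) \<partial>lborel) = (\<integral>\<^sup>+ y. f y \<partial>lborel)" if [measurable]: "f \<in> borel_measurable borel"
    for f :: "'a \<Rightarrow> ennreal" and x
  proof -
    have "(\<integral>\<^sup>+ y. f (y + x) \<partial>lborel) = (\<integral>\<^sup>+ y. f y \<partial>distr lborel borel ((+) x))"
      by (simp add: nn_integral_distr add_ac)
    then show ?thesis by (simp only: lborel_distr_plus)
  qed
  have inv': "(\<integral>\<^sup>+ y. f (x - y) \<partial>lborel) = (\<integral>\<^sup>+ y. f (- y) \<partial>lborel)" if [measurable]: "f \<in> borel_measurable borel"
    for f :: "'a \<Rightarrow> ennreal" and x
    using inv[of "\<lambda>y. f (- y)" "- x"] by simp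
  define B :: "'a set" where "B = cball 0 1"
  have [measurable]: "B \<in> sets borel" by (simp add: B_def)
  have key: "emeasure lborel A * emeasure \<mu> B = emeasure \<mu> A * emeasure lborel B"
    if [measurable]: "A \<in> sets borel" for A
  proof -
    let ?f = "indicator A :: 'a \<Rightarrow> ennreal" and ?g = "indicator B :: 'a \<Rightarrow> ennreal"
    have "emeasure lborel A * emeasure \<mu> B = (\<integral>\<^sup>+ y. (\<integral>\<^sup>+ x. ?f x \<partial>lborel) * ?g y \<partial>\<mu>)"
      by (simp add: nn_integral_cmult)
    also have "\<dots> = (\<integral>\<^sup>+ y. (\<integral>\<^sup>+ x. ?f (x + y) * ?g y \<partial>lborel) \<partial>\<mu>)"
      by (intro nn_integral_cong) (subst nn_integral_multc, simp, simp only: inv[of ?f] borel_measurable_indicator that)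
    also have "\<dots> = (\<integral>\<^sup>+ x. (\<integral>\<^sup>+ y. ?f (x + y) * ?g y \<partial>\<mu>) \<partial>lborel)"
      by (intro Fubini') measurable
    also have "\<dots> = (\<integral>\<^sup>+ x. (\<integral>\<^sup>+ y. ?f y * ?g (y - x) \<partial>\<mu>) \<partial>lborel)"
    proof (rule nn_integral_cong)
      fix x
      show "(\<integral>\<^sup>+ y. ?f (x + y) * ?g y \<partial>\<mu>) = (\<integral>\<^sup>+ y. ?f y * ?g (y - x) \<partial>\<mu>)"
        using inv\<mu>[of "\<lambda>y. ?f y * ?g (y - x)" x] by simp
    qed
    also have "\<dots> = (\<integral>\<^sup>+ y. (\<integral>\<^sup>+ x. ?f y * ?g (y - x) \<partial>lborel) \<partial>\<mu>)"
      by (intro Fubini'[symmetric]) measurable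
    also have "\<dots> = (\<integral>\<^sup>+ y. ?f y * (\<integral>\<^sup>+ x. ?g (- x) \<partial>lborel) \<partial>\<mu>)"
      by (intro nn_integral_cong) (subst nn_integral_cmult, simp, simp add: inv'[of ?g])
    also have "(\<lambda>x. ?g (- x)) = ?g" by (auto simp: B_def indicator_def)
    finally show ?thesis by (simp add: nn_integral_multc)
  qed
  define c where "c = measure \<mu> B / measure lborel B"
  have Bl: "0 < emeasure lborel B" "emeasure lborel B < \<infinity>"
    using content_cball_pos[of 1 "0::'a"] emeasure_compact_finite[of B]
    by (auto simp: B_def measure_def enn2real_positive_iff)
  have Bm: "emeasure \<mu> B \<noteq> 0" "emeasure \<mu> B < \<infinity>"
  proof -
    show "emeasure \<mu> B < \<infinity>" using fin[of 1] by (simp add: B_def)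
    have "emeasure \<mu> UNIV = emeasure lborel (UNIV::'a set)"
      by (simp add: \<mu>_def emeasure_distr)
    then have "emeasure \<mu> UNIV \<noteq> 0" by simp
    then show "emeasure \<mu> B \<noteq> 0" using key[of UNIV] Bl by auto
  qed
  have mB: "measure \<mu> B > 0" "measure lborel B > 0"
    using Bl Bm by (auto simp: measure_def enn2real_positive_iff zero_less_iff_neq_zero)
  have c: "c > 0" using mB by (simp add: c_def)
  have "\<mu> = density lborel (\<lambda>_. ennreal c)"
  proof (rule measure_eqI)
    fix A assume "A \<in> sets \<mu>"
    then have [measurable]: "A \<in> sets borel" by simp
    have "emeasure \<mu> A * ennreal (measure lborel B) = emeasure lborel A * ennreal (measure \<mu> B)"
      using key[of A] Bl Bm by (simp add: emeasure_eq_ennreal_measure)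
    also have "ennreal (measure \<mu> B) = ennreal c * ennreal (measure lborel B)"
      using mB by (simp add: c_def flip: ennreal_mult)
    finally have "emeasure \<mu> A * ennreal (measure lborel B) = (emeasure lborel A * ennreal c) * ennreal (measure lborel B)"
      by (simp add: mult.assoc)
    then have "emeasure \<mu> A = emeasure lborel A * ennreal c"
      using mB(2) ennreal_mult_cancel_left[of "ennreal (measure lborel B)" "emeasure \<mu> A"]
      by (metis ennreal_eq_0_iff ennreal_neq_top mult.commute not_less)
    then show "emeasure \<mu> A = emeasure (density lborel (\<lambda>_. ennreal c)) A"
      by (simp add: emeasure_density_const mult.commute)
  qed simp
  then show ?thesis using that[of c] c by (simp add: \<mu>_def T_def)
qed

lemma integral_affine_image:
  fixes L :: "'a::euclidean_space \<Rightarrow> 'a"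
  assumes "linear L" "inj L"
  obtains c where "0 < c"
    "\<And>f::'a \<Rightarrow> real. f \<in> borel_measurable borel \<Longrightarrow> (\<integral>x. f (L x + t) \<partial>lborel) = c * (\<integral>x. f x \<partial>lborel)"
proof -
  obtain c where c: "0 < c" "distr lborel borel (\<lambda>x. L x + t) = density lborel (\<lambda>_. ennreal c)"
    using haar_linear[OF assms] by metis
  have [measurable]: "L \<in> borel_measurable borel"
    using assms by (auto intro: borel_measurable_continuous_onI linear_continuous_on simp: linear_conv_bounded_linear)
  have "(\<integral>x. f (L x + t) \<partial>lborel) = c * (\<integral>x. f x \<partial>lborel)" if [measurable]: "f \<in> borel_measurable borel" for f :: "'a \<Rightarrow> real"
  proof -
    have "(\<integral>x. f (L x + t) \<partial>lborel) = (\<integral>x. f x \<partial>distr lborel borel (\<lambda>x. L x + t))"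
      by (subst integral_distr) auto
    also have "\<dots> = c * (\<integral>x. f x \<partial>lborel)"
      using c(1) by (simp add: c(2) integral_density)
    finally show ?thesis .
  qed
  with c show ?thesis using that by blast
qed

text \<open>Relative to one of its points the other points of \<open>C\<close> are linearly independent, so a linear map can
  be prescribed on the differences.\<close>

lemma affine_interpolation:
  fixes C :: "'a::euclidean_space set" and g :: "'a \<Rightarrow> 'b::real_vector"
  assumes C: "\<not> affine_dependent C"
  obtains L t where "linear L" "\<And>a. a \<in> C \<Longrightarrow> L a + t = g a"
proof (cases "C = {}")
  case True
  then show ?thesis using that[of "\<lambda>_. 0" 0] linear_zero by auto
next
  case False
  then obtain a0 where a0: "a0 \<in> C" by auto
  define B where "B = (\<lambda>x. - a0 + x) ` (C - {a0})"
  have "independent B"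
    using affine_dependent_iff_dependent2[OF a0] C by (auto simp: B_def)
  from linear_independent_extend[OF this, of "\<lambda>v. g (v + a0) - g a0"]
  obtain L where L: "linear L" "\<And>v. v \<in> B \<Longrightarrow> L v = g (v + a0) - g a0" by auto
  have "L a + (g a0 - L a0) = g a" if "a \<in> C" for a
  proof (cases "a = a0")
    case False
    then have "a - a0 \<in> B" using that by (auto simp: B_def)
    from L(2)[OF this] show ?thesis by (simp add: linear_diff[OF L(1)] algebra_simps)
  qed simp
  then show ?thesis using that L(1) by blast
qed

lemma affine_interpolation_real:
  fixes C :: "'a::euclidean_space set" and g :: "'a \<Rightarrow> real"
  assumes C: "\<not> affine_dependent C"
  obtains c b where "\<And>a. a \<in> C \<Longrightarrow> c + b \<bullet> a = g a"
proof -
  obtain L t where L: "linear L" "\<And>a. a \<in> C \<Longrightarrow> L a + t = g a"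
    using affine_interpolation[OF C, of g] by metis
  have "L x = adjoint L 1 \<bullet> x" for x
    using adjoint_works[OF L(1), of x 1] by (simp add: inner_commute)
  then show ?thesis using that[of t "adjoint L 1"] L(2) by (simp add: add.commute)
qed

lemma affine_eq_hull:
  fixes L L' :: "'a::real_vector \<Rightarrow> 'b::real_vector"
  assumes L: "linear L" "linear L'" and eq: "\<And>a. a \<in> C \<Longrightarrow> L a + t = L' a + t'"
    and x: "x \<in> affine hull C"
  shows "L x + t = L' x + t'"
proof -
  have "affine {x. L x + t = L' x + t'}"
  proof (unfold affine_def, clarify)
    fix x y :: 'a and u v :: real
    assume h: "L x + t = L' x + t'" "L y + t = L' y + t'" "u + v = 1"
    have "t = u *\<^sub>R t + v *\<^sub>R t" "t' = u *\<^sub>R t' + v *\<^sub>R t'"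
      using h(3) by (simp_all flip: scaleR_add_left)
    then have "L (u *\<^sub>R x + v *\<^sub>R y) + t = u *\<^sub>R (L x + t) + v *\<^sub>R (L y + t)"
      "L' (u *\<^sub>R x + v *\<^sub>R y) + t' = u *\<^sub>R (L' x + t') + v *\<^sub>R (L' y + t')"
      by (simp_all add: linear_add[OF L(1)] linear_scale[OF L(1)] linear_add[OF L(2)] linear_scale[OF L(2)] scaleR_add_right add_ac)
    then show "L (u *\<^sub>R x + v *\<^sub>R y) + t = L' (u *\<^sub>R x + v *\<^sub>R y) + t'"
      using h by simp
  qed
  then have "affine hull C \<subseteq> {x. L x + t = L' x + t'}"
    using eq by (intro hull_minimal) auto
  then show ?thesis using x by auto
qed

lemma affine_eq_hull_real:
  fixes b b' :: "'a::real_inner"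
  assumes "\<And>a. a \<in> C \<Longrightarrow> c + b \<bullet> a = c' + b' \<bullet> a" "x \<in> affine hull C"
  shows "c + b \<bullet> x = c' + b' \<bullet> x"
proof -
  have l: "linear (\<lambda>x. b \<bullet> x)" for b :: 'a
    by (simp add: bounded_linear.linear bounded_linear_inner_right)
  show ?thesis using affine_eq_hull[OF l l, of C b c b' c' x] assms by (simp add: add.commute)
qed

lemma barycentric_coordinates:
  fixes C :: "(real ^ 'n) set"
  assumes C: "\<not> affine_dependent C" "card C = CARD('n) + 1"
  obtains bc :: "real ^ 'n \<Rightarrow> real ^ 'n \<Rightarrow> real"
  where "\<And>a. \<exists>c b. \<forall>x. bc a x = c + b \<bullet> x"
    "\<And>a b. a \<in> C \<Longrightarrow> b \<in> C \<Longrightarrow> bc a b = (if a = b then 1 else 0)"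
    "\<And>c b x. c + b \<bullet> x = (\<Sum>a\<in>C. (c + b \<bullet> a) * bc a x)"
    "convex hull C = {x. \<forall>a\<in>C. 0 \<le> bc a x}"
    "\<And>x. (\<Sum>a\<in>C. bc a x *\<^sub>R a) = x"
proof -
  have finC: "finite C" using C(1) by (rule aff_independent_finite)
  have hull: "affine hull C = UNIV"
  proof -
    have "aff_dim C = int CARD('n)" using C aff_dim_affine_independent[OF C(1)] by simp
    then show ?thesis using aff_dim_eq_full[of C] by simp
  qed
  have "\<exists>c b. \<forall>x\<in>C. c + b \<bullet> x = (if a = x then 1 else (0::real))" for a
    using affine_interpolation_real[OF C(1), of "\<lambda>x. if a = x then 1 else 0"] by metis
  then obtain c b where cb: "\<And>a x. x \<in> C \<Longrightarrow> c a + b a \<bullet> x = (if a = x then 1 else (0::real))"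
    by metis
  define bc where "bc a x = c a + b a \<bullet> x" for a x
  have bcd: "bc a x = (if a = x then 1 else 0)" if "x \<in> C" for a x
    using cb[OF that] by (simp add: bc_def)
  have repr: "c' + b' \<bullet> x = (\<Sum>a\<in>C. (c' + b' \<bullet> a) * bc a x)" for c' b' x
  proof -
    have e: "(\<Sum>a\<in>C. (c' + b' \<bullet> a) * bc a x) = (\<Sum>a\<in>C. (c' + b' \<bullet> a) * c a) + (\<Sum>a\<in>C. (c' + b' \<bullet> a) *\<^sub>R b a) \<bullet> x" for x
      by (simp add: bc_def inner_sum_left sum.distrib distrib_left)
    show ?thesis unfolding e
    proof (rule affine_eq_hull_real)
      show "x \<in> affine hull C" by (simp add: hull)
      fix y assume y: "y \<in> C"
      then show "c' + b' \<bullet> y = (\<Sum>a\<in>C. (c' + b' \<bullet> a) * c a) + (\<Sum>a\<in>C. (c' + b' \<bullet> a) *\<^sub>R b a) \<bullet> y"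
        unfolding e[symmetric] using finC sum.delta[OF finC, of y "\<lambda>a. c' + b' \<bullet> a"]
        by (simp add: bcd if_distrib[of "(*) _"] cong: if_cong)
    qed
  qed
  have one: "(\<Sum>a\<in>C. bc a x) = 1" for x using repr[of 1 0 x] by simp
  have idx: "(\<Sum>a\<in>C. bc a x *\<^sub>R a) = x" for x
  proof (rule euclidean_eqI)
    fix i :: "real ^ 'n" assume "i \<in> Basis"
    show "(\<Sum>a\<in>C. bc a x *\<^sub>R a) \<bullet> i = x \<bullet> i"
      using repr[of 0 i x] by (simp add: inner_sum_left inner_sum_right inner_commute mult.commute)
  qed
  have "convex hull C = {x. \<forall>a\<in>C. 0 \<le> bc a x}"
  proof (intro equalityI subsetI)
    fix x assume "x \<in> convex hull C"
    then obtain u where u: "\<forall>a\<in>C. 0 \<le> u a" "sum u C = 1" "(\<Sum>a\<in>C. u a *\<^sub>R a) = x"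
      by (auto simp: convex_hull_finite[OF finC])
    have "bc a x = u a" if "a \<in> C" for a
    proof -
      have "bc a x = (\<Sum>y\<in>C. u y) * c a + b a \<bullet> (\<Sum>y\<in>C. u y *\<^sub>R y)"
        using u(2,3) by (simp add: bc_def)
      also have "\<dots> = (\<Sum>y\<in>C. u y * bc a y)"
        by (simp add: inner_sum_right sum_distrib_right sum.distrib bc_def distrib_left)
      also have "\<dots> = (\<Sum>y\<in>C. if a = y then u y else 0)"
        by (intro sum.cong) (auto simp: bcd)
      finally show ?thesis using that finC by simp
    qed
    then show "x \<in> {x. \<forall>a\<in>C. 0 \<le> bc a x}" using u by simp
  next
    fix x assume "x \<in> {x. \<forall>a\<in>C. 0 \<le> bc a x}"
    then show "x \<in> convex hull C" unfolding convex_hull_finite[OF finC]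
      using one idx by (intro CollectI exI[of _ "\<lambda>a. bc a x"]) auto
  qed
  moreover have "\<exists>c b. \<forall>x. bc a x = c + b \<bullet> x" for a unfolding bc_def by blast
  ultimately show ?thesis using that[of bc] repr idx bcd by blast
qed

section \<open>The mass matrix of a simplex\<close>

text \<open>The geometry of a simplex enters the computation of its mass matrix only through the properties of
  the barycentric coordinates collected here.\<close>

locale barycentric =
  fixes C :: "(real ^ 'n) set" and bc :: "real ^ 'n \<Rightarrow> real ^ 'n \<Rightarrow> real"
  assumes affine: "\<exists>c b. \<forall>x. bc a x = c + b \<bullet> x"
    and nodal: "a \<in> C \<Longrightarrow> b \<in> C \<Longrightarrow> bc a b = (if a = b then 1 else 0)"
    and repr: "c + v \<bullet> x = (\<Sum>a\<in>C. (c + v \<bullet> a) * bc a x)"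
    and hull: "convex hull C = {x. \<forall>a\<in>C. 0 \<le> bc a x}"
    and ident: "(\<Sum>a\<in>C. bc a x *\<^sub>R a) = x"
    and indep: "\<not> affine_dependent C"
    and full: "card C = CARD('n) + 1"
begin

abbreviation "K \<equiv> convex hull C"

definition I :: "(real ^ 'n \<Rightarrow> real) \<Rightarrow> real" where
  "I p = (\<integral>x. indicator K x * p x \<partial>lborel)"

lemma finC: "finite C" using indep by (rule aff_independent_finite)

lemma compK: "compact K" using finC by (rule finite_imp_compact_convex_hull)

lemma intK: "continuous_on UNIV p \<Longrightarrow> integrable lborel (\<lambda>x. indicator K x * p x :: real)"
  using borel_integrable_compact[OF compK continuous_on_subset[of UNIV p]] by simp

lemma cont_bc [continuous_intros]: "continuous_on A (bc a)"
proof -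
  obtain c b where "\<And>x. bc a x = c + b \<bullet> x" using affine by metis
  then have "bc a = (\<lambda>x. c + b \<bullet> x)" by auto
  then show ?thesis by (simp add: continuous_intros)
qed

lemma meas_bc [measurable]: "bc a \<in> borel_measurable borel"
  by (intro borel_measurable_continuous_onI cont_bc)

lemma meas_ind [measurable]: "indicator K \<in> borel_measurable borel"
  using compK by (intro borel_measurable_indicator) (simp add: borel_compact)

lemma bc_affine_image:
  fixes L :: "real ^ 'n \<Rightarrow> real ^ 'n"
  assumes "linear L"
  shows "bc d (L x + t) = (\<Sum>a\<in>C. bc d (L a + t) * bc a x)"
proof -
  obtain c b where cb: "\<And>x. bc d x = c + b \<bullet> x" using affine by metis
  have "bc d (L x + t) = (c + b \<bullet> t) + adjoint L b \<bullet> x" for x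
    using adjoint_works[OF assms, of x b] by (simp add: cb inner_add_right inner_commute)
  then show ?thesis using repr[of "c + b \<bullet> t" "adjoint L b" x] by simp
qed

lemma bc_eqI: "(\<And>a. a \<in> C \<Longrightarrow> bc a x = bc a y) \<Longrightarrow> x = y"
  by (subst (1 2) ident[symmetric]) (rule sum.cong, auto)

lemma bc_combination:
  assumes "u + v = 1" shows "bc d (u *\<^sub>R x + v *\<^sub>R y) = u * bc d x + v * bc d y"
proof -
  obtain c b where cb: "\<And>x. bc d x = c + b \<bullet> x" using affine by metis
  have "c = u * c + v * c" using assms by (simp flip: distrib_right)
  then show ?thesis by (simp add: cb inner_add_right algebra_simps)
qed

lemma I_add: "continuous_on UNIV p \<Longrightarrow> continuous_on UNIV q \<Longrightarrow> I (\<lambda>x. p x + q x) = I p + I q"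
  unfolding I_def by (simp add: distrib_left Bochner_Integration.integral_add intK)

lemma I_cmult: "I (\<lambda>x. c * p x) = c * I p"
  unfolding I_def by (simp add: mult.left_commute[of _ c])

lemma affine_independent_hyperplane:
  assumes "K \<subseteq> {x. v \<bullet> x = \<beta>}" shows "v = 0"
proof -
  have "a \<in> C \<Longrightarrow> - \<beta> + v \<bullet> a = 0" for a
    using assms hull_subset[of C convex] by auto
  then have e: "- \<beta> + v \<bullet> x = 0" for x
    using repr[of "- \<beta>" v x] by simp
  show ?thesis using e[of v] e[of 0] by simp
qed

lemma vol_pos: "I (\<lambda>_. 1) > 0"
proof -
  have "interior K \<noteq> {}"
    using empty_interior_subset_hyperplane[of K] affine_independent_hyperplane by auto
  then have "\<not> negligible K"
    using open_not_negligible[of "interior K"] negligible_subset interior_subset by blast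
  then have "emeasure lborel K \<noteq> 0"
    using compK by (auto simp: negligible_iff_null_sets null_sets_def borel_compact null_sets_completionI)
  then have "measure lborel K \<noteq> 0"
    using emeasure_compact_finite[OF compK] by (auto simp: measure_def enn2real_eq_0_iff)
  then show ?thesis using measure_nonneg[of lborel K] by (simp add: I_def order_less_le)
qed

lemma I_affine_image:
  fixes t :: "real ^ 'n" and L :: "real ^ 'n \<Rightarrow> real ^ 'n"
  assumes "linear L" "\<And>x y. L x + t = L y + t \<Longrightarrow> x = y"
  obtains k where "0 < k"
    "\<And>f. f \<in> borel_measurable borel \<Longrightarrow> (\<integral>x. f (L x + t) \<partial>lborel) = k * (\<integral>x. f x \<partial>lborel :: real)"
proof -
  have "inj L" using assms(2) by (auto simp: inj_def)
  from integral_affine_image[OF assms(1) this, of t] show ?thesis using that by blast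
qed

lemma K_swap:
  assumes "a \<in> C" "b \<in> C" "\<And>d. d \<in> C \<Longrightarrow> bc d y = bc (Transposition.transpose a b d) x"
  shows "y \<in> K \<longleftrightarrow> x \<in> K"
proof -
  have "Transposition.transpose a b ` C = C"
    using assms(1,2) by (simp add: transpose_image_eq)
  then have "(\<forall>d\<in>C. 0 \<le> bc (Transposition.transpose a b d) x) \<longleftrightarrow> (\<forall>d\<in>C. 0 \<le> bc d x)"
    by (metis (no_types, lifting) imageE image_eqI)
  then show ?thesis using assms(3) by (simp add: hull)
qed


text \<open>Exchanging two vertices is an affine map of the simplex onto itself, so its volume factor is \<open>1\<close>.\<close>

lemma swap_map:
  assumes "a \<in> C" "b \<in> C"
  obtains L t where "linear L" "\<And>d x. d \<in> C \<Longrightarrow> bc d (L x + t) = bc (Transposition.transpose a b d) x"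
    "\<And>p. p \<in> borel_measurable borel \<Longrightarrow> (\<integral>x. p (L x + t) \<partial>lborel) = (\<integral>x. p x \<partial>lborel :: real)"
proof -
  obtain L t where L: "linear L" "\<And>e. e \<in> C \<Longrightarrow> L e + t = Transposition.transpose a b e"
    using affine_interpolation[OF indep, of "Transposition.transpose a b"] by metis
  have tr: "Transposition.transpose a b e \<in> C \<longleftrightarrow> e \<in> C" for e
    using assms by (auto simp: Transposition.transpose_def)
  have bcL: "bc d (L x + t) = bc (Transposition.transpose a b d) x" if "d \<in> C" for d x
  proof -
    have "bc d (L x + t) = (\<Sum>e\<in>C. if Transposition.transpose a b d = e then bc e x else 0)"
      proof (subst bc_affine_image[OF L(1)], rule sum.cong[OF refl])
      fix e assume e: "e \<in> C"
      have "d = Transposition.transpose a b e \<longleftrightarrow> Transposition.transpose a b d = e"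
        by (auto simp: Transposition.transpose_def)
      moreover have "Transposition.transpose a b e \<in> C" using tr e by blast
      ultimately show "bc d (L e + t) * bc e x = (if Transposition.transpose a b d = e then bc e x else 0)"
        using nodal[OF that, of "Transposition.transpose a b e"] by (simp only: L(2)[OF e] if_cancel split: if_split) simp
    qed
    also have "\<dots> = bc (Transposition.transpose a b d) x"
      using tr[of d] that by (subst sum.delta'[OF finC]) simp
    finally show ?thesis .
  qed
  have inj: "x = y" if "L x + t = L y + t" for x y
  proof (rule bc_eqI)
    fix d assume d: "d \<in> C"
    then have "Transposition.transpose a b d \<in> C" using tr by blast
    from bcL[OF this, of x] bcL[OF this, of y] have "bc d x = bc (Transposition.transpose a b d) (L x + t)"
      "bc d y = bc (Transposition.transpose a b d) (L y + t)" by simp_all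
    then show "bc d x = bc d y" unfolding that by simp
  qed
  obtain k where k: "0 < k" "\<And>f. f \<in> borel_measurable borel \<Longrightarrow> (\<integral>x. f (L x + t) \<partial>lborel) = k * (\<integral>x. f x \<partial>lborel :: real)"
    by (rule I_affine_image[where L=L and t=t, OF L(1)]) (erule inj, rule that, assumption+)
  have "L x + t \<in> K \<longleftrightarrow> x \<in> K" for x
    using assms bcL by (rule K_swap)
  then have "(\<lambda>x. indicator K (L x + t)) = (indicator K :: _ \<Rightarrow> real)" by (auto simp: indicator_def)
  with k(2)[OF meas_ind] have "I (\<lambda>_. 1) = k * I (\<lambda>_. 1)" by (simp add: I_def)
  then have "k = 1" using vol_pos by simp
  with L(1) bcL k(2) show ?thesis by (intro that[of L t]) auto
qed

lemma I_swap:
  assumes "a \<in> C" "b \<in> C" "c \<in> C" "d \<in> C"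
  shows "I (\<lambda>x. bc c x * bc d x) = I (\<lambda>x. bc (Transposition.transpose a b c) x * bc (Transposition.transpose a b d) x)"
proof -
  obtain L t where L: "linear L" "\<And>d x. d \<in> C \<Longrightarrow> bc d (L x + t) = bc (Transposition.transpose a b d) x"
    "\<And>p. p \<in> borel_measurable borel \<Longrightarrow> (\<integral>x. p (L x + t) \<partial>lborel) = (\<integral>x. p x \<partial>lborel :: real)"
    by (rule swap_map[OF assms(1,2)]) (rule that, assumption+)
  have tr: "Transposition.transpose a b e \<in> C \<longleftrightarrow> e \<in> C" for e
    using assms by (auto simp: Transposition.transpose_def)
  have "L x + t \<in> K \<longleftrightarrow> x \<in> K" for x
    using assms(1,2) L(2) by (rule K_swap)
  then have "(\<lambda>x. indicator K (L x + t)) = (indicator K :: _ \<Rightarrow> real)" by (auto simp: indicator_def)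
  then have i: "indicator K (L x + t) = (indicator K x :: real)" for x by metis
  show ?thesis unfolding I_def
    by (subst L(3)[symmetric]) (simp_all add: i L(2) assms)
qed

text \<open>The hyperplane through the other vertices and the midpoint of the edge \<open>a b\<close> cuts the simplex into two
  halves that are exchanged by the swap of \<open>a\<close> and \<open>b\<close>. The affine map \<open>S\<close> that moves \<open>b\<close> to the midpoint
  and fixes the other vertices maps the simplex onto the half at \<open>a\<close>, and \<open>\<lambda>\<^sub>a - \<lambda>\<^sub>b\<close> composed with \<open>S\<close> is
  \<open>\<lambda>\<^sub>a\<close>. Expanding the square, this identity says that the integral of \<open>\<lambda>\<^sub>a\<^sup>2\<close> is twice that of
  \<open>\<lambda>\<^sub>a \<lambda>\<^sub>b\<close>.\<close>

lemma bisect: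
  assumes ab: "a \<in> C" "b \<in> C" "a \<noteq> b"
  shows "I (\<lambda>x. (bc a x - bc b x)\<^sup>2) = I (\<lambda>x. (bc a x)\<^sup>2)"
proof -
  define H where "H = {x \<in> K. bc b x \<le> bc a x}"
  define H' where "H' = {x \<in> K. bc a x \<le> bc b x}"
  have clK: "closed K" using compK by (rule compact_imp_closed)
  have mH [measurable]: "H \<in> sets borel" "H' \<in> sets borel"
  proof -
    have "K \<in> sets borel" using clK by simp
    then show "H \<in> sets borel" "H' \<in> sets borel" unfolding H_def H'_def by measurable
  qed
  have split: "I p = (\<integral>x. indicator H x * p x \<partial>lborel) + (\<integral>x. indicator H' x * p x \<partial>lborel)"
    if p: "continuous_on UNIV p" for p
  proof -
    have [measurable]: "p \<in> borel_measurable borel" using p by (rule borel_measurable_continuous_onI)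
    have i: "integrable lborel (\<lambda>x. indicator A x * p x)" if "A \<in> sets borel" "A \<subseteq> K" for A
      by (rule Bochner_Integration.integrable_bound[OF intK[OF p]]) (use that in \<open>auto simp: indicator_def\<close>)
    have "negligible {x. bc a x = bc b x}"
    proof -
      obtain c v where v: "\<And>x. bc a x = c + v \<bullet> x" using affine by metis
      obtain c' v' where v': "\<And>x. bc b x = c' + v' \<bullet> x" using affine by metis
      have "v - v' \<noteq> 0"
        using nodal[OF ab(1,1)] nodal[OF ab(1,2)] nodal[OF ab(2,1)] nodal[OF ab(2,2)] ab(3) v v' by auto
      then have "negligible {x. (v - v') \<bullet> x = c' - c}" by (intro negligible_hyperplane) simp
      moreover have "{x. bc a x = bc b x} = {x. (v - v') \<bullet> x = c' - c}"
        by (auto simp: v v' inner_diff_left)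
      ultimately show ?thesis by simp
    qed
    then have "{x. bc a x = bc b x} \<in> null_sets lebesgue" by (simp add: negligible_iff_null_sets)
    then have "AE x in lebesgue. bc a x \<noteq> bc b x"
      using AE_not_in by force
    then have "AE x in lborel. bc a x \<noteq> bc b x"
      by (rule AE_completion_iff[THEN iffD1])
    then have "AE x in lborel. indicator K x * p x = indicator H x * p x + indicator H' x * p x"
      by eventually_elim (auto simp: H_def H'_def indicator_def)
    then have "I p = (\<integral>x. indicator H x * p x + indicator H' x * p x \<partial>lborel)"
      unfolding I_def by (intro integral_cong_AE) measurable
    also have "\<dots> = (\<integral>x. indicator H x * p x \<partial>lborel) + (\<integral>x. indicator H' x * p x \<partial>lborel)"
      using i mH by (intro Bochner_Integration.integral_add) (auto simp: H_def H'_def)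
    finally show ?thesis .
  qed
  obtain L t where L: "linear L" "\<And>d x. d \<in> C \<Longrightarrow> bc d (L x + t) = bc (Transposition.transpose a b d) x"
    "\<And>p. p \<in> borel_measurable borel \<Longrightarrow> (\<integral>x. p (L x + t) \<partial>lborel) = (\<integral>x. p x \<partial>lborel :: real)"
    by (rule swap_map[OF ab(1,2)]) (rule that, assumption+)
  have tr: "Transposition.transpose a b e \<in> C \<longleftrightarrow> e \<in> C" for e
    using ab by (auto simp: Transposition.transpose_def)
  have LK: "L x + t \<in> K \<longleftrightarrow> x \<in> K" for x
    using ab(1,2) L(2) by (rule K_swap)
  have LH: "indicator H' (L x + t) = (indicator H x :: real)" for x
    using LK ab by (auto simp: indicator_def H_def H'_def L(2))
  have symm: "I p = 2 * (\<integral>x. indicator H x * p x \<partial>lborel)"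
    if p: "continuous_on UNIV p" and "\<And>x. p (L x + t) = p x" for p
  proof -
    have [measurable]: "p \<in> borel_measurable borel" using p by (rule borel_measurable_continuous_onI)
    have "(\<integral>x. indicator H' x * p x \<partial>lborel) = (\<integral>x. indicator H x * p x \<partial>lborel)"
      by (subst L(3)[symmetric]) (simp_all add: LH that)
    then show ?thesis using split[OF p] by simp
  qed
  define g where "g e = (if e = b then (1/2) *\<^sub>R a + (1/2) *\<^sub>R b else e)" for e
  obtain S s where S: "linear S" "\<And>e. e \<in> C \<Longrightarrow> S e + s = g e"
    by (rule affine_interpolation[OF indep, of g]) (rule that, assumption+)
  have bcS: "bc d (S x + s) = (if d = a then bc a x + bc b x / 2 else if d = b then bc b x / 2 else bc d x)"
    if d: "d \<in> C" for d x
  proof -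
    have "bc d (S x + s) = (\<Sum>e\<in>C. (if e = d then (if d = b then bc b x / 2 else bc d x) else 0)
        + (if e = b then (if d = a then bc b x / 2 else 0) else 0))"
    proof (subst bc_affine_image[OF S(1)], rule sum.cong[OF refl])
      fix e assume e: "e \<in> C"
      show "bc d (S e + s) * bc e x = (if e = d then (if d = b then bc b x / 2 else bc d x) else 0)
        + (if e = b then (if d = a then bc b x / 2 else 0) else 0)"
        using d e ab by (auto simp: S(2) g_def nodal bc_combination)
    qed
    then show ?thesis using finC d ab by (simp add: sum.distrib)
  qed
  have inj: "x = y" if "S x + s = S y + s" for x y
  proof (rule bc_eqI)
    fix d assume d: "d \<in> C"
    have "bc b x = bc b y" using bcS[OF ab(2), of x] bcS[OF ab(2), of y] that ab by simp
    then show "bc d x = bc d y" using bcS[OF d, of x] bcS[OF d, of y] that ab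
      by (simp split: if_splits)
  qed
  obtain k where k: "0 < k" "\<And>f. f \<in> borel_measurable borel \<Longrightarrow> (\<integral>x. f (S x + s) \<partial>lborel) = k * (\<integral>x. f x \<partial>lborel :: real)"
    by (rule I_affine_image[where L=S and t=s, OF S(1)]) (erule inj, rule that, assumption+)
  have SH: "S x + s \<in> H \<longleftrightarrow> x \<in> K" for x
  proof
    assume "S x + s \<in> H"
    then have h: "\<And>d. d \<in> C \<Longrightarrow> 0 \<le> bc d (S x + s)" "bc b (S x + s) \<le> bc a (S x + s)"
      by (auto simp: H_def hull)
    have "0 \<le> bc d x" if d: "d \<in> C" for d
      using h(1)[OF d] h(2) bcS[OF d, of x] bcS[OF ab(1), of x] bcS[OF ab(2), of x] ab
      by (simp split: if_splits)
    then show "x \<in> K" by (simp add: hull)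
  next
    assume "x \<in> K"
    then show "S x + s \<in> H" using ab by (auto simp: H_def hull bcS)
  qed
  then have SH': "indicator H (S x + s) = (indicator K x :: real)" for x by (auto simp: indicator_def)
  have half: "I p * k = 2 * I (\<lambda>x. p (S x + s))" if p: "continuous_on UNIV p" and "\<And>x. p (L x + t) = p x" for p
  proof -
    have [measurable]: "p \<in> borel_measurable borel" using p by (rule borel_measurable_continuous_onI)
    show ?thesis using symm[OF that] k(2)[of "\<lambda>x. indicator H x * p x"] by (simp add: SH' I_def)
  qed
  \<comment> \<open>The constant function \<open>1\<close> determines the volume factor of \<open>S\<close>.\<close>
  have "k = 2" using half[of "\<lambda>_. 1"] vol_pos by simp
  moreover have "I (\<lambda>x. (bc a x - bc b x)\<^sup>2) * k = 2 * I (\<lambda>x. (bc a (S x + s) - bc b (S x + s))\<^sup>2)"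
    using ab by (intro half continuous_intros) (auto simp: L(2) power2_commute)
  ultimately show ?thesis using ab by (simp add: bcS)
qed

text \<open>By symmetry all diagonal entries agree, and by \<open>bisect\<close> they are twice the off-diagonal ones. The
  formula for the function \<open>1\<close> shows that the common factor is not zero.\<close>

lemma mass_matrix:
  obtains B where "0 < B"
    "\<And>c v c' v'. I (\<lambda>x. (c + v \<bullet> x) * (c' + v' \<bullet> x))
      = B * ((\<Sum>a\<in>C. (c + v \<bullet> a) * (c' + v' \<bullet> a)) + (\<Sum>a\<in>C. c + v \<bullet> a) * (\<Sum>a\<in>C. c' + v' \<bullet> a))"
proof -
  have "card C \<noteq> 0" "card C \<noteq> 1" using full by auto
  then obtain a0 where a0: "a0 \<in> C" by fastforce
  define A where "A = I (\<lambda>x. bc a0 x * bc a0 x)"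
  have diag: "I (\<lambda>x. bc a x * bc a x) = A" if "a \<in> C" for a
    using I_swap[OF that a0 a0 a0] by (simp add: A_def)
  have off: "I (\<lambda>x. bc a x * bc b x) = A / 2" if ab: "a \<in> C" "b \<in> C" "a \<noteq> b" for a b
  proof -
    have "I (\<lambda>x. (bc a x)\<^sup>2) = I (\<lambda>x. (bc a x * bc a x + bc b x * bc b x) + (- 2) * (bc a x * bc b x))"
      unfolding bisect[OF ab, symmetric] by (simp add: power2_eq_square algebra_simps)
    also have "\<dots> = I (\<lambda>x. bc a x * bc a x) + I (\<lambda>x. bc b x * bc b x) + (-2) * I (\<lambda>x. bc a x * bc b x)"
      unfolding I_cmult[symmetric] by (simp only: I_add continuous_intros)
    finally show ?thesis using diag ab by (simp add: power2_eq_square)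
  qed
  have ev: "I (\<lambda>x. bc a x * bc b x) = A / 2 * ((if a = b then 1 else 0) + 1)" if "a \<in> C" "b \<in> C" for a b
    using diag off that by auto
  have "0 \<le> A" unfolding A_def I_def by (intro integral_nonneg_AE) auto
  moreover have formula: "I (\<lambda>x. (c + v \<bullet> x) * (c' + v' \<bullet> x))
      = A / 2 * ((\<Sum>a\<in>C. (c + v \<bullet> a) * (c' + v' \<bullet> a)) + (\<Sum>a\<in>C. c + v \<bullet> a) * (\<Sum>a\<in>C. c' + v' \<bullet> a))" for c v c' v'
  proof -
    define f where "f a = c + v \<bullet> a" for a
    define g where "g a = c' + v' \<bullet> a" for a
    have "(c + v \<bullet> x) * (c' + v' \<bullet> x) = (\<Sum>a\<in>C. f a * bc a x) * (\<Sum>b\<in>C. g b * bc b x)" for x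
      unfolding f_def g_def by (rule arg_cong2[OF repr repr])
    then have "I (\<lambda>x. (c + v \<bullet> x) * (c' + v' \<bullet> x)) = I (\<lambda>x. \<Sum>a\<in>C. \<Sum>b\<in>C. (f a * g b) * (bc a x * bc b x))"
      by (simp add: sum_product mult_ac)
    also have "\<dots> = (\<Sum>a\<in>C. \<Sum>b\<in>C. (f a * g b) * I (\<lambda>x. bc a x * bc b x))"
    proof -
      have i: "integrable lborel (\<lambda>x. indicator K x * (f a * g b * (bc a x * bc b x)))" for a b
        by (intro intK continuous_intros)
      show ?thesis
        unfolding I_cmult[symmetric] by (simp add: I_def sum_distrib_left Bochner_Integration.integral_sum i Bochner_Integration.integrable_sum)
    qed
    also have "\<dots> = (\<Sum>a\<in>C. \<Sum>b\<in>C. A / 2 * ((if a = b then f a * g b else 0) + f a * g b))"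
      by (intro sum.cong refl) (auto simp: ev)
    also have "\<dots> = A / 2 * ((\<Sum>a\<in>C. f a * g a) + (\<Sum>a\<in>C. f a) * (\<Sum>a\<in>C. g a))"
      unfolding sum_distrib_left[symmetric] by (simp add: sum_product sum.distrib finC)
    finally show ?thesis by (simp add: f_def g_def)
  qed
  moreover have "A \<noteq> 0" using formula[of 1 0 1 0] vol_pos by auto
  ultimately show ?thesis using that[of "A / 2"] by simp
qed

end

section \<open>Continuous piecewise affine functions on a mesh\<close>

lemma simplex_barycentric:
  fixes K :: "(real ^ 'n) set"
  assumes "int CARD('n) simplex K"
  obtains bc where "barycentric (vertices K) bc" "K = convex hull vertices K"
proof -
  obtain C where C: "\<not> affine_dependent C" "int (card C) = int CARD('n) + 1" "K = convex hull C"
    using assms by (auto simp: simplex_def)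
  have v: "vertices K = C"
    using C extreme_point_of_convex_hull_affine_independent[OF C(1)] by (auto simp: vertices_def)
  have card: "card C = CARD('n) + 1" using C(2) by linarith
  show ?thesis
  proof (rule barycentric_coordinates[OF C(1) card])
    fix bc :: "real ^ 'n \<Rightarrow> real ^ 'n \<Rightarrow> real"
    assume "\<And>a. \<exists>c b. \<forall>x. bc a x = c + b \<bullet> x"
      "\<And>a b. a \<in> C \<Longrightarrow> b \<in> C \<Longrightarrow> bc a b = (if a = b then 1 else 0)"
      "\<And>c b x. c + b \<bullet> x = (\<Sum>a\<in>C. (c + b \<bullet> a) * bc a x)"
      "convex hull C = {x. \<forall>a\<in>C. 0 \<le> bc a x}"
      "\<And>x. (\<Sum>a\<in>C. bc a x *\<^sub>R a) = x"
    then have "barycentric C bc" using C(1) card by unfold_locales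
    then show ?thesis using that[of bc] v C(3) by simp
  qed
qed

lemma P1_affine:
  assumes "v \<in> P1_space D \<T>" "K \<in> \<T>"
  obtains c b where "\<And>x. x \<in> K \<Longrightarrow> v x = c + b \<bullet> x"
proof -
  have "\<exists>c b. \<forall>x\<in>K. v x = c + b \<bullet> x" using assms by (simp add: P1_space_def)
  then show ?thesis using that by (elim exE) simp
qed

lemma P1_lin:
  assumes "v \<in> P1_space D \<T>" "w \<in> P1_space D \<T>"
  shows "(\<lambda>x. a * v x + b * w x) \<in> P1_space D \<T>"
  unfolding P1_space_def
proof (intro CollectI conjI ballI allI impI)
  fix K assume "K \<in> \<T>"
  obtain c d where "\<And>x. x \<in> K \<Longrightarrow> v x = c + d \<bullet> x" by (rule P1_affine[OF assms(1) \<open>K \<in> \<T>\<close>]) (rule that, assumption)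
  moreover obtain c' d' where "\<And>x. x \<in> K \<Longrightarrow> w x = c' + d' \<bullet> x" by (rule P1_affine[OF assms(2) \<open>K \<in> \<T>\<close>]) (rule that, assumption)
  ultimately have "\<forall>x\<in>K. a * v x + b * w x = (a * c + b * c') + (a *\<^sub>R d + b *\<^sub>R d') \<bullet> x"
    by (simp add: inner_add_left algebra_simps)
  then show "\<exists>c d. \<forall>x\<in>K. a * v x + b * w x = c + d \<bullet> x" by blast
qed (use assms in \<open>auto simp: P1_space_def\<close>)

locale mesh =
  fixes D :: "(real ^ 'n) set" and \<T> :: "(real ^ 'n) set set"
  assumes tri: "triangulation_of D \<T>"
    and bounded_D: "bounded D" and open_D: "open D" and convex_D: "convex D"
begin

definition nodes :: "(real ^ 'n) set" where "nodes = (\<Union>K\<in>\<T>. vertices K)"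

lemma finite_mesh: "finite \<T>"
  and simplex_mesh: "K \<in> \<T> \<Longrightarrow> int CARD('n) simplex K"
  and face_mesh: "K \<in> \<T> \<Longrightarrow> K' \<in> \<T> \<Longrightarrow> (K \<inter> K') face_of K"
  and Union_mesh: "\<Union>\<T> = closure D"
  using tri by (auto simp: triangulation_of_def triangulation_def)

lemma vertices_mesh:
  assumes "K \<in> \<T>"
  shows "finite (vertices K)" "card (vertices K) = CARD('n) + 1" "convex hull vertices K = K"
    "\<not> affine_dependent (vertices K)" "compact K" "convex K" "vertices K \<subseteq> K"
proof -
  obtain bc where b: "barycentric (vertices K) bc" "K = convex hull vertices K"
    using simplex_barycentric[OF simplex_mesh[OF assms]] by metis
  interpret barycentric "vertices K" bc by fact
  show "finite (vertices K)" "card (vertices K) = CARD('n) + 1" "\<not> affine_dependent (vertices K)"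
    by (fact finC full indep)+
  show "convex hull vertices K = K" using b(2) by simp
  then show "compact K" "convex K" "vertices K \<subseteq> K"
    using compK convex_convex_hull[of "vertices K"] hull_subset[of "vertices K" convex] by simp_all
qed

lemma finite_nodes: "finite nodes"
  unfolding nodes_def using finite_mesh vertices_mesh(1) by auto

lemma nodes_subset: "nodes \<subseteq> closure D"
  unfolding nodes_def Union_mesh[symmetric] using vertices_mesh(7) by blast

lemma D_sets: "D \<in> sets lebesgue"
  using open_D by (simp add: borel_open)

lemma affine_eq_on_hull:
  assumes "\<And>a. a \<in> C \<Longrightarrow> c + b \<bullet> a = c' + b' \<bullet> a" "x \<in> convex hull C"
  shows "c + b \<bullet> x = c' + b' \<bullet> (x :: real ^ 'n)"
  using affine_eq_hull_real[OF assms(1), of C x] assms(2) convex_hull_subset_affine_hull[of C] by auto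

text \<open>A compact convex set is the hull of its extreme points, and the extreme points of a common face
  are common vertices.\<close>

lemma affine_eq_on_common_face:
  assumes K: "K \<in> \<T>" "K' \<in> \<T>" and eq: "\<And>a. a \<in> vertices K \<inter> vertices K' \<Longrightarrow> c + b \<bullet> a = c' + b' \<bullet> a"
    and x: "x \<in> K \<inter> K'"
  shows "c + b \<bullet> x = c' + b' \<bullet> x"
proof (rule affine_eq_on_hull[where C="{a. a extreme_point_of (K \<inter> K')}"])
  have "K' \<inter> K face_of K'" using face_mesh K by blast
  then have f: "K \<inter> K' face_of K" "K \<inter> K' face_of K'" using face_mesh K by (auto simp: Int_commute)
  have "compact (K \<inter> K')" "convex (K \<inter> K')" using K vertices_mesh(5,6) by (auto intro: compact_Int convex_Int)
  from Krein_Milman_Minkowski[OF this] x show "x \<in> convex hull {a. a extreme_point_of K \<inter> K'}"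
    by (rule subst[of _ _ "\<lambda>S. x \<in> S"])
  show "c + b \<bullet> a = c' + b' \<bullet> a" if "a \<in> {a. a extreme_point_of K \<inter> K'}" for a
    using that f extreme_point_of_face by (intro eq) (auto simp: vertices_def)
qed

lemma P1_eqI:
  assumes "v \<in> P1_space D \<T>" "w \<in> P1_space D \<T>" "\<And>a. a \<in> nodes \<Longrightarrow> v a = w a"
  shows "v = w"
proof
  fix x
  show "v x = w x"
  proof (cases "x \<in> closure D")
    case True
    then obtain K where K: "K \<in> \<T>" "x \<in> K" using Union_mesh by auto
    obtain c d where e1: "\<And>x. x \<in> K \<Longrightarrow> v x = c + d \<bullet> x" by (rule P1_affine[OF assms(1) K(1)]) (rule that, assumption)
    obtain c' d' where e2: "\<And>x. x \<in> K \<Longrightarrow> w x = c' + d' \<bullet> x" by (rule P1_affine[OF assms(2) K(1)]) (rule that, assumption)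
    have "c + d \<bullet> x = c' + d' \<bullet> x"
    proof (rule affine_eq_on_hull[where C="vertices K"])
      show "x \<in> convex hull vertices K" using K vertices_mesh(3) by simp
      fix a assume a: "a \<in> vertices K"
      then show "c + d \<bullet> a = c' + d' \<bullet> a"
        using assms(3)[of a] e1[of a] e2[of a] vertices_mesh(7)[OF K(1)] K by (fastforce simp: nodes_def)
    qed
    then show ?thesis using e1 e2 K by simp
  qed (use assms in \<open>auto simp: P1_space_def\<close>)
qed

text \<open>The affine interpolants of neighbouring elements agree on the common face, so any choice of an element
  containing \<open>x\<close> gives the same value.\<close>

lemma P1_interpolant:
  obtains v where "v \<in> P1_space D \<T>" "\<And>a. a \<in> nodes \<Longrightarrow> v a = g a"
proof -
  have "\<exists>c b. \<forall>a\<in>vertices K. c + b \<bullet> a = g a" if "K \<in> \<T>" for K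
    by (rule affine_interpolation_real[OF vertices_mesh(4)[OF that], of g]) blast
  then obtain c b where cb: "\<And>K a. K \<in> \<T> \<Longrightarrow> a \<in> vertices K \<Longrightarrow> c K + b K \<bullet> a = g a" by metis
  define S where "S x = (SOME K. K \<in> \<T> \<and> x \<in> K)" for x
  have S: "S x \<in> \<T>" "x \<in> S x" if "x \<in> closure D" for x
    using someI_ex[of "\<lambda>K. K \<in> \<T> \<and> x \<in> K"] that Union_mesh unfolding S_def by auto
  define v where "v x = (if x \<in> closure D then c (S x) + b (S x) \<bullet> x else 0)" for x
  have vK: "v x = c K + b K \<bullet> x" if "K \<in> \<T>" "x \<in> K" for K x
  proof -
    have x: "x \<in> closure D" using that Union_mesh by auto
    have "c (S x) + b (S x) \<bullet> x = c K + b K \<bullet> x"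
    proof (rule affine_eq_on_common_face)
      show "S x \<in> \<T>" "K \<in> \<T>" "x \<in> S x \<inter> K" using S[OF x] that by auto
      show "c (S x) + b (S x) \<bullet> a = c K + b K \<bullet> a" if a: "a \<in> vertices (S x) \<inter> vertices K" for a
        using cb[OF S(1)[OF x], of a] cb[OF \<open>K \<in> \<T>\<close>, of a] a by simp
    qed
    then show ?thesis using x by (simp add: v_def)
  qed
  show ?thesis
  proof (rule that)
    have "\<forall>K\<in>\<T>. \<exists>c b. \<forall>x\<in>K. v x = c + b \<bullet> x" using vK by blast
    moreover have "\<forall>x. x \<notin> closure D \<longrightarrow> v x = 0" by (simp add: v_def)
    ultimately show "v \<in> P1_space D \<T>" unfolding P1_space_def by simp
    fix a assume "a \<in> nodes"
    then obtain K where K: "K \<in> \<T>" "a \<in> vertices K" by (auto simp: nodes_def)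
    then show "v a = g a" using vK[of K a] cb[OF K] vertices_mesh(7)[OF K(1)] by auto
  qed
qed

lemma P1_continuous: assumes "v \<in> P1_space D \<T>" shows "continuous_on (closure D) v"
  unfolding Union_mesh[symmetric]
proof (rule continuous_on_closed_Union[of \<T> "\<lambda>K. K" v, simplified])
  show "finite \<T>" by (rule finite_mesh)
  show "closed K" if "K \<in> \<T>" for K using vertices_mesh(5)[OF that] by (rule compact_imp_closed)
  show "continuous_on K v" if K: "K \<in> \<T>" for K
  proof -
    obtain c b where "\<And>x. x \<in> K \<Longrightarrow> v x = c + b \<bullet> x" by (rule P1_affine[OF assms K]) (rule that, assumption)
    moreover have "continuous_on K (\<lambda>x. c + b \<bullet> x)" by (intro continuous_intros)
    ultimately show ?thesis by (simp cong: continuous_on_cong)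
  qed
qed

lemma P1_L2: "v \<in> P1_space D \<T> \<Longrightarrow> v \<in> L2_space D"
  by (intro continuous_on_closure_L2 D_sets bounded_D P1_continuous)

text \<open>Two different elements meet in a proper face, which has empty interior, so integrals over the domain
  are sums over the elements.\<close>

lemma l2_inner_P1:
  obtains B where "\<And>K. K \<in> \<T> \<Longrightarrow> 0 < B K"
    "\<And>v w. v \<in> P1_space D \<T> \<Longrightarrow> w \<in> P1_space D \<T> \<Longrightarrow> l2_inner D v w = (\<Sum>K\<in>\<T>. B K * mass_form (vertices K) v w)"
proof -
  have "\<exists>B>0. \<forall>v\<in>P1_space D \<T>. \<forall>w\<in>P1_space D \<T>. ((\<lambda>x. v x * w x) has_integral B * mass_form (vertices K) v w) K"
    if K: "K \<in> \<T>" for K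
  proof -
    obtain bc where b: "barycentric (vertices K) bc" "K = convex hull vertices K"
      using simplex_barycentric[OF simplex_mesh[OF K]] by metis
    interpret barycentric "vertices K" bc by fact
    obtain B where B: "0 < B"
      "\<And>c v c' v'. I (\<lambda>x. (c + v \<bullet> x) * (c' + v' \<bullet> x))
      = B * ((\<Sum>a\<in>vertices K. (c + v \<bullet> a) * (c' + v' \<bullet> a)) + (\<Sum>a\<in>vertices K. c + v \<bullet> a) * (\<Sum>a\<in>vertices K. c' + v' \<bullet> a))"
      by (rule mass_matrix) (rule that, assumption+)
    have "((\<lambda>x. v x * w x) has_integral B * mass_form (vertices K) v w) K"
      if vw: "v \<in> P1_space D \<T>" "w \<in> P1_space D \<T>" for v w
    proof -
      obtain c d where e1: "\<And>x. x \<in> K \<Longrightarrow> v x = c + d \<bullet> x" by (rule P1_affine[OF vw(1) K]) (rule that, assumption)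
      obtain c' d' where e2: "\<And>x. x \<in> K \<Longrightarrow> w x = c' + d' \<bullet> x" by (rule P1_affine[OF vw(2) K]) (rule that, assumption)
      have eq: "mass_form (vertices K) v w = (\<Sum>a\<in>vertices K. (c + d \<bullet> a) * (c' + d' \<bullet> a))
        + (\<Sum>a\<in>vertices K. c + d \<bullet> a) * (\<Sum>a\<in>vertices K. c' + d' \<bullet> a)"
        using vertices_mesh(7)[OF K] e1 e2 unfolding mass_form_def
        by (intro arg_cong2[of _ _ _ _ "(+)"] arg_cong2[of _ _ _ _ "(*)"] sum.cong refl) auto
      have "((\<lambda>x. indicator K x * ((c + d \<bullet> x) * (c' + d' \<bullet> x))) has_integral I (\<lambda>x. (c + d \<bullet> x) * (c' + d' \<bullet> x))) UNIV"
      proof -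
        have "integrable lborel (\<lambda>x. indicator (convex hull vertices K) x * ((c + d \<bullet> x) * (c' + d' \<bullet> x)))"
          by (intro intK continuous_intros)
        from has_integral_integral_lborel[OF this] show ?thesis
          unfolding I_def b(2)[symmetric] .
      qed
      also have "(\<lambda>x. indicator K x * ((c + d \<bullet> x) * (c' + d' \<bullet> x))) = (\<lambda>x. if x \<in> K then v x * w x else 0)"
        using e1 e2 by (auto simp: indicator_def)
      finally show ?thesis by (simp only: has_integral_restrict_UNIV B(2) eq)
    qed
    then show ?thesis using B(1) by blast
  qed
  then obtain B where B: "\<And>K. K \<in> \<T> \<Longrightarrow> 0 < B K"
    "\<And>K v w. K \<in> \<T> \<Longrightarrow> v \<in> P1_space D \<T> \<Longrightarrow> w \<in> P1_space D \<T> \<Longrightarrow> ((\<lambda>x. v x * w x) has_integral B K * mass_form (vertices K) v w) K"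
    by metis
  have pw: "pairwise (\<lambda>S S'. negligible (S \<inter> S')) \<T>"
  proof (rule pairwiseI)
    fix K K' assume K: "K \<in> \<T>" "K' \<in> \<T>" "K \<noteq> K'"
    have full: "aff_dim K = int CARD('n)" if "K \<in> \<T>" for K
      using simplex_mesh[OF that] aff_dim_simplex by blast
    have "K \<inter> K' \<noteq> K \<or> K' \<inter> K \<noteq> K'" using K(3) by auto
    then have "aff_dim (K \<inter> K') < int CARD('n)"
    proof
      assume "K \<inter> K' \<noteq> K"
      then show ?thesis using face_of_aff_dim_lt[OF vertices_mesh(6) face_mesh[of K K']] K full by fastforce
    next
      assume "K' \<inter> K \<noteq> K'"
      then show ?thesis using face_of_aff_dim_lt[OF vertices_mesh(6) face_mesh[of K' K]] K full
        by (simp add: Int_commute)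
    qed
    then have "interior (K \<inter> K') = {}"
      using affine_hull_nonempty_interior[of "K \<inter> K'"] aff_dim_eq_full[of "K \<inter> K'"] by auto
    then show "negligible (K \<inter> K')"
      using negligible_convex_interior[of "K \<inter> K'"] K vertices_mesh(6) convex_Int by blast
  qed
  have "l2_inner D v w = (\<Sum>K\<in>\<T>. B K * mass_form (vertices K) v w)"
    if vw: "v \<in> P1_space D \<T>" "w \<in> P1_space D \<T>" for v w
  proof -
    have "((\<lambda>x. v x * w x) has_integral (\<Sum>K\<in>\<T>. B K * mass_form (vertices K) v w)) (\<Union>\<T>)"
      by (rule has_integral_Union[OF finite_mesh B(2)[OF _ vw] pw])
    then have "((\<lambda>x. v x * w x) has_integral (\<Sum>K\<in>\<T>. B K * mass_form (vertices K) v w)) D"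
      unfolding Union_mesh by (simp only: has_integral_closure[OF negligible_convex_frontier[OF convex_D]])
    then have "integral D (\<lambda>x. v x * w x) = (\<Sum>K\<in>\<T>. B K * mass_form (vertices K) v w)"
      by (rule integral_unique)
    then show ?thesis
      unfolding l2_inner_def
      using lebesgue_integral_eq_integral[OF L2_mult_integrable[OF P1_L2[OF vw(1)] P1_L2[OF vw(2)]] D_sets] by simp
  qed
  then show ?thesis using that B(1) by blast
qed

text \<open>Because \<open>u\<close> vanishes at the boundary nodes, the interpolant has the values \<open>u - u^q\<close> at all nodes and
  the estimate applies on every element. The factors \<open>B\<^sub>K\<close> are summed by comparison with
  \<open>(1, 1)\<close>, the volume of the domain.\<close>

lemma reaction_bound:
  assumes dim: "CARD('n) = 2 \<and> q \<ge> 3 \<and> odd q \<or> CARD('n) = 3 \<and> q \<in> {3, 5}"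
    and R: "0 \<le> R" "\<And>(C :: (real ^ 'n) set) f. card C = CARD('n) + 1 \<Longrightarrow> mass_form C (\<lambda>a. f a - f a ^ q) f \<le> R"
    and u: "u \<in> P1_space D \<T>" "\<And>x. x \<notin> D \<Longrightarrow> u x = 0"
  shows "l2_inner D (I_h D \<T> (\<lambda>x. u x - u x ^ q)) u \<le> R * measure lebesgue D"
proof -
  obtain B where B: "\<And>K. K \<in> \<T> \<Longrightarrow> 0 < B K"
    "\<And>v w. v \<in> P1_space D \<T> \<Longrightarrow> w \<in> P1_space D \<T> \<Longrightarrow> l2_inner D v w = (\<Sum>K\<in>\<T>. B K * mass_form (vertices K) v w)"
    by (rule l2_inner_P1) (rule that, assumption+)
  obtain v where v: "v \<in> P1_space D \<T>" "\<And>a. a \<in> nodes \<Longrightarrow> v a = u a - u a ^ q"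
    using P1_interpolant[of "\<lambda>a. u a - u a ^ q"] by metis
  have q: "q > 0" using dim by auto
  have va: "v a = (if a \<in> D then u a - u a ^ q else 0)" if "a \<in> nodes" for a
    using v(2)[OF that] u(2)[of a] q by (simp add: zero_power)
  have "I_h D \<T> (\<lambda>x. u x - u x ^ q) = v"
    unfolding I_h_def
  proof (rule the_equality)
    show "v \<in> P1_space D \<T> \<and> (\<forall>K\<in>\<T>. \<forall>a\<in>vertices K. v a = (if a \<in> D then u a - u a ^ q else 0))"
      using v(1) va unfolding nodes_def by blast
    fix w assume w: "w \<in> P1_space D \<T> \<and> (\<forall>K\<in>\<T>. \<forall>a\<in>vertices K. w a = (if a \<in> D then u a - u a ^ q else 0))"
    show "w = v"
    proof (rule P1_eqI)
      fix a assume a: "a \<in> nodes"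
      then show "w a = v a" using w va[OF a] by (auto simp: nodes_def)
    qed (use w v in auto)
  qed
  then have "l2_inner D (I_h D \<T> (\<lambda>x. u x - u x ^ q)) u = (\<Sum>K\<in>\<T>. B K * mass_form (vertices K) v u)"
    using B(2)[OF v(1) u(1)] by simp
  also have "\<dots> \<le> (\<Sum>K\<in>\<T>. R * (B K * mass_form (vertices K) (\<lambda>_. 1) (\<lambda>_. 1)))"
  proof (rule sum_mono)
    fix K assume K: "K \<in> \<T>"
    have "mass_form (vertices K) v u = mass_form (vertices K) (\<lambda>a. u a - u a ^ q) u"
      using v(2) K unfolding mass_form_def nodes_def
      by (intro arg_cong2[of _ _ _ _ "(+)"] arg_cong2[of _ _ _ _ "(*)"] sum.cong refl) auto
    also have "\<dots> \<le> R" using R(2) vertices_mesh(2)[OF K] by simp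
    also have "\<dots> \<le> R * mass_form (vertices K) (\<lambda>_. 1) (\<lambda>_. 1)"
      using R(1) vertices_mesh(2)[OF K] mult_left_mono[of 1 "mass_form (vertices K) (\<lambda>_. 1) (\<lambda>_. 1)" R] by (simp add: mass_form_def)
    finally have "B K * mass_form (vertices K) v u \<le> B K * (R * mass_form (vertices K) (\<lambda>_. 1) (\<lambda>_. 1))"
      by (rule mult_left_mono[OF _ less_imp_le[OF B(1)[OF K]]])
    then show "B K * mass_form (vertices K) v u \<le> R * (B K * mass_form (vertices K) (\<lambda>_. 1) (\<lambda>_. 1))"
      by (simp add: mult.left_commute)
  qed
  also have "\<dots> = R * l2_inner D (indicator (closure D)) (indicator (closure D))"
  proof -
    have i: "indicator (closure D) \<in> P1_space D \<T>"
      unfolding P1_space_def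
    proof (intro CollectI conjI ballI allI impI)
      fix K assume "K \<in> \<T>"
      then have "\<forall>x\<in>K. indicat_real (closure D) x = 1 + 0 \<bullet> x"
        using Union_mesh by (auto simp: indicator_def)
      then show "\<exists>c b. \<forall>x\<in>K. indicat_real (closure D) x = c + b \<bullet> x" by blast
    qed auto
    have "mass_form (vertices K) (indicator (closure D)) (indicator (closure D)) = mass_form (vertices K) (\<lambda>_. 1) (\<lambda>_. 1)"
      if "K \<in> \<T>" for K
      using nodes_subset that unfolding mass_form_def nodes_def
      by (intro arg_cong2[of _ _ _ _ "(+)"] arg_cong2[of _ _ _ _ "(*)"] sum.cong refl) (auto simp: indicator_def subset_iff)
    then show ?thesis unfolding B(2)[OF i i] by (simp add: sum_distrib_left)
  qed
  also have "l2_inner D (indicator (closure D)) (indicator (closure D)) = measure lebesgue D"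
  proof -
    have "l2_inner D (indicator (closure D)) (indicator (closure D)) = (LINT x|lebesgue_on D. 1)"
      unfolding l2_inner_def using closure_subset by (intro Bochner_Integration.integral_cong) (auto simp: indicator_def space_restrict_space)
    also have "\<dots> = measure lebesgue D"
      using D_sets by (simp add: measure_restrict_space space_restrict_space)
    finally show ?thesis .
  qed
  finally show ?thesis .
qed

end

section \<open>Test functions and integration by parts\<close>

lemma C_k_lin: "C_k k f \<Longrightarrow> C_k k g \<Longrightarrow> C_k k (\<lambda>x. a * f x + b * g x)"
proof (induction k arbitrary: f g)
  case 0
  then show ?case by (auto intro!: continuous_intros)
next
  case (Suc k)
  have d: "((\<lambda>x. a * f x + b * g x) has_derivative
      (\<lambda>h. a * frechet_derivative f (at x) h + b * frechet_derivative g (at x) h)) (at x)" for x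
  proof -
    have "(f has_derivative frechet_derivative f (at x)) (at x)" "(g has_derivative frechet_derivative g (at x)) (at x)"
      using Suc.prems by (auto simp: frechet_derivative_works)
    then show ?thesis by (intro has_derivative_add has_derivative_mult_right)
  qed
  have "partial i (\<lambda>x. a * f x + b * g x) = (\<lambda>x. a * partial i f x + b * partial i g x)" for i
    by (rule ext) (simp add: partial_def frechet_derivative_at[OF d, symmetric])
  moreover have "(\<lambda>x. a * f x + b * g x) differentiable at x" for x
    using d by (auto simp: differentiable_def)
  ultimately show ?case using Suc by simp
qed

lemma C_k_continuous: "C_k k f \<Longrightarrow> continuous_on UNIV f"
proof (cases k)
  case (Suc n)
  assume "C_k k f"
  then show ?thesis using Suc
    by (auto simp: continuous_on_eq_continuous_within intro: differentiable_imp_continuous_within)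
qed simp

lemma test_functionsE:
  assumes "\<phi> \<in> test_functions D"
  obtains S where "compact S" "S \<subseteq> D" "\<And>x. x \<notin> S \<Longrightarrow> \<phi> x = 0" "\<And>k. C_k k \<phi>" "continuous_on UNIV \<phi>"
    "\<And>x. \<phi> differentiable at x" "\<And>i. continuous_on UNIV (partial i \<phi>)" "\<And>x i. x \<notin> S \<Longrightarrow> partial i \<phi> x = 0"
proof -
  obtain S where S: "compact S" "S \<subseteq> D" "\<And>x. x \<notin> S \<Longrightarrow> \<phi> x = 0" and c: "\<And>k. C_k k \<phi>"
    using assms by (auto simp: test_functions_def)
  have d: "\<phi> differentiable at x" for x using c[of "Suc 0"] by simp
  have p: "partial i \<phi> x = 0" if x: "x \<notin> S" for x i
  proof -
    have "open (- S)" using S(1) by (intro open_Compl compact_imp_closed)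
    then have "(\<phi> has_derivative (\<lambda>_. 0)) (at x)"
      using has_derivative_transform_within_open[of "\<lambda>_. 0" "\<lambda>_. 0" x UNIV "- S" \<phi>] x S(3) by auto
    then show ?thesis by (simp add: partial_def frechet_derivative_at[symmetric])
  qed
  have pc: "continuous_on UNIV (partial i \<phi>)" for i using c[of "Suc 0"] by simp
  show ?thesis using that[OF S c C_k_continuous[OF c[of 0]] d pc p] .
qed

lemma partial_test: "\<phi> \<in> test_functions D \<Longrightarrow> partial i \<phi> \<in> test_functions D"
proof -
  assume *: "\<phi> \<in> test_functions D"
  obtain S where S: "compact S" "S \<subseteq> D" "\<And>x. x \<notin> S \<Longrightarrow> \<phi> x = 0" "\<And>k. C_k k \<phi>" "continuous_on UNIV \<phi>"
    "\<And>x. \<phi> differentiable at x" "\<And>i. continuous_on UNIV (partial i \<phi>)" "\<And>x i. x \<notin> S \<Longrightarrow> partial i \<phi> x = 0"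
    by (rule test_functionsE[OF *]) (rule that, assumption+)
  have "C_k k (partial i \<phi>)" for k using S(4)[of "Suc k"] by simp
  then show ?thesis using S(1,2,8) unfolding test_functions_def by blast
qed

lemma test_functions_lin:
  assumes "\<phi> \<in> test_functions D" "\<psi> \<in> test_functions D"
  shows "(\<lambda>x. a * \<phi> x + b * \<psi> x) \<in> test_functions D"
proof -
  obtain S S' where S: "compact S" "S \<subseteq> D" "\<forall>x. x \<notin> S \<longrightarrow> \<phi> x = 0" "compact S'" "S' \<subseteq> D" "\<forall>x. x \<notin> S' \<longrightarrow> \<psi> x = 0"
    using assms unfolding test_functions_def by blast
  have "compact (S \<union> S')" "S \<union> S' \<subseteq> D" "\<forall>x. x \<notin> S \<union> S' \<longrightarrow> a * \<phi> x + b * \<psi> x = 0"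
    using S by (auto intro: compact_Un)
  moreover have "C_k k (\<lambda>x. a * \<phi> x + b * \<psi> x)" for k
    using assms by (intro C_k_lin) (auto simp: test_functions_def)
  ultimately show ?thesis unfolding test_functions_def by blast
qed

lemma test_functions_L2:
  assumes "\<phi> \<in> test_functions D" "open D" "bounded D"
  shows "\<phi> \<in> L2_space D"
proof -
  have "continuous_on UNIV \<phi>" using assms(1) C_k_continuous unfolding test_functions_def by blast
  then show ?thesis using assms(2,3) continuous_on_subset
    by (intro continuous_on_closure_L2) (auto simp: borel_open)
qed

lemma integral_lebesgue_on_eq_lborel:
  fixes h :: "real ^ 'n \<Rightarrow> real"
  assumes "open D" "continuous_on UNIV h" "\<And>x. x \<notin> D \<Longrightarrow> h x = 0"
  shows "(LINT x|lebesgue_on D. h x) = (\<integral>x. h x \<partial>lborel)"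
proof -
  have "D \<in> sets lebesgue" using assms(1) by (simp add: borel_open)
  then have "(LINT x|lebesgue_on D. h x) = (LINT x|lebesgue. indicator D x *\<^sub>R h x)"
    by (subst integral_restrict_space) auto
  also have "\<dots> = (LINT x|lebesgue. h x)"
    using assms(3) by (intro Bochner_Integration.integral_cong) (auto simp: indicator_def)
  also have "\<dots> = (\<integral>x. h x \<partial>lborel)"
    using assms(2) by (intro integral_completion) (simp add: borel_measurable_continuous_onI)
  finally show ?thesis .
qed

lemma partial_line_derivative:
  assumes "f differentiable at (x + t *\<^sub>R axis i 1)"
  shows "((\<lambda>t. f (x + t *\<^sub>R axis i 1)) has_real_derivative partial i f (x + t *\<^sub>R axis i 1)) (at t)"
proof -
  have f: "(f has_derivative frechet_derivative f (at (x + t *\<^sub>R axis i 1))) (at (x + t *\<^sub>R axis i 1))"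
    using assms by (simp add: frechet_derivative_works)
  have g: "((\<lambda>t. x + t *\<^sub>R axis i 1) has_derivative (\<lambda>s. s *\<^sub>R axis i 1)) (at t)"
    by (auto intro!: derivative_eq_intros)
  have "((\<lambda>t. f (x + t *\<^sub>R axis i 1)) has_derivative (\<lambda>s. frechet_derivative f (at (x + t *\<^sub>R axis i 1)) (s *\<^sub>R axis i 1))) (at t)"
    using diff_chain_at[OF g f] by (simp add: o_def)
  moreover have "frechet_derivative f (at (x + t *\<^sub>R axis i 1)) (s *\<^sub>R axis i 1) = partial i f (x + t *\<^sub>R axis i 1) * s" for s
    using linear_scale[OF linear_frechet_derivative[OF assms]] by (simp add: partial_def)
  ultimately show ?thesis by (simp add: has_field_derivative_def mult_commute_abs)
qed

text \<open>By translation invariance the difference quotients of \<open>f\<close> have integral \<open>0\<close>; by the mean value theorem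
  they are bounded and vanish outside a fixed ball, so dominated convergence applies.\<close>

lemma integral_partial_zero:
  fixes f f' :: "real ^ 'n \<Rightarrow> real"
  assumes S: "compact S" "\<And>x. x \<notin> S \<Longrightarrow> f x = 0" "\<And>x. x \<notin> S \<Longrightarrow> f' x = 0"
    and f: "continuous_on UNIV f" and f': "continuous_on UNIV f'"
    and d: "\<And>x t. ((\<lambda>t. f (x + t *\<^sub>R axis i 1)) has_real_derivative f' (x + t *\<^sub>R axis i 1)) (at t)"
  shows "(\<integral>x. f' x \<partial>lborel) = 0"
proof -
  define e :: "real ^ 'n" where "e = axis i 1"
  have ne: "norm e = 1" by (simp add: e_def)
  have [measurable]: "f \<in> borel_measurable borel" "f' \<in> borel_measurable borel"
    using f f' by (auto intro: borel_measurable_continuous_onI)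
  obtain r where r: "\<And>x. x \<in> S \<Longrightarrow> norm x \<le> r"
    using compact_imp_bounded[OF S(1)] by (auto simp: bounded_iff)
  have "compact (f' ` S)" using S(1) f' continuous_on_subset by (intro compact_continuous_image) auto
  then obtain B where B: "\<And>x. x \<in> S \<Longrightarrow> \<bar>f' x\<bar> \<le> B"
    using compact_imp_bounded by (fastforce simp: bounded_iff)
  have B': "\<bar>f' x\<bar> \<le> \<bar>B\<bar>" for x using B[of x] S(3)[of x] by (cases "x \<in> S") auto
  have intf: "integrable lborel (\<lambda>x. f (x + t *\<^sub>R e))" for t
  proof -
    have "integrable lborel (\<lambda>x. indicator (cball 0 (r + \<bar>t\<bar>)) x *\<^sub>R f (x + t *\<^sub>R e))"
      by (intro borel_integrable_compact continuous_on_compose2[OF f] continuous_intros) auto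
    also have "(\<lambda>x. indicator (cball 0 (r + \<bar>t\<bar>)) x *\<^sub>R f (x + t *\<^sub>R e)) = (\<lambda>x. f (x + t *\<^sub>R e))"
    proof
      fix x
      have "x + t *\<^sub>R e \<in> S \<Longrightarrow> norm x \<le> r + \<bar>t\<bar>"
        using r[of "x + t *\<^sub>R e"] norm_triangle_ineq4[of "x + t *\<^sub>R e" "t *\<^sub>R e"] ne by simp
      then show "indicator (cball 0 (r + \<bar>t\<bar>)) x *\<^sub>R f (x + t *\<^sub>R e) = f (x + t *\<^sub>R e)"
        using S(2)[of "x + t *\<^sub>R e"] by (auto simp: indicator_def)
    qed
    finally show ?thesis .
  qed
  define g where "g n x = real (Suc n) * (f (x + (1 / real (Suc n)) *\<^sub>R e) - f x)" for n x
  have g0: "(\<integral>x. g n x \<partial>lborel) = 0" for n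
  proof -
    have "(\<integral>x. f (x + (1 / real (Suc n)) *\<^sub>R e) \<partial>lborel) = (\<integral>x. f x \<partial>distr lborel borel ((+) ((1 / real (Suc n)) *\<^sub>R e)))"
      by (subst integral_distr) (auto simp: add_ac)
    also have "\<dots> = (\<integral>x. f x \<partial>lborel)" by (simp only: lborel_distr_plus)
    finally show ?thesis
      using intf[of "1 / real (Suc n)"] intf[of 0] by (simp add: g_def)
  qed
  have bound: "\<bar>g n x\<bar> \<le> indicator (cball 0 (r + 1)) x * \<bar>B\<bar>" for n x
  proof -
    have "\<exists>z>0. z < 1 / real (Suc n) \<and> f (x + (1 / real (Suc n)) *\<^sub>R e) - f (x + 0 *\<^sub>R e) = (1 / real (Suc n) - 0) * f' (x + z *\<^sub>R e)"
      using MVT2[of 0 "1 / real (Suc n)" "\<lambda>t. f (x + t *\<^sub>R e)" "\<lambda>t. f' (x + t *\<^sub>R e)"] d by (auto simp: e_def)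
    then obtain z where z: "0 < z" "z < 1 / real (Suc n)" "g n x = f' (x + z *\<^sub>R e)" by (auto simp: g_def)
    have z1: "z \<le> 1" using z(2) by (smt (verit) divide_le_eq_1_pos of_nat_Suc of_nat_0_le_iff)
    show ?thesis
    proof (cases "x + z *\<^sub>R e \<in> S")
      case True
      then have "norm x \<le> r + 1"
        using r[of "x + z *\<^sub>R e"] norm_triangle_ineq4[of "x + z *\<^sub>R e" "z *\<^sub>R e"] ne z z1 by simp
      then show ?thesis using z(3) B' by simp
    qed (use z(3) S(3) in auto)
  qed
  have lim: "(\<lambda>n. g n x) \<longlonglongrightarrow> f' x" for x
  proof -
    have "((\<lambda>h. (f (x + h *\<^sub>R e) - f x) / h) \<longlongrightarrow> f' x) (at 0)"
      using d[of x 0] by (simp add: has_field_derivative_iff e_def)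
    moreover have "filterlim (\<lambda>n. 1 / real (Suc n)) (at 0) sequentially"
      using lim_inverse_n'[THEN LIMSEQ_Suc] by (auto simp: filterlim_at)
    ultimately have "(\<lambda>n. (f (x + (1 / real (Suc n)) *\<^sub>R e) - f x) / (1 / real (Suc n))) \<longlonglongrightarrow> f' x"
      by (rule filterlim_compose)
    then show ?thesis by (simp add: g_def mult.commute)
  qed
  have "(\<lambda>n. \<integral>x. g n x \<partial>lborel) \<longlonglongrightarrow> (\<integral>x. f' x \<partial>lborel)"
  proof (rule integral_dominated_convergence)
    show "integrable lborel (\<lambda>x::real^'n. indicator (cball 0 (r + 1)) x * \<bar>B\<bar> :: real)"
      using borel_integrable_compact[of "cball (0::real^'n) (r + 1)" "\<lambda>_. \<bar>B\<bar>"] by simp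
  qed (use lim bound in \<open>auto simp: g_def\<close>)
  then show ?thesis by (simp add: g0 LIMSEQ_const_iff)
qed

lemma integration_by_parts:
  assumes \<phi>: "\<phi> \<in> test_functions D" and \<psi>: "\<psi> \<in> test_functions D" and D: "open D" "bounded D"
  shows "l2_inner D \<phi> (partial i \<psi>) = - l2_inner D (partial i \<phi>) \<psi>"
proof -
  obtain S where S: "compact S" "S \<subseteq> D" "\<And>x. x \<notin> S \<Longrightarrow> \<phi> x = 0" "\<And>k. C_k k \<phi>" "continuous_on UNIV \<phi>"
    "\<And>x. \<phi> differentiable at x" "\<And>i. continuous_on UNIV (partial i \<phi>)" "\<And>x i. x \<notin> S \<Longrightarrow> partial i \<phi> x = 0"
    by (rule test_functionsE[OF \<phi>]) (rule that, assumption+)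
  obtain S' where S': "compact S'" "S' \<subseteq> D" "\<And>x. x \<notin> S' \<Longrightarrow> \<psi> x = 0" "\<And>k. C_k k \<psi>" "continuous_on UNIV \<psi>"
    "\<And>x. \<psi> differentiable at x" "\<And>i. continuous_on UNIV (partial i \<psi>)" "\<And>x i. x \<notin> S' \<Longrightarrow> partial i \<psi> x = 0"
    by (rule test_functionsE[OF \<psi>]) (rule that, assumption+)
  have "(\<integral>x. \<phi> x * partial i \<psi> x + partial i \<phi> x * \<psi> x \<partial>lborel) = 0"
  proof (rule integral_partial_zero[OF S(1), where f="\<lambda>x. \<phi> x * \<psi> x" and i=i])
    show "((\<lambda>t. \<phi> (x + t *\<^sub>R axis i 1) * \<psi> (x + t *\<^sub>R axis i 1)) has_real_derivative
            \<phi> (x + t *\<^sub>R axis i 1) * partial i \<psi> (x + t *\<^sub>R axis i 1) + partial i \<phi> (x + t *\<^sub>R axis i 1) * \<psi> (x + t *\<^sub>R axis i 1)) (at t)" for x t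
      by (rule derivative_eq_intros partial_line_derivative S(6) S'(6) refl)+ simp
  qed (use S S' in \<open>auto intro!: continuous_intros\<close>)
  moreover have "(LINT x|lebesgue_on D. \<phi> x * partial i \<psi> x + partial i \<phi> x * \<psi> x)
      = (\<integral>x. \<phi> x * partial i \<psi> x + partial i \<phi> x * \<psi> x \<partial>lborel)"
  proof (intro integral_lebesgue_on_eq_lborel continuous_intros S S' D(1))
    fix x assume "x \<notin> D"
    then have "x \<notin> S" using S(2) by blast
    then show "\<phi> x * partial i \<psi> x + partial i \<phi> x * \<psi> x = 0" by (simp add: S(3,8))
  qed
  moreover have "(LINT x|lebesgue_on D. \<phi> x * partial i \<psi> x + partial i \<phi> x * \<psi> x)
    = l2_inner D \<phi> (partial i \<psi>) + l2_inner D (partial i \<phi>) \<psi>"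
    unfolding l2_inner_def using \<phi> \<psi> D
    by (intro Bochner_Integration.integral_add L2_mult_integrable test_functions_L2 partial_test)
  ultimately show ?thesis by simp
qed

section \<open>The fundamental lemma of the calculus of variations\<close>

text \<open>The positive and the negative part of \<open>g\<close> are densities of measures that agree on the generator of
  all boxes, hence they are equal.\<close>

lemma AE_zero_if_box_integrals_zero:
  fixes g :: "'a::euclidean_space \<Rightarrow> real"
  assumes g: "integrable lborel g" and zero: "\<And>l u. (\<integral>x. indicator (box l u) x * g x \<partial>lborel) = 0"
  shows "AE x in lborel. g x = 0"
proof -
  have [measurable]: "g \<in> borel_measurable borel" using g by auto
  let ?E = "range (\<lambda>(a, b). box a b::'a set)"
  let ?A = "\<lambda>n::nat. box (- (real n *\<^sub>R One)) (real n *\<^sub>R One) :: 'a set"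
  let ?P = "density lborel (\<lambda>x. ennreal (g x))" and ?N = "density lborel (\<lambda>x. ennreal (- g x))"
  have P: "emeasure ?P (box l u) = (\<integral>\<^sup>+ x. ennreal (indicator (box l u) x * g x) \<partial>lborel)" for l u
    by (subst emeasure_density) (auto intro!: nn_integral_cong simp: indicator_def)
  have N: "emeasure ?N (box l u) = (\<integral>\<^sup>+ x. ennreal (- (indicator (box l u) x * g x)) \<partial>lborel)" for l u
    by (subst emeasure_density) (auto intro!: nn_integral_cong simp: indicator_def)
  have i: "integrable lborel (\<lambda>x. indicator (box l u) x * g x)" for l u
    using integrable_mult_indicator[OF _ g, of "box l u"] by simp
  have fin: "emeasure ?P (box l u) \<noteq> \<infinity>" "emeasure ?N (box l u) \<noteq> \<infinity>" for l u
    unfolding P N using i[of l u] by (simp_all add: real_integrable_def)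
  have eq: "emeasure ?P (box l u) = emeasure ?N (box l u)" for l u
  proof -
    have "enn2real (emeasure ?P (box l u)) = enn2real (emeasure ?N (box l u))"
      using zero[of l u] real_lebesgue_integral_def[OF i[of l u]] unfolding P N by simp
    then show ?thesis using fin[of l u] by (metis ennreal_enn2real less_top infinity_ennreal_def)
  qed
  have "?P = ?N"
  proof (rule measure_eqI_generator_eq)
    show "Int_stable ?E" by (auto simp: Int_stable_def box_Int_box)
    show "?E \<subseteq> Pow UNIV" "sets ?P = sigma_sets UNIV ?E" "sets ?N = sigma_sets UNIV ?E"
      by (simp_all add: borel_eq_box)
    show "range ?A \<subseteq> ?E" "(\<Union>i. ?A i) = UNIV" unfolding UN_box_eq_UNIV by auto
    show "emeasure ?P (?A i) \<noteq> \<infinity>" for i by (rule fin)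
    show "emeasure ?P X = emeasure ?N X" if "X \<in> ?E" for X using that eq by auto
  qed
  then have "AE x in lborel. ennreal (g x) = ennreal (- g x)"
    by (intro sigma_finite_measure.density_unique[OF sigma_finite_lborel]) auto
  then show ?thesis
  proof eventually_elim
    fix x assume h: "ennreal (g x) = ennreal (- g x)"
    show "g x = 0"
    proof (cases "0 \<le> g x")
      case True
      then have "ennreal (g x) = 0" using h by (simp add: ennreal_neg)
      then show ?thesis using True by (simp add: ennreal_eq_0_iff)
    next
      case False
      then have "ennreal (- g x) = 0" using h by (simp add: ennreal_neg)
      then show ?thesis using False by (simp add: ennreal_eq_0_iff)
    qed
  qed
qed

text \<open>A family of functions containing the classical example \<open>exp (- 1 / x)\<close> of a smooth function that is
  not analytic, and closed under differentiation.\<close>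

definition smooth_exp :: "real poly \<Rightarrow> real \<Rightarrow> real" where
  "smooth_exp p x = (if 0 < x then poly p (1 / x) * exp (- (1 / x)) else 0)"

definition smooth_exp_step :: "real poly \<Rightarrow> real poly" where
  "smooth_exp_step p = [:0, 0, 1:] * (p - pderiv p)"

lemma poly_div_exp_tendsto_0: "((\<lambda>y. poly p y * exp (- y)) \<longlongrightarrow> (0::real)) at_top"
proof -
  have "((\<lambda>y. \<Sum>i\<le>degree p. coeff p i * (y ^ i / exp y)) \<longlongrightarrow> (\<Sum>i\<le>degree p. coeff p i * 0)) at_top"
    by (intro tendsto_intros tendsto_power_div_exp_0)
  then show ?thesis
    by (simp add: poly_altdef exp_minus divide_inverse sum_distrib_right mult.assoc)
qed

lemma smooth_exp_deriv: "(smooth_exp p has_real_derivative smooth_exp (smooth_exp_step p) x) (at x)"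
proof -
  consider "x < 0" | "x = 0" | "x > 0" by linarith
  then show ?thesis
  proof cases
    case 1
    have "((\<lambda>_. 0) has_real_derivative 0) (at x)" by simp
    then have "(smooth_exp p has_real_derivative 0) (at x)"
      by (rule has_field_derivative_transform_within_open[of _ _ _ "{..<0}"]) (use 1 in \<open>auto simp: smooth_exp_def\<close>)
    then show ?thesis using 1 by (simp add: smooth_exp_def)
  next
    case 3
    have "((\<lambda>x. poly p (1 / x) * exp (- (1 / x))) has_real_derivative
      poly (pderiv p) (1 / x) * (- (1 / x\<^sup>2)) * exp (- (1 / x)) + exp (- (1 / x)) * (1 / x\<^sup>2) * poly p (1 / x)) (at x)"
      using 3 by (auto intro!: derivative_eq_intros DERIV_chain2[OF poly_DERIV] simp: power2_eq_square field_simps)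
    also have "poly (pderiv p) (1 / x) * (- (1 / x\<^sup>2)) * exp (- (1 / x)) + exp (- (1 / x)) * (1 / x\<^sup>2) * poly p (1 / x)
      = smooth_exp (smooth_exp_step p) x"
      using 3 by (simp add: smooth_exp_def smooth_exp_step_def power2_eq_square algebra_simps)
    finally have "((\<lambda>x. poly p (1 / x) * exp (- (1 / x))) has_real_derivative smooth_exp (smooth_exp_step p) x) (at x)" .
    then show ?thesis
      by (rule has_field_derivative_transform_within_open[of _ _ _ "{0<..}"]) (use 3 in \<open>auto simp: smooth_exp_def\<close>)
  next
    case 2
    have "((\<lambda>h. smooth_exp p h / h) \<longlongrightarrow> 0) (at_left 0)"
      by (rule tendsto_eventually) (auto simp: eventually_at_filter smooth_exp_def)
    moreover have "((\<lambda>h. smooth_exp p h / h) \<longlongrightarrow> 0) (at_right 0)"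
    proof (rule Lim_transform_eventually)
      have "filterlim (\<lambda>h. 1 / h :: real) at_top (at_right 0)"
        using filterlim_inverse_at_top_right by (simp add: inverse_eq_divide)
      from filterlim_compose[OF poly_div_exp_tendsto_0[of "pCons 0 p"] this]
      show "((\<lambda>h. poly (pCons 0 p) (1 / h) * exp (- (1 / h))) \<longlongrightarrow> 0) (at_right 0)" .
      show "\<forall>\<^sub>F h in at_right 0. poly (pCons 0 p) (1 / h) * exp (- (1 / h)) = smooth_exp p h / h"
        by (auto simp: eventually_at_filter smooth_exp_def)
    qed
    ultimately have "((\<lambda>h. smooth_exp p h / h) \<longlongrightarrow> 0) (at 0)" by (rule filterlim_split_at)
    then show ?thesis using 2 by (simp add: has_field_derivative_iff smooth_exp_def)
  qed
qed

lemma C_k_const: "C_k k (\<lambda>_ :: real ^ 'n. c)"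
proof (induction k arbitrary: c)
  case (Suc k)
  have "partial i (\<lambda>_ :: real ^ 'n. c) = (\<lambda>_. 0)" for i by (rule ext) (simp add: partial_def)
  then show ?case using Suc by simp
qed auto

lemma C_k_sum: "(\<And>j. j \<in> J \<Longrightarrow> C_k k (f j)) \<Longrightarrow> C_k k (\<lambda>x. \<Sum>j\<in>J. c j * f j x)"
proof (induction J rule: infinite_finite_induct)
  case (insert j J)
  then show ?case using C_k_lin[of k "f j" "\<lambda>x. \<Sum>j\<in>J. c j * f j x" "c j" 1] by simp
qed (auto simp: C_k_const)

text \<open>A partial derivative of such a product is a linear combination of products of the same kind, so
  an induction over \<open>k\<close> with arbitrary polynomials works.\<close>

lemma C_k_prod_smooth_exp:
  fixes a :: "'j \<Rightarrow> real ^ 'n"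
  assumes J: "finite J"
  shows "C_k k (\<lambda>x. \<Prod>j\<in>J. smooth_exp (p j) (a j \<bullet> x + b j))"
proof (induction k arbitrary: p)
  have d: "((\<lambda>x. smooth_exp (p j) (a j \<bullet> x + b j)) has_derivative
      (\<lambda>h. smooth_exp (smooth_exp_step (p j)) (a j \<bullet> x + b j) * (a j \<bullet> h))) (at x)" for j x and p :: "'j \<Rightarrow> real poly"
  proof -
    have "((\<lambda>x. a j \<bullet> x + b j) has_derivative (\<lambda>h. a j \<bullet> h)) (at x)"
      by (auto intro!: derivative_eq_intros)
    from has_derivative_compose[OF this smooth_exp_deriv[of "p j", unfolded has_field_derivative_def]]
    show ?thesis .
  qed
  have pd: "((\<lambda>x. \<Prod>j\<in>J. smooth_exp (p j) (a j \<bullet> x + b j)) has_derivative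
    (\<lambda>h. \<Sum>j\<in>J. smooth_exp (smooth_exp_step (p j)) (a j \<bullet> x + b j) * (a j \<bullet> h) *
        (\<Prod>l\<in>J - {j}. smooth_exp (p l) (a l \<bullet> x + b l)))) (at x)" for x and p :: "'j \<Rightarrow> real poly"
    by (rule has_derivative_prod) (rule d)
  {
    case 0
    show ?case
      using has_derivative_continuous[OF pd] by (simp add: continuous_on_eq_continuous_within)
  next
    case (Suc k)
    have "partial i (\<lambda>x. \<Prod>j\<in>J. smooth_exp (p j) (a j \<bullet> x + b j))
      = (\<lambda>x. \<Sum>j\<in>J. (a j \<bullet> axis i 1) * (\<Prod>l\<in>J. smooth_exp ((p(j := smooth_exp_step (p j))) l) (a l \<bullet> x + b l)))" for i
    proof
      fix x
      have "partial i (\<lambda>x. \<Prod>j\<in>J. smooth_exp (p j) (a j \<bullet> x + b j)) x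
        = (\<Sum>j\<in>J. smooth_exp (smooth_exp_step (p j)) (a j \<bullet> x + b j) * (a j \<bullet> axis i 1) *
        (\<Prod>l\<in>J - {j}. smooth_exp (p l) (a l \<bullet> x + b l)))"
        by (simp add: partial_def frechet_derivative_at[OF pd, symmetric])
      also have "\<dots> = (\<Sum>j\<in>J. (a j \<bullet> axis i 1) * (\<Prod>l\<in>J. smooth_exp ((p(j := smooth_exp_step (p j))) l) (a l \<bullet> x + b l)))"
      proof (rule sum.cong[OF refl])
        fix j assume j: "j \<in> J"
        have "(\<Prod>l\<in>J. smooth_exp ((p(j := smooth_exp_step (p j))) l) (a l \<bullet> x + b l))
          = smooth_exp (smooth_exp_step (p j)) (a j \<bullet> x + b j) * (\<Prod>l\<in>J - {j}. smooth_exp ((p(j := smooth_exp_step (p j))) l) (a l \<bullet> x + b l))"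
          by (subst prod.remove[OF J j]) simp
        also have "(\<Prod>l\<in>J - {j}. smooth_exp ((p(j := smooth_exp_step (p j))) l) (a l \<bullet> x + b l)) = (\<Prod>l\<in>J - {j}. smooth_exp (p l) (a l \<bullet> x + b l))"
          by (rule prod.cong) auto
        finally show "smooth_exp (smooth_exp_step (p j)) (a j \<bullet> x + b j) * (a j \<bullet> axis i 1) *
            (\<Prod>l\<in>J - {j}. smooth_exp (p l) (a l \<bullet> x + b l))
          = (a j \<bullet> axis i 1) * (\<Prod>l\<in>J. smooth_exp ((p(j := smooth_exp_step (p j))) l) (a l \<bullet> x + b l))"
          by (simp only: mult_ac)
      qed
      finally show "partial i (\<lambda>x. \<Prod>j\<in>J. smooth_exp (p j) (a j \<bullet> x + b j)) x
        = (\<Sum>j\<in>J. (a j \<bullet> axis i 1) * (\<Prod>l\<in>J. smooth_exp ((p(j := smooth_exp_step (p j))) l) (a l \<bullet> x + b l)))" .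
    qed
    moreover have "(\<lambda>x. \<Prod>j\<in>J. smooth_exp (p j) (a j \<bullet> x + b j)) differentiable at x" for x
      using pd by (auto simp: differentiable_def)
    ultimately show ?case using Suc by (simp add: C_k_sum del: fun_upd_apply)
  }
qed

text \<open>Each coordinate contributes two factors \<open>exp (- 1 / y)\<close>, with
  \<open>y = (m + 1) (x - l) - 1\<close> and \<open>y = (m + 1) (u - x) - 1\<close>. The shift by \<open>1\<close> keeps the support at distance
  \<open>1 / (m + 1)\<close> from the faces of the box.\<close>

lemma box_bump_functions:
  fixes l u :: "real ^ 'n"
  obtains \<psi> :: "nat \<Rightarrow> real ^ 'n \<Rightarrow> real" where "\<And>m. \<psi> m \<in> test_functions (box l u)" "\<And>m x. \<bar>\<psi> m x\<bar> \<le> 1"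
    "\<And>x. (\<lambda>m. \<psi> m x) \<longlonglongrightarrow> indicator (box l u) x"
proof -
  define arg where "arg m j x = (if snd j then real (Suc m) * (x $ fst j - l $ fst j) - 1 else real (Suc m) * (u $ fst j - x $ fst j) - 1)"
    for m and j :: "'n \<times> bool" and x :: "real ^ 'n"
  define \<psi> where "\<psi> m x = (\<Prod>j\<in>UNIV. smooth_exp 1 (arg m j x))" for m x
  have se: "\<bar>smooth_exp 1 y\<bar> \<le> 1" for y by (simp add: smooth_exp_def)
  have "\<psi> m \<in> test_functions (box l u)" for m
  proof -
    define a where "a j = (if snd j then real (Suc m) else - real (Suc m)) *\<^sub>R (axis (fst j) 1 :: real ^ 'n)" for j :: "'n \<times> bool"
    define b where "b j = (if snd j then - real (Suc m) * l $ fst j - 1 else real (Suc m) * u $ fst j - 1)" for j :: "'n \<times> bool"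
    have "arg m j x = a j \<bullet> x + b j" for j x
      by (auto simp: arg_def a_def b_def inner_axis' algebra_simps)
    then have ck: "C_k k (\<psi> m)" for k
      unfolding \<psi>_def using C_k_prod_smooth_exp[of UNIV k "\<lambda>_. 1" a b] by simp
    define S where "S = cbox (\<chi> i. l $ i + 1 / real (Suc m)) (\<chi> i. u $ i - 1 / real (Suc m))"
    have "S \<subseteq> box l u"
    proof
      fix x assume "x \<in> S"
      then have h: "l $ i + 1 / real (Suc m) \<le> x $ i" "x $ i \<le> u $ i - 1 / real (Suc m)" for i
        by (simp_all add: S_def mem_box_cart)
      have "0 < 1 / real (Suc m)" by simp
      then have "l $ i < x $ i \<and> x $ i < u $ i" for i using h[of i] by linarith
      then show "x \<in> box l u" by (simp add: mem_box_cart)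
    qed
    moreover have "\<psi> m x = 0" if "x \<notin> S" for x
    proof -
      have "\<not> (\<forall>i. l $ i + 1 / real (Suc m) \<le> x $ i \<and> x $ i \<le> u $ i - 1 / real (Suc m))"
        using that by (simp add: S_def mem_box_cart)
      then obtain i where "\<not> (l $ i + 1 / real (Suc m) \<le> x $ i \<and> x $ i \<le> u $ i - 1 / real (Suc m))" by blast
      then have "x $ i < l $ i + 1 / real (Suc m) \<or> u $ i - 1 / real (Suc m) < x $ i" by linarith
      then have "arg m (i, True) x \<le> 0 \<or> arg m (i, False) x \<le> 0"
        by (auto simp: arg_def field_simps)
      then have "\<exists>j. smooth_exp 1 (arg m j x) = 0" by (auto simp: smooth_exp_def not_less)
      then show ?thesis unfolding \<psi>_def by (intro prod_zero) auto
    qed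
    moreover have "compact S" by (simp add: S_def)
    ultimately have "\<exists>S. compact S \<and> S \<subseteq> box l u \<and> (\<forall>x. x \<notin> S \<longrightarrow> \<psi> m x = 0)" by blast
    then show ?thesis unfolding test_functions_def using ck by simp
  qed
  moreover have "\<bar>\<psi> m x\<bar> \<le> 1" for m x
    unfolding \<psi>_def abs_prod by (rule prod_le_1) (use se in auto)
  moreover have "(\<lambda>m. \<psi> m x) \<longlonglongrightarrow> indicator (box l u) x" for x
  proof (cases "x \<in> box l u")
    case True
    have "(\<lambda>m. smooth_exp 1 (arg m j x)) \<longlonglongrightarrow> 1" for j
    proof -
      define c where "c = (if snd j then x $ fst j - l $ fst j else u $ fst j - x $ fst j)"
      have c: "c > 0" using True by (auto simp: c_def mem_box_cart)
      have arg: "arg m j x = real (Suc m) * c - 1" for m by (simp add: arg_def c_def)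
      have "eventually (\<lambda>m. real (Suc m) * c - 1 > 0) sequentially"
        using c by real_asymp
      then have "eventually (\<lambda>m. exp (- (1 / (real (Suc m) * c - 1))) = smooth_exp 1 (arg m j x)) sequentially"
        by eventually_elim (simp add: arg smooth_exp_def)
      moreover have "(\<lambda>m. exp (- (1 / (real (Suc m) * c - 1)))) \<longlonglongrightarrow> 1"
        using c by real_asymp
      ultimately show ?thesis by (rule Lim_transform_eventually[rotated])
    qed
    then have "(\<lambda>m. \<psi> m x) \<longlonglongrightarrow> (\<Prod>j\<in>(UNIV :: ('n \<times> bool) set). 1)"
      unfolding \<psi>_def by (intro tendsto_prod)
    then show ?thesis using True by simp
  next
    case False
    then have "\<not> (\<forall>i. l $ i < x $ i \<and> x $ i < u $ i)" by (simp add: mem_box_cart)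
    then obtain i where "\<not> (l $ i < x $ i \<and> x $ i < u $ i)" by blast
    then have i: "x $ i \<le> l $ i \<or> u $ i \<le> x $ i" by linarith
    have "\<psi> m x = 0" for m
    proof -
      have "arg m (i, True) x \<le> 0 \<or> arg m (i, False) x \<le> 0"
        using i mult_nonneg_nonpos[of "real (Suc m)" "x $ i - l $ i"] mult_nonneg_nonpos[of "real (Suc m)" "u $ i - x $ i"]
        unfolding arg_def fst_conv snd_conv if_True if_False by fastforce
      then have "\<exists>j. smooth_exp 1 (arg m j x) = 0" by (auto simp: smooth_exp_def not_less)
      then show ?thesis unfolding \<psi>_def by (intro prod_zero) auto
    qed
    then show ?thesis using False by simp
  qed
  ultimately show ?thesis using that by blast
qed

text \<open>Bump functions approximate the indicators of boxes boundedly, so \<open>g\<close> has integral \<open>0\<close> over every box.\<close>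

lemma fundamental_lemma_calculus_of_variations:
  fixes g :: "real ^ 'n \<Rightarrow> real"
  assumes g: "g \<in> L2_space (box a b)"
    and zero: "\<And>\<phi>. \<phi> \<in> test_functions (box a b) \<Longrightarrow> l2_inner (box a b) g \<phi> = 0"
  shows "l2_norm (box a b) g = 0"
proof -
  define D where "D = box a b"
  have D: "D \<in> sets lebesgue" "bounded D" by (auto simp: D_def)
  have one: "(\<lambda>_. 1) \<in> L2_space D" using D by (intro L2_bounded[of D _ 1]) auto
  have gi: "integrable (lebesgue_on D) g"
    using L2_mult_integrable[OF g[folded D_def] one] by simp
  have box0: "(LINT x|lebesgue_on D. g x * indicator (box l u) x) = 0" for l u
  proof -
    obtain l' u' where B: "box l u \<inter> D = box l' u'" unfolding D_def box_Int_box by blast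
    obtain \<psi> :: "nat \<Rightarrow> real ^ 'n \<Rightarrow> real" where \<psi>: "\<And>m. \<psi> m \<in> test_functions (box l' u')" "\<And>m x. \<bar>\<psi> m x\<bar> \<le> 1"
      "\<And>x. (\<lambda>m. \<psi> m x) \<longlonglongrightarrow> indicator (box l' u') x" by (rule box_bump_functions) (rule that, assumption+)
    have "\<psi> m \<in> test_functions D" for m using \<psi>(1)[of m] B unfolding test_functions_def by blast
    then have z: "l2_inner D g (\<psi> m) = 0" for m using zero by (simp add: D_def)
    have [measurable]: "\<psi> m \<in> borel_measurable (lebesgue_on D)" for m
    proof -
      have "continuous_on UNIV (\<psi> m)" using \<psi>(1)[of m] C_k_continuous unfolding test_functions_def by blast
      then show ?thesis using D(1) continuous_imp_measurable_on_sets_lebesgue continuous_on_subset by blast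
    qed
    have [measurable]: "g \<in> borel_measurable (lebesgue_on D)" using gi by auto
    have [measurable]: "indicator (box l' u') \<in> borel_measurable (lebesgue_on D)"
      by (intro borel_measurable_indicator) (auto simp: B[symmetric] sets_restrict_space_iff D(1) intro!: sets.Int)
    have "(\<lambda>m. LINT x|lebesgue_on D. g x * \<psi> m x) \<longlonglongrightarrow> (LINT x|lebesgue_on D. g x * indicator (box l' u') x)"
    proof (rule integral_dominated_convergence[where w="\<lambda>x. \<bar>g x\<bar>"])
      show "AE x in lebesgue_on D. norm (g x * \<psi> m x) \<le> \<bar>g x\<bar>" for m
        using \<psi>(2)[of m] by (auto simp: abs_mult mult_left_le)
      show "AE x in lebesgue_on D. (\<lambda>m. g x * \<psi> m x) \<longlonglongrightarrow> g x * indicator (box l' u') x"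
        using \<psi>(3) by (intro AE_I2 tendsto_mult tendsto_const)
    qed (use gi in auto)
    then have "(LINT x|lebesgue_on D. g x * indicator (box l' u') x) = 0"
      using z by (simp add: l2_inner_def LIMSEQ_const_iff)
    moreover have "(LINT x|lebesgue_on D. g x * indicator (box l' u') x) = (LINT x|lebesgue_on D. g x * indicator (box l u) x)"
      unfolding B[symmetric] by (intro Bochner_Integration.integral_cong) (auto simp: indicator_def space_restrict_space)
    ultimately show ?thesis by simp
  qed
  define g0 where "g0 = (\<lambda>x. indicator D x * g x)"
  have g0i: "integrable lebesgue g0"
    using gi D(1) by (simp add: g0_def integrable_restrict_space)
  obtain g1 where g1: "g1 \<in> borel_measurable lborel" "AE x in lborel. g0 x = g1 x"
    using completion_ex_borel_measurable_real[of g0 lborel] g0i by (metis borel_measurable_integrable)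
  have AEl: "AE x in lebesgue. g0 x = g1 x" using g1(2) by (rule AE_completion)
  have g1m: "g1 \<in> borel_measurable borel" using g1(1) by simp
  have g1l: "g1 \<in> borel_measurable lebesgue" using g1(1) by (rule measurable_completion)
  have g0l: "g0 \<in> borel_measurable lebesgue" using g0i by auto
  have "integrable lebesgue g1"
    using g0i AEl integrable_cong_AE[OF g0l g1l] by blast
  then have g1i: "integrable lborel g1" using g1(1) by (simp add: integrable_completion)
  have "AE x in lborel. g1 x = 0"
  proof (rule AE_zero_if_box_integrals_zero[OF g1i])
    fix l u :: "real ^ 'n"
    have [measurable]: "box l u \<in> sets borel" by simp
    have m: "(\<lambda>x. indicator (box l u) x * g1 x) \<in> borel_measurable lborel" using g1m by simp
    have "(\<integral>x. indicator (box l u) x * g1 x \<partial>lborel) = (LINT x|lebesgue. indicator (box l u) x * g1 x)"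
      by (rule integral_completion[symmetric, OF m])
    also have "\<dots> = (LINT x|lebesgue. indicator (box l u) x * g0 x)"
    proof (rule integral_cong_AE)
      show "(\<lambda>x. indicator (box l u) x * g1 x) \<in> borel_measurable lebesgue" using m by (rule measurable_completion)
      show "(\<lambda>x. indicator (box l u) x * g0 x) \<in> borel_measurable lebesgue"
        by (intro borel_measurable_times borel_measurable_indicator g0l) simp
      show "AE x in lebesgue. indicator (box l u) x * g1 x = indicator (box l u) x * g0 x"
        using AEl by eventually_elim simp
    qed
    also have "\<dots> = (LINT x|lebesgue_on D. g x * indicator (box l u) x)"
      using D(1) by (subst integral_restrict_space) (auto simp: g0_def mult_ac)
    finally show "(\<integral>x. indicator (box l u) x * g1 x \<partial>lborel) = 0" using box0 by simp
  qed
  then have "AE x in lebesgue. g1 x = 0" by (rule AE_completion)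
  with AEl have "AE x in lebesgue. g0 x = 0" by eventually_elim simp
  then have "AE x in lebesgue_on D. g x = 0"
    using D(1) by (subst AE_restrict_space_iff) (auto simp: g0_def elim!: eventually_mono)
  then have "AE x in lebesgue_on D. g x * g x = 0" by eventually_elim simp
  then have "(LINT x|lebesgue_on D. g x * g x) = 0" by (rule integral_eq_zero_AE)
  then show ?thesis by (simp add: l2_norm_def l2_inner_def D_def)
qed

section \<open>The Sobolev space with zero boundary values\<close>

lemma weak_partial_spec:
  assumes "f \<in> H1_space D"
  shows "weak_partial D i f \<in> L2_space D" "is_weak_partial D i f (weak_partial D i f)"
proof -
  have "\<exists>g. g \<in> L2_space D \<and> is_weak_partial D i f g" using assms by (auto simp: H1_space_def)
  from someI_ex[OF this] show "weak_partial D i f \<in> L2_space D" "is_weak_partial D i f (weak_partial D i f)"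
    by (simp_all add: weak_partial_def)
qed

lemma is_weak_partial_lin:
  assumes D: "open D" "bounded D" and L2: "f \<in> L2_space D" "g \<in> L2_space D" "f' \<in> L2_space D" "g' \<in> L2_space D"
    and w: "is_weak_partial D i f f'" "is_weak_partial D i g g'"
  shows "is_weak_partial D i (\<lambda>x. a * f x + b * g x) (\<lambda>x. a * f' x + b * g' x)"
  unfolding is_weak_partial_def
proof
  fix \<phi> assume \<phi>: "\<phi> \<in> test_functions D"
  have "\<phi> \<in> L2_space D" "partial i \<phi> \<in> L2_space D"
    using \<phi> D by (auto intro: test_functions_L2 partial_test)
  then show "l2_inner D (\<lambda>x. a * f x + b * g x) (partial i \<phi>) = - l2_inner D (\<lambda>x. a * f' x + b * g' x) \<phi>"
    using w \<phi> L2 by (simp add: l2_inner_lin_left is_weak_partial_def)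
qed

lemma H1_lin:
  assumes D: "open D" "bounded D" and "f \<in> H1_space D" "g \<in> H1_space D"
  shows "(\<lambda>x. a * f x + b * g x) \<in> H1_space D"
proof -
  have L2: "f \<in> L2_space D" "g \<in> L2_space D" using assms by (auto simp: H1_space_def)
  have "\<exists>h\<in>L2_space D. is_weak_partial D i (\<lambda>x. a * f x + b * g x) h" for i
    using is_weak_partial_lin[OF D L2 weak_partial_spec(1)[OF assms(3)] weak_partial_spec(1)[OF assms(4)]
        weak_partial_spec(2)[OF assms(3)] weak_partial_spec(2)[OF assms(4)], of i a b]
      L2_lin[OF weak_partial_spec(1)[OF assms(3)] weak_partial_spec(1)[OF assms(4)]] by blast
  then show ?thesis using L2 by (simp add: H1_space_def L2_lin)
qed

lemma test_functions_H1:
  assumes "\<phi> \<in> test_functions D" "open D" "bounded D"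
  shows "\<phi> \<in> H1_space D" "is_weak_partial D i \<phi> (partial i \<phi>)"
proof -
  show w: "is_weak_partial D i \<phi> (partial i \<phi>)" for i
    using integration_by_parts assms by (auto simp: is_weak_partial_def)
  then show "\<phi> \<in> H1_space D"
    using test_functions_L2 partial_test assms unfolding H1_space_def by blast
qed

text \<open>The selected weak derivative of a linear combination need not be the combination of the selected weak
  derivatives; uniqueness up to null functions is what makes \<open>h1_norm\<close> behave like a norm.\<close>

lemma weak_partial_unique:
  assumes "f \<in> L2_space (box l u)" "g \<in> L2_space (box l u)" "g' \<in> L2_space (box l u)"
    "is_weak_partial (box l u) i f g" "is_weak_partial (box l u) i f g'"
  shows "l2_norm (box l u) (\<lambda>x. g x - g' x) = 0"
proof (rule fundamental_lemma_calculus_of_variations)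
  show "(\<lambda>x. g x - g' x) \<in> L2_space (box l u)" using assms by (intro L2_diff)
  fix \<phi> assume \<phi>: "\<phi> \<in> test_functions (box l u)"
  have "\<phi> \<in> L2_space (box l u)" using \<phi> by (rule test_functions_L2) auto
  then show "l2_inner (box l u) (\<lambda>x. g x - g' x) \<phi> = 0"
    using assms \<phi> by (simp add: l2_inner_diff_left is_weak_partial_def)
qed

lemma l2_norm_weak_partial_lin:
  assumes f: "f \<in> H1_space (box l u)" "g \<in> H1_space (box l u)"
  shows "l2_norm (box l u) (weak_partial (box l u) i (\<lambda>x. a * f x + b * g x))
    \<le> \<bar>a\<bar> * l2_norm (box l u) (weak_partial (box l u) i f) + \<bar>b\<bar> * l2_norm (box l u) (weak_partial (box l u) i g)"
proof -
  define D where "D = box l u"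
  have D: "open D" "bounded D" by (auto simp: D_def)
  note f = f[folded D_def]
  let ?h = "\<lambda>x. a * f x + b * g x" and ?f = "weak_partial D i f" and ?g = "weak_partial D i g"
  have L2: "f \<in> L2_space D" "g \<in> L2_space D" using f by (auto simp: H1_space_def)
  note s = weak_partial_spec(1)[OF f(1), of i] weak_partial_spec(1)[OF f(2), of i]
    weak_partial_spec(2)[OF f(1), of i] weak_partial_spec(2)[OF f(2), of i]
  have h: "?h \<in> H1_space D" using D f by (rule H1_lin)
  note hs = weak_partial_spec[OF h, of i]
  have l: "(\<lambda>x. a * ?f x + b * ?g x) \<in> L2_space D" using s by (intro L2_lin)
  have "l2_norm D (\<lambda>x. weak_partial D i ?h x - (a * ?f x + b * ?g x)) = 0"
    using weak_partial_unique[of ?h l u "weak_partial D i ?h" "\<lambda>x. a * ?f x + b * ?g x" i, folded D_def]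
      is_weak_partial_lin[OF D L2 s] hs L2 l by (simp add: L2_lin)
  then have "l2_norm D (weak_partial D i ?h) \<le> l2_norm D (\<lambda>x. a * ?f x + b * ?g x)"
    using l2_norm_triangle_diff[OF hs(1) l] by simp
  also have "\<dots> \<le> l2_norm D (\<lambda>x. a * ?f x) + l2_norm D (\<lambda>x. b * ?g x)"
    using s by (intro l2_norm_triangle L2_cmult)
  finally show ?thesis by (simp add: l2_norm_cmult D_def)
qed

text \<open>Splitting the norm into its components reduces convergence in \<open>H10_space\<close> to the seminorm
  \<open>l2_norm\<close>, which satisfies the triangle inequality.\<close>

lemma h1_norm_tendsto_0_iff:
  fixes f :: "nat \<Rightarrow> real ^ 'n \<Rightarrow> real"
  shows "(\<lambda>k. h1_norm D (f k)) \<longlonglongrightarrow> 0 \<longleftrightarrow>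
    (\<lambda>k. l2_norm D (f k)) \<longlonglongrightarrow> 0 \<and> (\<forall>i. (\<lambda>k. l2_norm D (weak_partial D i (f k))) \<longlonglongrightarrow> 0)"
proof -
  have h: "h1_norm D f = sqrt ((l2_norm D f)\<^sup>2 + (\<Sum>i\<in>UNIV. (l2_norm D (weak_partial D i f))\<^sup>2))" for f :: "real ^ 'n \<Rightarrow> real"
    by (simp add: h1_norm_def grad_inner_def l2_norm_square)
  have le: "l2_norm D f \<le> h1_norm D f" "l2_norm D (weak_partial D i f) \<le> h1_norm D f" for f :: "real ^ 'n \<Rightarrow> real" and i
  proof -
    show "l2_norm D f \<le> h1_norm D f" unfolding h by (intro real_le_rsqrt) (simp add: sum_nonneg)
    have "(l2_norm D (weak_partial D i f))\<^sup>2 \<le> (\<Sum>i\<in>UNIV. (l2_norm D (weak_partial D i f))\<^sup>2)"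
      by (intro member_le_sum) auto
    then show "l2_norm D (weak_partial D i f) \<le> h1_norm D f" unfolding h
      by (intro real_le_rsqrt) (simp add: add_increasing)
  qed
  show ?thesis
  proof (intro iffI conjI allI)
    assume "(\<lambda>k. h1_norm D (f k)) \<longlonglongrightarrow> 0"
    then show "(\<lambda>k. l2_norm D (f k)) \<longlonglongrightarrow> 0" "(\<lambda>k. l2_norm D (weak_partial D i (f k))) \<longlonglongrightarrow> 0" for i
      by (rule tendsto_sandwich[OF _ _ tendsto_const, rotated 2]; simp add: le)+
  next
    assume *: "(\<lambda>k. l2_norm D (f k)) \<longlonglongrightarrow> 0 \<and> (\<forall>i. (\<lambda>k. l2_norm D (weak_partial D i (f k))) \<longlonglongrightarrow> 0)"
    have "(\<lambda>k. sqrt ((l2_norm D (f k))\<^sup>2 + (\<Sum>i\<in>UNIV. (l2_norm D (weak_partial D i (f k)))\<^sup>2)))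
      \<longlonglongrightarrow> sqrt (0\<^sup>2 + (\<Sum>i\<in>(UNIV :: 'n set). 0\<^sup>2))"
      using * by (intro tendsto_intros) auto
    then show "(\<lambda>k. h1_norm D (f k)) \<longlonglongrightarrow> 0" unfolding h by simp
  qed
qed

lemma H10_lin:
  assumes f: "f \<in> H10_space (box l u)" and g: "g \<in> H10_space (box l u)"
  shows "(\<lambda>x. a * f x + b * g x) \<in> H10_space (box l u)"
proof -
  define D where "D = box l u"
  have D: "open D" "bounded D" by (auto simp: D_def)
  note f = f[folded D_def] and g = g[folded D_def]
  obtain \<phi> where \<phi>: "\<And>k. \<phi> k \<in> test_functions D" "(\<lambda>k::nat. h1_norm D (\<lambda>x. \<phi> k x - f x)) \<longlonglongrightarrow> 0"
    using f by (auto simp: H10_space_def)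
  obtain \<psi> where \<psi>: "\<And>k. \<psi> k \<in> test_functions D" "(\<lambda>k::nat. h1_norm D (\<lambda>x. \<psi> k x - g x)) \<longlonglongrightarrow> 0"
    using g by (auto simp: H10_space_def)
  have H1: "f \<in> H1_space D" "g \<in> H1_space D" using f g by (auto simp: H10_space_def)
  have df: "(\<lambda>x. \<phi> k x - f x) \<in> H1_space D" "(\<lambda>x. \<psi> k x - g x) \<in> H1_space D" for k
    using H1_lin[OF D test_functions_H1(1)[OF \<phi>(1)[of k] D] H1(1), of 1 "-1"]
      H1_lin[OF D test_functions_H1(1)[OF \<psi>(1)[of k] D] H1(2), of 1 "-1"] by simp_all
  have dL: "(\<lambda>x. \<phi> k x - f x) \<in> L2_space D" "(\<lambda>x. \<psi> k x - g x) \<in> L2_space D" for k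
    using df by (auto simp: H1_space_def)
  let ?d = "\<lambda>k x. a * (\<phi> k x - f x) + b * (\<psi> k x - g x)"
  have "(\<lambda>k. h1_norm D (?d k)) \<longlonglongrightarrow> 0"
    unfolding h1_norm_tendsto_0_iff
  proof (intro conjI allI)
    show "(\<lambda>k. l2_norm D (?d k)) \<longlonglongrightarrow> 0"
    proof (rule tendsto_sandwich[OF _ _ tendsto_const])
      show "\<forall>\<^sub>F k in sequentially. l2_norm D (?d k) \<le> \<bar>a\<bar> * l2_norm D (\<lambda>x. \<phi> k x - f x) + \<bar>b\<bar> * l2_norm D (\<lambda>x. \<psi> k x - g x)"
        using l2_norm_triangle[OF L2_cmult[OF dL(1)] L2_cmult[OF dL(2)]] by (simp add: l2_norm_cmult)
      have "(\<lambda>k. \<bar>a\<bar> * l2_norm D (\<lambda>x. \<phi> k x - f x) + \<bar>b\<bar> * l2_norm D (\<lambda>x. \<psi> k x - g x)) \<longlonglongrightarrow> \<bar>a\<bar> * 0 + \<bar>b\<bar> * 0"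
        using \<phi>(2) \<psi>(2) unfolding h1_norm_tendsto_0_iff by (intro tendsto_intros) auto
      then show "(\<lambda>k. \<bar>a\<bar> * l2_norm D (\<lambda>x. \<phi> k x - f x) + \<bar>b\<bar> * l2_norm D (\<lambda>x. \<psi> k x - g x)) \<longlonglongrightarrow> 0" by simp
    qed simp
    show "(\<lambda>k. l2_norm D (weak_partial D i (?d k))) \<longlonglongrightarrow> 0" for i
    proof (rule tendsto_sandwich[OF _ _ tendsto_const])
      show "\<forall>\<^sub>F k in sequentially. l2_norm D (weak_partial D i (?d k)) \<le>
          \<bar>a\<bar> * l2_norm D (weak_partial D i (\<lambda>x. \<phi> k x - f x)) + \<bar>b\<bar> * l2_norm D (weak_partial D i (\<lambda>x. \<psi> k x - g x))"
        unfolding D_def by (intro always_eventually allI l2_norm_weak_partial_lin df[unfolded D_def])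
      have "(\<lambda>k. \<bar>a\<bar> * l2_norm D (weak_partial D i (\<lambda>x. \<phi> k x - f x)) + \<bar>b\<bar> * l2_norm D (weak_partial D i (\<lambda>x. \<psi> k x - g x)))
         \<longlonglongrightarrow> \<bar>a\<bar> * 0 + \<bar>b\<bar> * 0"
        using \<phi>(2) \<psi>(2) unfolding h1_norm_tendsto_0_iff by (intro tendsto_intros) auto
      then show "(\<lambda>k. \<bar>a\<bar> * l2_norm D (weak_partial D i (\<lambda>x. \<phi> k x - f x)) + \<bar>b\<bar> * l2_norm D (weak_partial D i (\<lambda>x. \<psi> k x - g x)))
         \<longlonglongrightarrow> 0" by simp
    qed simp
  qed
  moreover have "?d k = (\<lambda>x. (a * \<phi> k x + b * \<psi> k x) - (a * f x + b * g x))" for k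
    by (auto simp: algebra_simps)
  ultimately have "(\<lambda>k. h1_norm D (\<lambda>x. (a * \<phi> k x + b * \<psi> k x) - (a * f x + b * g x))) \<longlonglongrightarrow> 0" by simp
  moreover have "(\<lambda>x. a * \<phi> k x + b * \<psi> k x) \<in> test_functions D" for k using \<phi>(1) \<psi>(1) by (intro test_functions_lin)
  ultimately have "\<exists>\<theta>. (\<forall>k. \<theta> k \<in> test_functions D) \<and> (\<lambda>k::nat. h1_norm D (\<lambda>x. \<theta> k x - (a * f x + b * g x))) \<longlonglongrightarrow> 0"
    by (intro exI[of _ "\<lambda>k x. a * \<phi> k x + b * \<psi> k x"]) simp
  then show ?thesis using H1_lin[OF D H1] unfolding H10_space_def D_def by simp
qed

section \<open>Vanishing boundary values\<close>

text \<open>The difference is the integral of \<open>t \<partial>\<^sub>i\<phi>\<close> along a segment. By Jensen's inequality its square is at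
  most the integral of the square, and after exchanging the integrals translation invariance applies. The
  estimate is stated with nonnegative integrals so that the exchange needs no integrability.\<close>

lemma l2_norm_translation_le:
  fixes \<phi> :: "real ^ 'n \<Rightarrow> real"
  assumes \<phi>: "\<phi> \<in> test_functions D"
  shows "(\<integral>\<^sup>+x. ennreal ((\<phi> (x + t *\<^sub>R axis i 1) - \<phi> x)\<^sup>2) \<partial>lborel) \<le> ennreal (t\<^sup>2) * (\<integral>\<^sup>+x. ennreal ((partial i \<phi> x)\<^sup>2) \<partial>lborel)"
proof -
  obtain S where S: "compact S" "S \<subseteq> D" "\<And>x. x \<notin> S \<Longrightarrow> \<phi> x = 0" "\<And>k. C_k k \<phi>" "continuous_on UNIV \<phi>"
    "\<And>x. \<phi> differentiable at x" "\<And>i. continuous_on UNIV (partial i \<phi>)" "\<And>x i. x \<notin> S \<Longrightarrow> partial i \<phi> x = 0"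
    by (rule test_functionsE[OF \<phi>]) (rule that, assumption+)
  define e :: "real ^ 'n" where "e = axis i 1"
  define h where "h x s = partial i \<phi> (x + (s * t) *\<^sub>R e) * t" for x s
  have [measurable]: "partial i \<phi> \<in> borel_measurable borel"
    using S(7) by (rule borel_measurable_continuous_onI)
  have pointwise: "ennreal ((\<phi> (x + t *\<^sub>R e) - \<phi> x)\<^sup>2) \<le> (\<integral>\<^sup>+s. indicator {0..1::real} s * ennreal ((h x s)\<^sup>2) \<partial>lborel)" for x
  proof -
    \<comment> \<open>Jensen's inequality in the form \<open>0 \<le> \<integral>(h - m)\<^sup>2\<close>, where \<open>m\<close> is the mean of \<open>h\<close>.\<close>
    define m where "m = \<phi> (x + t *\<^sub>R e) - \<phi> x"
    have hc: "continuous_on {0..1} (h x)"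
      unfolding h_def by (intro continuous_intros continuous_on_compose2[OF S(7)]) auto
    have "((\<lambda>s. \<phi> (x + (s * t) *\<^sub>R e)) has_real_derivative h x s) (at s)" for s
    proof -
      have "((\<lambda>r. \<phi> (x + r *\<^sub>R e)) has_real_derivative partial i \<phi> (x + (s * t) *\<^sub>R e)) (at (s * t))"
        unfolding e_def by (rule partial_line_derivative) (rule S(6))
      note d1 = this
      have d2: "((\<lambda>s. s * t) has_real_derivative t) (at s)" by (auto intro!: derivative_eq_intros)
      from DERIV_chain2[where f="\<lambda>r. \<phi> (x + r *\<^sub>R e)" and g="\<lambda>s. s * t", OF d1 d2]
      show ?thesis by (simp only: h_def)
    qed
    then have I: "(h x has_integral m) {0..1}"
      using fundamental_theorem_of_calculus[of 0 1 "\<lambda>s. \<phi> (x + (s * t) *\<^sub>R e)" "h x"]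
      by (auto simp: m_def has_real_derivative_iff_has_vector_derivative[symmetric] intro: DERIV_subset)
    have I2: "((\<lambda>s. (h x s)\<^sup>2) has_integral integral {0..1} (\<lambda>s. (h x s)\<^sup>2)) {0..1}"
      by (intro integrable_integral integrable_continuous_interval continuous_intros hc)
    have I3: "((\<lambda>s. (h x s)\<^sup>2 - 2 * m * h x s + m\<^sup>2) has_integral (integral {0..1} (\<lambda>s. (h x s)\<^sup>2) - 2 * m * m + m\<^sup>2)) {0..1}"
      using has_integral_const_real[of "m\<^sup>2" 0 1] by (intro has_integral_add has_integral_diff has_integral_mult_right I I2) simp
    have nn: "0 \<le> (h x s)\<^sup>2 - 2 * m * h x s + m\<^sup>2" for s
      using zero_le_power2[of "h x s - m"] by (simp add: power2_diff algebra_simps)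
    have "0 \<le> integral {0..1} (\<lambda>s. (h x s)\<^sup>2) - 2 * m * m + m\<^sup>2"
      by (rule has_integral_nonneg[OF I3]) (rule nn)
    then have "m\<^sup>2 \<le> integral {0..1} (\<lambda>s. (h x s)\<^sup>2)" by (simp add: power2_eq_square)
    also have "ennreal (integral {0..1} (\<lambda>s. (h x s)\<^sup>2)) = (\<integral>\<^sup>+s. indicator {0..1::real} s * ennreal ((h x s)\<^sup>2) \<partial>lborel)"
    proof -
      have [measurable]: "h x \<in> borel_measurable borel" unfolding h_def by measurable
      have "((\<lambda>s. indicator {0..1} s * (h x s)\<^sup>2) has_integral integral {0..1} (\<lambda>s. (h x s)\<^sup>2)) UNIV"
      proof -
        have "(\<lambda>s. if s \<in> {0..1} then (h x s)\<^sup>2 else 0) = (\<lambda>s. indicator {0..1} s * (h x s)\<^sup>2)" by (auto simp: indicator_def)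
        then show ?thesis using I2 has_integral_restrict_UNIV[of "{0..1}" "\<lambda>s. (h x s)\<^sup>2"] by simp
      qed
      then have "(\<integral>\<^sup>+s. ennreal (indicator {0..1} s * (h x s)\<^sup>2) \<partial>lborel) = ennreal (integral {0..1} (\<lambda>s. (h x s)\<^sup>2))"
        by (intro nn_integral_has_integral_lborel) auto
      moreover have "ennreal (indicator {0..1} s * (h x s)\<^sup>2) = indicator {0..1::real} s * ennreal ((h x s)\<^sup>2)" for s :: real
        by (simp add: indicator_def)
      ultimately show ?thesis by simp
    qed
    finally show ?thesis by (simp add: m_def ennreal_leI)
  qed
  have "(\<integral>\<^sup>+x. ennreal ((\<phi> (x + t *\<^sub>R e) - \<phi> x)\<^sup>2) \<partial>lborel) \<le> (\<integral>\<^sup>+x. (\<integral>\<^sup>+s. indicator {0..1::real} s * ennreal ((h x s)\<^sup>2) \<partial>lborel) \<partial>lborel)"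
    by (intro nn_integral_mono pointwise)
  also have "\<dots> = (\<integral>\<^sup>+s. (\<integral>\<^sup>+x. indicator {0..1::real} s * ennreal ((h x s)\<^sup>2) \<partial>lborel) \<partial>lborel)"
    unfolding h_def by (intro lborel_pair.Fubini') measurable
  also have "\<dots> = (\<integral>\<^sup>+s. indicator {0..1::real} s * (ennreal (t\<^sup>2) * (\<integral>\<^sup>+x. ennreal ((partial i \<phi> x)\<^sup>2) \<partial>lborel)) \<partial>lborel)"
  proof (rule nn_integral_cong)
    fix s :: real
    have "(\<integral>\<^sup>+x. ennreal ((h x s)\<^sup>2) \<partial>lborel) = (\<integral>\<^sup>+x. ennreal (t\<^sup>2) * ennreal ((partial i \<phi> ((s * t) *\<^sub>R e + x))\<^sup>2) \<partial>lborel)"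
      by (simp add: h_def power_mult_distrib ennreal_mult add.commute mult.commute)
    also have "\<dots> = ennreal (t\<^sup>2) * (\<integral>\<^sup>+x. ennreal ((partial i \<phi> x)\<^sup>2) \<partial>distr lborel borel ((+) ((s * t) *\<^sub>R e)))"
      by (simp add: nn_integral_cmult nn_integral_distr)
    also have "\<dots> = ennreal (t\<^sup>2) * (\<integral>\<^sup>+x. ennreal ((partial i \<phi> x)\<^sup>2) \<partial>lborel)" by (simp only: lborel_distr_plus)
    finally show "(\<integral>\<^sup>+x. indicator {0..1::real} s * ennreal ((h x s)\<^sup>2) \<partial>lborel) = indicator {0..1::real} s * (ennreal (t\<^sup>2) * (\<integral>\<^sup>+x. ennreal ((partial i \<phi> x)\<^sup>2) \<partial>lborel))"
      by (subst nn_integral_cmult) (auto simp: h_def)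
  qed
  also have "\<dots> = ennreal (t\<^sup>2) * (\<integral>\<^sup>+x. ennreal ((partial i \<phi> x)\<^sup>2) \<partial>lborel)"
    by (subst nn_integral_multc) auto
  finally show ?thesis by (simp add: e_def)
qed


lemma L2_subset:
  assumes f: "f \<in> L2_space D" and B: "B \<subseteq> D" "B \<in> sets lebesgue" and D: "D \<in> sets lebesgue"
  shows "f \<in> L2_space B" "l2_norm B f \<le> l2_norm D f"
proof -
  have m: "f \<in> borel_measurable (lebesgue_on B)"
    using measurable_restrict_mono[OF L2_measurable[OF f] B(1)] .
  have iD: "integrable lebesgue (\<lambda>x. indicator D x *\<^sub>R (f x)\<^sup>2)"
    using L2_square_integrable[OF f] D by (simp add: integrable_restrict_space)
  have iB: "integrable lebesgue (\<lambda>x. indicator B x *\<^sub>R (f x)\<^sup>2)"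
  proof -
    have "integrable lebesgue (\<lambda>x. indicator B x *\<^sub>R (indicator D x *\<^sub>R (f x)\<^sup>2))"
      using integrable_mult_indicator[OF B(2) iD] .
    also have "(\<lambda>x. indicator B x *\<^sub>R (indicator D x *\<^sub>R (f x)\<^sup>2)) = (\<lambda>x. indicator B x *\<^sub>R (f x)\<^sup>2)"
      using B(1) by (intro ext) (auto simp: indicator_def)
    finally show ?thesis .
  qed
  show "f \<in> L2_space B"
    using m iB B(2) by (intro L2_spaceI) (simp_all add: integrable_restrict_space)
  have "l2_inner B f f = (LINT x|lebesgue. indicator B x *\<^sub>R (f x)\<^sup>2)"
    unfolding l2_inner_def using B(2) by (subst integral_restrict_space) (auto simp: power2_eq_square)
  also have "\<dots> \<le> (LINT x|lebesgue. indicator D x *\<^sub>R (f x)\<^sup>2)"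
    using iB iD B(1) by (intro integral_mono) (auto simp: indicator_def)
  also have "\<dots> = l2_inner D f f"
    unfolding l2_inner_def using D by (subst integral_restrict_space) (auto simp: power2_eq_square)
  finally show "l2_norm B f \<le> l2_norm D f" by (simp add: l2_norm_def)
qed

text \<open>The translate of \<open>\<phi>\<close> by \<open>t\<close> vanishes on \<open>B\<close>, so there \<open>\<phi>\<close> is a difference of translates.\<close>

lemma l2_norm_strip_le:
  fixes \<phi> :: "real ^ 'n \<Rightarrow> real"
  assumes \<phi>: "\<phi> \<in> test_functions D" and D: "open D" "bounded D" and B: "B \<subseteq> D" "open B"
    and out: "\<And>x. x \<in> B \<Longrightarrow> x + t *\<^sub>R axis i 1 \<notin> D"
  shows "l2_norm B \<phi> \<le> \<bar>t\<bar> * l2_norm D (partial i \<phi>)"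
proof -
  obtain S where S: "compact S" "S \<subseteq> D" "\<And>x. x \<notin> S \<Longrightarrow> \<phi> x = 0" "\<And>k. C_k k \<phi>" "continuous_on UNIV \<phi>"
    "\<And>x. \<phi> differentiable at x" "\<And>i. continuous_on UNIV (partial i \<phi>)" "\<And>x i. x \<notin> S \<Longrightarrow> partial i \<phi> x = 0"
    by (rule test_functionsE[OF \<phi>]) (rule that, assumption+)
  have sets: "D \<in> sets lebesgue" "B \<in> sets lebesgue" using D B by (auto simp: borel_open)
  have [measurable]: "B \<in> sets borel" using B by (simp add: borel_open)
  have [measurable]: "\<phi> \<in> borel_measurable borel" "partial i \<phi> \<in> borel_measurable borel"
    using S(5,7) by (auto intro: borel_measurable_continuous_onI)
  have pL: "partial i \<phi> \<in> L2_space D" using \<phi> D by (intro test_functions_L2 partial_test)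
  have BL: "\<phi> \<in> L2_space B" using L2_subset(1)[OF test_functions_L2[OF \<phi> D] B(1) sets(2,1)] .
  have "l2_inner B \<phi> \<phi> = (LINT x|lebesgue. indicator B x *\<^sub>R (\<phi> x)\<^sup>2)"
    unfolding l2_inner_def using sets by (subst integral_restrict_space) (auto simp: power2_eq_square)
  also have "\<dots> = (\<integral>x. indicator B x * (\<phi> x)\<^sup>2 \<partial>lborel)"
    by (subst integral_completion) auto
  finally have eB: "l2_inner B \<phi> \<phi> = (\<integral>x. indicator B x * (\<phi> x)\<^sup>2 \<partial>lborel)" .
  have iB: "integrable lborel (\<lambda>x. indicator B x * (\<phi> x)\<^sup>2)"
  proof -
    have "integrable lebesgue (\<lambda>x. indicator B x *\<^sub>R (\<phi> x)\<^sup>2)"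
      using L2_square_integrable[OF BL] sets by (simp add: integrable_restrict_space)
    then show ?thesis by (subst (asm) integrable_completion) auto
  qed
  have eD: "l2_inner D (partial i \<phi>) (partial i \<phi>) = (\<integral>x. (partial i \<phi> x)\<^sup>2 \<partial>lborel)"
    unfolding l2_inner_def power2_eq_square
    using S(2,8) by (intro integral_lebesgue_on_eq_lborel continuous_intros D S) (auto simp: subset_iff)
  have iD: "integrable lborel (\<lambda>x. (partial i \<phi> x)\<^sup>2)"
  proof -
    have "integrable lborel (\<lambda>x. indicator S x *\<^sub>R (partial i \<phi> x)\<^sup>2)"
      by (intro borel_integrable_compact S continuous_on_subset[OF continuous_on_power[OF S(7)]]) auto
    also have "(\<lambda>x. indicator S x *\<^sub>R (partial i \<phi> x)\<^sup>2) = (\<lambda>x. (partial i \<phi> x)\<^sup>2)"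
      using S(8) by (intro ext) (auto simp: indicator_def)
    finally show ?thesis .
  qed
  have "ennreal (l2_inner B \<phi> \<phi>) = (\<integral>\<^sup>+x. ennreal (indicator B x * (\<phi> x)\<^sup>2) \<partial>lborel)"
    unfolding eB by (rule nn_integral_eq_integral[symmetric, OF iB]) auto
  also have "\<dots> \<le> (\<integral>\<^sup>+x. ennreal ((\<phi> (x + t *\<^sub>R axis i 1) - \<phi> x)\<^sup>2) \<partial>lborel)"
  proof (intro nn_integral_mono ennreal_leI)
    fix x
    have "\<phi> (x + t *\<^sub>R axis i 1) = 0" if "x \<in> B" using out[OF that] S(2,3) by blast
    then show "indicator B x * (\<phi> x)\<^sup>2 \<le> (\<phi> (x + t *\<^sub>R axis i 1) - \<phi> x)\<^sup>2" by (auto simp: indicator_def)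
  qed
  also have "\<dots> \<le> ennreal (t\<^sup>2) * (\<integral>\<^sup>+x. ennreal ((partial i \<phi> x)\<^sup>2) \<partial>lborel)"
    by (rule l2_norm_translation_le[OF \<phi>])
  also have "\<dots> = ennreal (t\<^sup>2 * l2_inner D (partial i \<phi>) (partial i \<phi>))"
    unfolding eD by (subst nn_integral_eq_integral[OF iD]) (auto simp: ennreal_mult)
  finally have "l2_inner B \<phi> \<phi> \<le> t\<^sup>2 * l2_inner D (partial i \<phi>) (partial i \<phi>)"
    by (subst (asm) ennreal_le_iff) auto
  then have "(l2_norm B \<phi>)\<^sup>2 \<le> (\<bar>t\<bar> * l2_norm D (partial i \<phi>))\<^sup>2"
    by (simp add: l2_norm_square power_mult_distrib)
  then show ?thesis by (rule power2_le_imp_le) simp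
qed

text \<open>The derivative \<open>\<partial>\<^sub>i\<phi>\<close> is itself a test function. Testing the weak derivatives of \<open>\<phi> - u\<close> and of \<open>u\<close> with it
  bounds its squared norm, whichever representatives of the weak derivatives are selected.\<close>

lemma l2_norm_partial_le:
  assumes D: "open D" "bounded D" and \<phi>: "\<phi> \<in> test_functions D" and u: "u \<in> H1_space D"
  shows "l2_norm D (partial i \<phi>) \<le> l2_norm D (weak_partial D i (\<lambda>x. \<phi> x - u x)) + l2_norm D (weak_partial D i u)"
proof -
  let ?w = "weak_partial D i u" and ?d = "weak_partial D i (\<lambda>x. \<phi> x - u x)" and ?\<psi> = "partial i \<phi>"
  have "(\<lambda>x. \<phi> x - u x) \<in> H1_space D"
    using H1_lin[OF D test_functions_H1(1)[OF \<phi> D] u, of 1 "-1"] by simp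
  note d = weak_partial_spec[OF this, of i] and w = weak_partial_spec[OF u, of i]
  have \<psi>: "?\<psi> \<in> test_functions D" "?\<psi> \<in> L2_space D" "partial i ?\<psi> \<in> L2_space D"
    using \<phi> D by (auto intro: partial_test test_functions_L2)
  have L2: "\<phi> \<in> L2_space D" "u \<in> L2_space D"
    using u test_functions_L2[OF \<phi> D] by (auto simp: H1_space_def)
  have "l2_inner D ?\<psi> ?\<psi> = - l2_inner D \<phi> (partial i ?\<psi>)"
    using integration_by_parts[OF \<phi> \<psi>(1) D, of i] by simp
  also have "\<dots> = - l2_inner D (\<lambda>x. \<phi> x - u x) (partial i ?\<psi>) - l2_inner D u (partial i ?\<psi>)"
    using L2 \<psi> by (simp add: l2_inner_diff_left)
  also have "\<dots> = l2_inner D ?d ?\<psi> + l2_inner D ?w ?\<psi>"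
    using d(2) w(2) \<psi>(1) by (simp add: is_weak_partial_def)
  also have "\<dots> \<le> l2_norm D ?d * l2_norm D ?\<psi> + l2_norm D ?w * l2_norm D ?\<psi>"
    using l2_Cauchy_Schwarz[OF d(1) \<psi>(2)] l2_Cauchy_Schwarz[OF w(1) \<psi>(2)] by linarith
  finally have "l2_norm D ?\<psi> * l2_norm D ?\<psi> \<le> (l2_norm D ?d + l2_norm D ?w) * l2_norm D ?\<psi>"
    by (simp add: l2_norm_square[symmetric] power2_eq_square distrib_right)
  then show ?thesis
    by (cases "l2_norm D ?\<psi> = 0") (auto simp: order_less_le)
qed

lemma H10_strip_estimate:
  fixes u :: "real ^ 'n \<Rightarrow> real"
  assumes u: "u \<in> H10_space D" and D: "open D" "bounded D" and B: "B \<subseteq> D" "open B"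
    and out: "\<And>x. x \<in> B \<Longrightarrow> x + t *\<^sub>R axis i 1 \<notin> D"
  shows "l2_norm B u \<le> \<bar>t\<bar> * l2_norm D (weak_partial D i u)"
proof -
  have uH: "u \<in> H1_space D" using u by (simp add: H10_space_def)
  have uL: "u \<in> L2_space D" using uH by (simp add: H1_space_def)
  obtain \<phi> where \<phi>: "\<And>k. \<phi> k \<in> test_functions D" "(\<lambda>k::nat. h1_norm D (\<lambda>x. \<phi> k x - u x)) \<longlonglongrightarrow> 0"
    using u by (auto simp: H10_space_def)
  have sets: "B \<in> sets lebesgue" "D \<in> sets lebesgue" using D B by (auto simp: borel_open)
  let ?e = "\<lambda>k. l2_norm D (\<lambda>x. \<phi> k x - u x)" and ?d = "\<lambda>k. l2_norm D (weak_partial D i (\<lambda>x. \<phi> k x - u x))"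
  have e: "?e \<longlonglongrightarrow> 0" and d: "?d \<longlonglongrightarrow> 0" using \<phi>(2) unfolding h1_norm_tendsto_0_iff by auto
  have le: "l2_norm B u \<le> ?e k + \<bar>t\<bar> * (?d k + l2_norm D (weak_partial D i u))" for k
  proof -
    have \<phi>L: "\<phi> k \<in> L2_space D" using test_functions_L2[OF \<phi>(1) D] .
    have "l2_norm B u \<le> l2_norm B (\<lambda>x. u x - \<phi> k x) + l2_norm B (\<phi> k)"
      using L2_subset(1)[OF _ B(1) sets] uL \<phi>L by (intro l2_norm_triangle_diff) auto
    also have "l2_norm B (\<lambda>x. u x - \<phi> k x) \<le> ?e k"
      using L2_subset(2)[OF L2_diff[OF uL \<phi>L] B(1) sets] by (simp add: l2_norm_minus_commute)
    also have "l2_norm B (\<phi> k) \<le> \<bar>t\<bar> * l2_norm D (partial i (\<phi> k))"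
      by (rule l2_norm_strip_le[OF \<phi>(1) D B out])
    also have "\<dots> \<le> \<bar>t\<bar> * (?d k + l2_norm D (weak_partial D i u))"
      by (intro mult_left_mono l2_norm_partial_le D \<phi> uH) auto
    finally show ?thesis by simp
  qed
  have "(\<lambda>k. ?e k + \<bar>t\<bar> * (?d k + l2_norm D (weak_partial D i u))) \<longlonglongrightarrow> 0 + \<bar>t\<bar> * (0 + l2_norm D (weak_partial D i u))"
    by (intro tendsto_intros e d)
  then show ?thesis using le by (intro LIMSEQ_le_const[of _ _ "l2_norm B u"]) auto
qed

text \<open>If \<open>u a \<noteq> 0\<close> at a point \<open>a\<close> of the face in direction \<open>i\<close>, then \<open>\<bar>u\<bar> \<ge> c > 0\<close> on a box at \<open>a\<close> of width
  \<open>\<delta>\<close> in direction \<open>i\<close> and of fixed width \<open>\<rho>\<close> in the other directions. The squared norm over this box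
  is at least of order \<open>\<delta>\<close>, but by the strip estimate at most of order \<open>\<delta>\<^sup>2\<close>.\<close>

lemma H10_continuous_zero_on_boundary:
  fixes u :: "real ^ 'n \<Rightarrow> real"
  assumes u: "u \<in> H10_space (cube L)" and L: "L > 0" and cont: "continuous_on (closure (cube L)) u"
    and a: "a \<in> closure (cube L)" "a \<notin> cube L"
  shows "u a = 0"
proof (rule ccontr)
  assume ua: "u a \<noteq> 0"
  define D where "D = (cube L :: (real ^ 'n) set)"
  have Dbox: "D = box 0 (\<chi> i. L)" by (auto simp: D_def cube_def mem_box_cart)
  have D: "open D" "bounded D" unfolding Dbox by auto
  have "box 0 (\<chi> i. L) \<noteq> ({} :: (real ^ 'n) set)" using L by (simp add: interval_ne_empty_cart)
  then have cl: "closure D = cbox 0 (\<chi> i. L)" unfolding Dbox by (rule closure_box)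
  have a01: "0 \<le> a $ j" "a $ j \<le> L" for j using a(1) by (auto simp: cl D_def[symmetric] mem_box_cart)
  obtain i where i: "a $ i = 0 \<or> a $ i = L"
  proof -
    have "\<not> (\<forall>i. 0 < a $ i \<and> a $ i < L)" using a(2) by (simp add: cube_def)
    then obtain i where "\<not> (0 < a $ i \<and> a $ i < L)" by blast
    then have "a $ i = 0 \<or> a $ i = L" using a01[of i] by linarith
    then show ?thesis using that by blast
  qed
  define W where "W = l2_norm D (weak_partial D i u)"
  have W: "W \<ge> 0" by (simp add: W_def)
  define c where "c = \<bar>u a\<bar> / 2"
  have c: "c > 0" using ua by (simp add: c_def)
  obtain r where r: "r > 0" "\<And>x. x \<in> closure D \<Longrightarrow> dist x a < r \<Longrightarrow> dist (u x) (u a) < c"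
    using cont a(1) c unfolding continuous_on_iff D_def by metis
  define \<rho> where "\<rho> = min (L / 2) (r / (2 * real CARD('n)))"
  have \<rho>: "\<rho> > 0" "\<rho> \<le> L / 2" using L r by (auto simp: \<rho>_def)
  have \<rho>r: "real CARD('n) * \<rho> < r"
  proof -
    have "real CARD('n) * \<rho> \<le> real CARD('n) * (r / (2 * real CARD('n)))" by (intro mult_left_mono) (auto simp: \<rho>_def)
    also have "\<dots> < r" using r(1) by simp
    finally show ?thesis .
  qed
  have main: "c\<^sup>2 * \<rho> ^ (CARD('n) - 1) \<le> \<delta> * W\<^sup>2" if \<delta>: "0 < \<delta>" "\<delta> \<le> \<rho>" for \<delta>
  proof -
    define w where "w j = (if j = i then \<delta> else \<rho>)" for j
    have w: "0 < w j" "w j \<le> \<rho>" for j using \<delta> \<rho> by (auto simp: w_def)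
    \<comment> \<open>From every coordinate of \<open>a\<close> the box extends towards the middle of the cube, so that it stays inside.\<close>
    define lo :: "real ^ 'n" where "lo = (\<chi> j. if a $ j \<le> L / 2 then a $ j else a $ j - w j)"
    define hi :: "real ^ 'n" where "hi = (\<chi> j. lo $ j + w j)"
    have lo: "0 \<le> lo $ j" "lo $ j + w j \<le> L" "lo $ j \<le> a $ j" "a $ j \<le> lo $ j + w j" for j
      using a01[of j] w[of j] \<rho> by (auto simp: lo_def)
    define B where "B = box lo hi"
    have BD: "B \<subseteq> D"
    proof
      fix x assume "x \<in> B"
      then have "lo $ j < x $ j" "x $ j < lo $ j + w j" for j by (auto simp: B_def mem_box_cart hi_def)
      then have "0 < x $ j \<and> x $ j < L" for j using lo(1,2)[of j] by (meson le_less_trans less_le_trans)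
      then show "x \<in> D" by (simp add: D_def cube_def)
    qed
    define t where "t = (if a $ i = 0 then - \<delta> else \<delta>)"
    have out: "x + t *\<^sub>R axis i 1 \<notin> D" if "x \<in> B" for x
    proof -
      have "lo $ i < x $ i" "x $ i < lo $ i + \<delta>" using that by (auto simp: B_def mem_box_cart hi_def w_def dest: spec[of _ i])
      moreover have "lo $ i = (if a $ i = 0 then 0 else L - \<delta>)" using i L by (auto simp: lo_def w_def)
      ultimately have "(x + t *\<^sub>R axis i 1) $ i \<le> 0 \<or> L \<le> (x + t *\<^sub>R axis i 1) $ i"
        by (auto simp: t_def)
      then show ?thesis by (auto simp: D_def cube_def not_less intro!: exI[of _ i])
    qed
    have B: "open B" "B \<in> sets lebesgue" by (auto simp: B_def)
    have strip: "l2_norm B u \<le> \<delta> * W"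
      using H10_strip_estimate[OF u[folded D_def] D BD B(1) out] \<delta> by (simp add: W_def t_def split: if_splits)
    have ub: "c\<^sup>2 \<le> (u x)\<^sup>2" if x: "x \<in> B" for x
    proof -
      have "\<bar>x $ j - a $ j\<bar> \<le> \<rho>" for j
      proof -
        have "lo $ j < x $ j" "x $ j < lo $ j + w j" using x by (auto simp: B_def mem_box_cart hi_def)
        then show ?thesis using lo(3,4)[of j] w(2)[of j] by linarith
      qed
      then have "dist x a \<le> (\<Sum>j\<in>(UNIV :: 'n set). \<rho>)"
        unfolding dist_norm by (intro order_trans[OF norm_le_l1_cart] sum_mono) simp
      then have "dist x a < r" using \<rho>r by simp
      moreover have "x \<in> closure D" using x BD closure_subset by blast
      ultimately have "\<bar>u x - u a\<bar> < c" using r(2) by (simp add: dist_real_def)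
      then have "\<bar>c\<bar> \<le> \<bar>u x\<bar>" unfolding c_def by linarith
      then show ?thesis by (simp only: abs_le_square_iff)
    qed
    have uL: "u \<in> L2_space B"
      using L2_subset(1)[of u D B] u BD B D by (simp add: H10_space_def H1_space_def D_def borel_open)
    have "measure lebesgue B = \<delta> * \<rho> ^ (CARD('n) - 1)"
    proof -
      have le: "\<forall>j. lo $ j \<le> hi $ j" using w(1) by (simp add: hi_def less_imp_le)
      have "measure lebesgue B = measure lborel (cbox lo hi)"
        unfolding B_def using le by (simp add: measure_completion measure_lborel_box_eq measure_lborel_cbox_eq)
      also have "\<dots> = (\<Prod>j\<in>UNIV. hi $ j - lo $ j)"
        using le by (intro content_cbox_cart) (auto simp: interval_ne_empty_cart)
      also have "\<dots> = (\<Prod>j\<in>UNIV. w j)" by (simp add: hi_def)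
      also have "\<dots> = w i * (\<Prod>j\<in>UNIV - {i}. w j)" by (subst prod.remove[of _ i]) auto
      also have "(\<Prod>j\<in>UNIV - {i}. w j) = (\<Prod>j\<in>UNIV - {i}. \<rho>)" by (intro prod.cong) (auto simp: w_def)
      finally show ?thesis by (simp add: w_def)
    qed
    moreover have "c\<^sup>2 * measure lebesgue B \<le> l2_inner B u u"
    proof -
      interpret finite_measure "lebesgue_on B"
        by (rule finite_measure_lebesgue_on) (simp add: B_def)
      have "c\<^sup>2 * measure lebesgue B = (LINT x|lebesgue_on B. c\<^sup>2)"
        using B by (simp add: measure_restrict_space space_restrict_space)
      also have "\<dots> \<le> (LINT x|lebesgue_on B. (u x)\<^sup>2)"
        using ub by (intro integral_mono L2_square_integrable[OF uL]) (auto simp: space_restrict_space)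
      finally show ?thesis by (simp add: l2_inner_def power2_eq_square)
    qed
    moreover have "l2_inner B u u \<le> (\<delta> * W)\<^sup>2"
      using power_mono[OF strip, of 2] by (simp add: l2_norm_square)
    ultimately have "\<delta> * (c\<^sup>2 * \<rho> ^ (CARD('n) - 1)) \<le> \<delta> * (\<delta> * W\<^sup>2)"
      by (simp add: power_mult_distrib power2_eq_square mult_ac)
    then show ?thesis using \<delta> by simp
  qed
  define A where "A = c\<^sup>2 * \<rho> ^ (CARD('n) - 1)"
  have A: "A > 0" using c \<rho> by (simp add: A_def)
  define \<delta> where "\<delta> = min \<rho> (A / (2 * (W\<^sup>2 + 1)))"
  have W1: "W\<^sup>2 + 1 > 0" by (simp add: add_nonneg_pos)
  have "A \<le> \<delta> * W\<^sup>2" using main[of \<delta>] A \<rho> W1 by (simp add: A_def \<delta>_def)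
  also have "\<dots> \<le> A / (2 * (W\<^sup>2 + 1)) * (W\<^sup>2 + 1)"
    using A W1 by (intro mult_mono) (auto simp: \<delta>_def)
  also have "\<dots> = A / 2" using W1 by (simp add: field_simps)
  finally show False using A by simp
qed

section \<open>Projection, measurability and the noise coefficients\<close>

text \<open>A Gram--Schmidt argument, by induction over the nodes: the functions that also vanish at the node \<open>b\<close>
  have a projection by induction, and at most one direction is missing. It is spanned by a function
  with value \<open>1\<close> at \<open>b\<close> from which its own projection is subtracted.\<close>

lemma exists_l2_projection:
  fixes N :: "(real ^ 'n) set"
  assumes "finite N" and V: "V \<subseteq> L2_space D" "(\<lambda>_. 0) \<in> V"
    and lin: "\<And>v w a b. v \<in> V \<Longrightarrow> w \<in> V \<Longrightarrow> (\<lambda>x. a * v x + b * w x) \<in> V"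
    and nodal: "\<And>v. v \<in> V \<Longrightarrow> (\<And>a. a \<in> N \<Longrightarrow> v a = 0) \<Longrightarrow> v = (\<lambda>_. 0)"
    and definite: "\<And>v. v \<in> V \<Longrightarrow> l2_inner D v v = 0 \<Longrightarrow> v = (\<lambda>_. 0)"
    and f: "f \<in> L2_space D"
  shows "\<exists>w\<in>V. \<forall>v\<in>V. l2_inner D w v = l2_inner D f v"
  using assms
proof (induction N arbitrary: V f rule: finite_induct)
  case empty
  have V0: "v = (\<lambda>_. 0)" if "v \<in> V" for v by (rule empty.prems(4)[OF that]) simp
  have "l2_inner D (\<lambda>_. 0) v = l2_inner D f v" if "v \<in> V" for v
    unfolding V0[OF that] by (simp add: l2_inner_def)
  then show ?case using empty.prems(2) by blast
next
  case (insert b N)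
  define V' where "V' = {v \<in> V. v b = 0}"
  have V'1: "V' \<subseteq> L2_space D" "(\<lambda>_. 0) \<in> V'"
    using insert.prems(1,2) by (auto simp: V'_def)
  have V'2: "(\<lambda>x. a * v x + b * w x) \<in> V'" if "v \<in> V'" "w \<in> V'" for v w a b
    using that insert.prems(3)[of v w a b] by (simp add: V'_def)
  have V'3: "v = (\<lambda>_. 0)" if v: "v \<in> V'" and z: "\<And>a. a \<in> N \<Longrightarrow> v a = 0" for v
  proof (rule insert.prems(4))
    show "v \<in> V" using v by (simp add: V'_def)
    show "v a = 0" if "a \<in> insert b N" for a using that v z[of a] by (auto simp: V'_def)
  qed
  have V'4: "v = (\<lambda>_. 0)" if "v \<in> V'" "l2_inner D v v = 0" for v
    using that by (intro insert.prems(5)) (simp_all add: V'_def)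
  note V' = V'1 V'2 V'3 V'4
  have IH: "\<exists>w\<in>V'. \<forall>v\<in>V'. l2_inner D w v = l2_inner D f v" if "f \<in> L2_space D" for f
    by (rule insert.IH) (fact V'1 that | erule (1) V'2 V'4 | rule V'3; assumption)+
  show ?case
  proof (cases "V' = V")
    case True
    then show ?thesis using IH[OF insert.prems(6)] by simp
  next
    case False
    then obtain e0 where e0: "e0 \<in> V" "e0 b \<noteq> 0" by (auto simp: V'_def)
    define e1 where "e1 x = (1 / e0 b) * e0 x + 0 * e0 x" for x
    have e1: "e1 \<in> V" "e1 b = 1" using insert.prems(3)[OF e0(1) e0(1), of "1 / e0 b" 0] e0(2) by (auto simp: e1_def[abs_def])
    obtain p where p: "p \<in> V'" "\<And>v. v \<in> V' \<Longrightarrow> l2_inner D p v = l2_inner D e1 v"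
      using IH[of e1] e1 insert.prems(1) by blast
    define e where "e x = 1 * e1 x + (- 1) * p x" for x
    have eV: "e \<in> V" using insert.prems(3)[OF e1(1), of p 1 "-1"] p(1) by (simp add: e_def[abs_def] V'_def)
    have eb: "e b = 1" using e1 p by (simp add: e_def V'_def)
    have L2: "v \<in> L2_space D" if "v \<in> V" for v using that insert.prems(1) by auto
    have pV: "p \<in> V" using p(1) by (simp add: V'_def)
    have eort: "l2_inner D e v = 0" if "v \<in> V'" for v
      using that p(2)[OF that] L2[OF e1(1)] L2[OF pV] V'(1) unfolding e_def[abs_def]
      by (subst l2_inner_lin_left) auto
    have ee: "l2_inner D e e \<noteq> 0"
    proof
      assume "l2_inner D e e = 0"
      from fun_cong[OF insert.prems(5)[OF eV this], of b] eb show False by simp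
    qed
    obtain w0 where w0: "w0 \<in> V'" "\<And>v. v \<in> V' \<Longrightarrow> l2_inner D w0 v = l2_inner D f v"
      using IH[OF insert.prems(6)] by blast
    have w0V: "w0 \<in> V" using w0(1) by (simp add: V'_def)
    define c where "c = l2_inner D f e / l2_inner D e e"
    define w where "w x = 1 * w0 x + c * e x" for x
    have wV: "w \<in> V" using insert.prems(3)[OF w0V eV, of 1 c] by (simp add: w_def[abs_def])
    have "l2_inner D w v = l2_inner D f v" if v: "v \<in> V" for v
    proof -
      define v' where "v' x = 1 * v x + (- v b) * e x" for x
      have v'V: "v' \<in> V'" using insert.prems(3)[OF v eV, of 1 "- v b"] eb by (simp add: v'_def[abs_def] V'_def)
      have veq: "v = (\<lambda>x. 1 * v' x + v b * e x)" by (auto simp: v'_def)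
      have v'L: "v' \<in> L2_space D" using v'V V'(1) by auto
      have split: "l2_inner D g v = l2_inner D g v' + v b * l2_inner D g e" if "g \<in> L2_space D" for g
        by (subst veq) (simp add: l2_inner_lin_right[OF v'L L2[OF eV] that, of 1 "v b", simplified])
      have lw: "l2_inner D w g = l2_inner D w0 g + c * l2_inner D e g" if "g \<in> L2_space D" for g
        unfolding w_def[abs_def] using l2_inner_lin_left[OF L2[OF w0V] L2[OF eV] that, of 1 c] by simp
      have "l2_inner D w v' = l2_inner D f v'" using lw[OF v'L] w0(2)[OF v'V] eort[OF v'V] by simp
      moreover have "l2_inner D w e = l2_inner D f e"
        using lw[OF L2[OF eV]] eort[OF w0(1)] ee by (simp add: l2_inner_commute[of D w0 e] c_def)
      ultimately show ?thesis using split[OF L2[OF wV]] split[OF insert.prems(6)] by simp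
    qed
    then show ?thesis using wV by blast
  qed
qed

lemma zero_in_H10: "(\<lambda>_. 0) \<in> H10_space (box l u)"
proof -
  have t: "(\<lambda>_. 0) \<in> test_functions (box l u)"
    unfolding test_functions_def by (auto simp: C_k_const intro!: exI[of _ "{}"])
  have h: "(\<lambda>_. 0) \<in> H1_space (box l u)" by (rule test_functions_H1(1)[OF t]) auto
  have "l2_norm (box l u) (weak_partial (box l u) i (\<lambda>_. 0)) = 0" for i
    using l2_norm_weak_partial_lin[OF h h, of i 0 0] by (intro antisym) simp_all
  moreover have "l2_norm (box l u) (\<lambda>_. 0) = 0" by (simp add: l2_norm_def l2_inner_def)
  ultimately have "(\<lambda>k::nat. h1_norm (box l u) (\<lambda>x. 0 - 0)) \<longlonglongrightarrow> 0"
    unfolding h1_norm_tendsto_0_iff by simp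
  then have "\<exists>\<phi>. (\<forall>k. \<phi> k \<in> test_functions (box l u)) \<and> (\<lambda>k::nat. h1_norm (box l u) (\<lambda>x. \<phi> k x - 0)) \<longlonglongrightarrow> 0"
    using t by (intro exI[of _ "\<lambda>_ _. 0"]) simp
  then show ?thesis using h by (simp add: H10_space_def)
qed

lemma cube_box: "cube L = box 0 (\<chi> i. L)"
  by (auto simp: cube_def mem_box_cart)

lemma mesh_cube: "triangulation_of (cube L) \<T> \<Longrightarrow> mesh (cube L) \<T>"
  unfolding cube_box by unfold_locales auto

lemma (in mesh) P1_definite:
  assumes v: "v \<in> P1_space D \<T>" and 0: "l2_inner D v v = 0"
  shows "v = (\<lambda>_. 0)"
proof (rule P1_eqI[OF v])
  show "(\<lambda>_. 0) \<in> P1_space D \<T>" using P1_lin[OF v v, of 0 0] by simp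
  obtain B where B: "\<And>K. K \<in> \<T> \<Longrightarrow> 0 < B K"
    "\<And>v w. v \<in> P1_space D \<T> \<Longrightarrow> w \<in> P1_space D \<T> \<Longrightarrow> l2_inner D v w = (\<Sum>K\<in>\<T>. B K * mass_form (vertices K) v w)"
    by (rule l2_inner_P1) (rule that, assumption+)
  have mf: "mass_form (vertices K) v v = (\<Sum>a\<in>vertices K. (v a)\<^sup>2) + (\<Sum>a\<in>vertices K. v a)\<^sup>2" for K
    by (simp add: mass_form_def power2_eq_square)
  have nn: "0 \<le> B K * mass_form (vertices K) v v" if "K \<in> \<T>" for K
    unfolding mf using B(1)[OF that] by (intro mult_nonneg_nonneg add_nonneg_nonneg sum_nonneg) auto
  fix a assume "a \<in> nodes"
  then obtain K where K: "K \<in> \<T>" "a \<in> vertices K" by (auto simp: nodes_def)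
  have "B K * mass_form (vertices K) v v = 0"
    using 0 nn finite_mesh K(1) unfolding B(2)[OF v v] by (subst (asm) sum_nonneg_eq_0_iff) auto
  then have "mass_form (vertices K) v v = 0" using B(1)[OF K(1)] by simp
  then have "(\<Sum>a\<in>vertices K. (v a)\<^sup>2) = 0"
    unfolding mf by (simp add: add_nonneg_eq_0_iff sum_nonneg)
  then show "v a = 0" using vertices_mesh(1)[OF K(1)] K(2) by (subst (asm) sum_nonneg_eq_0_iff) auto
qed

lemma P_h_l2_norm_le:
  fixes f :: "real ^ 'n \<Rightarrow> real"
  assumes tri: "triangulation_of (cube L) \<T>" and f: "f \<in> L2_space (cube L)"
  shows "l2_norm (cube L) (P_h (cube L) \<T> f) \<le> l2_norm (cube L) f"
proof -
  define D where "D = (cube L :: (real ^ 'n) set)"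
  interpret mesh D \<T> unfolding D_def by (rule mesh_cube[OF tri])
  have Dbox: "D = box 0 (\<chi> i. L)" by (simp add: D_def cube_box)
  note f = f[folded D_def]
  let ?V = "V_h D \<T>"
  have VL: "?V \<subseteq> L2_space D" by (auto simp: V_h_def P1_L2)
  have P0: "(\<lambda>_. 0) \<in> P1_space D \<T>" by (auto simp: P1_space_def intro!: exI[of _ 0])
  have V0: "(\<lambda>_. 0) \<in> ?V" using zero_in_H10 P0 by (simp add: V_h_def Dbox)
  have lin: "(\<lambda>x. a * v x + b * w x) \<in> ?V" if "v \<in> ?V" "w \<in> ?V" for v w a b
    using that H10_lin[of v 0 "\<chi> i. L" w a b] P1_lin[of v D \<T> w a b] by (simp add: V_h_def Dbox)
  have definite: "v = (\<lambda>_. 0)" if "v \<in> ?V" "l2_inner D v v = 0" for v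
    using P1_definite that by (simp add: V_h_def)
  have "\<exists>w\<in>?V. \<forall>v\<in>?V. l2_inner D w v = l2_inner D f v"
  proof (rule exists_l2_projection[OF finite_nodes VL V0 lin _ definite f])
    fix v assume "v \<in> ?V" and z: "\<And>a. a \<in> nodes \<Longrightarrow> v a = 0"
    then show "v = (\<lambda>_. 0)" by (intro P1_eqI[OF _ P0]) (auto simp: V_h_def)
  qed
  then obtain w where w: "w \<in> ?V" "\<And>v. v \<in> ?V \<Longrightarrow> l2_inner D w v = l2_inner D f v" by blast
  have "P_h D \<T> f = w"
    unfolding P_h_def
  proof (rule the_equality)
    fix w' assume w': "w' \<in> ?V \<and> (\<forall>v\<in>?V. l2_inner D w' v = l2_inner D f v)"
    have d: "(\<lambda>x. w' x - w x) \<in> ?V" using lin[of w' w 1 "-1"] w w' by simp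
    have "l2_inner D (\<lambda>x. w' x - w x) (\<lambda>x. w' x - w x) = 0"
      using w' w d VL by (subst l2_inner_diff_left) (auto simp: subset_iff)
    from fun_cong[OF definite[OF d this]] show "w' = w" by (intro ext) simp
  qed (use w in auto)
  moreover have "l2_norm D w * l2_norm D w \<le> l2_norm D f * l2_norm D w"
  proof -
    have "l2_norm D w * l2_norm D w = l2_inner D f w"
      using w(2)[OF w(1)] by (simp add: l2_norm_square[symmetric] power2_eq_square)
    also have "\<dots> \<le> l2_norm D f * l2_norm D w"
      using l2_Cauchy_Schwarz[OF f, of w] w(1) VL by (auto simp: abs_le_iff)
    finally show ?thesis .
  qed
  then have "l2_norm D w \<le> l2_norm D f"
    by (cases "l2_norm D w = 0") (auto simp: order_less_le)
  ultimately show ?thesis by (simp add: D_def)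
qed

text \<open>A piecewise affine function depends linearly on finitely many nodal values, which are measurable by
  hypothesis. Enumerated by natural numbers they form a measurable map into the product space
  \<open>nat \<Rightarrow> real\<close>, on which the functional is continuous by the local Lipschitz bound.\<close>

lemma (in mesh) l2_functional_measurable:
  fixes \<Psi> :: "(real ^ 'n \<Rightarrow> real) \<Rightarrow> real" and U :: "'w \<Rightarrow> real ^ 'n \<Rightarrow> real"
  assumes U: "\<And>\<omega>. \<omega> \<in> space A \<Longrightarrow> U \<omega> \<in> P1_space D \<T>" "\<And>x. (\<lambda>\<omega>. U \<omega> x) \<in> borel_measurable A"
    and K: "0 \<le> K" and lip: "\<And>v w. v \<in> L2_space D \<Longrightarrow> w \<in> L2_space D \<Longrightarrow>
      \<bar>\<Psi> v - \<Psi> w\<bar> \<le> K * (1 + l2_norm D v + l2_norm D w) * l2_norm D (\<lambda>x. v x - w x)"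
  shows "(\<lambda>\<omega>. \<Psi> (U \<omega>)) \<in> borel_measurable A"
proof -
  obtain e where e: "bij_betw e {..<card nodes} nodes"
    using ex_bij_betw_nat_finite[OF finite_nodes] by (auto simp: atLeast0LessThan)
  define m where "m = card nodes"
  have "\<exists>v. v \<in> P1_space D \<T> \<and> (\<forall>b\<in>nodes. v b = (if b = e j then 1 else 0))" for j
  proof -
    obtain v where "v \<in> P1_space D \<T>" "\<And>b. b \<in> nodes \<Longrightarrow> v b = (if b = e j then 1 else 0)"
      by (rule P1_interpolant[of "\<lambda>b. if b = e j then 1 else 0"]) (rule that, assumption+)
    then show ?thesis by blast
  qed
  then obtain hat where hat: "\<And>j. hat j \<in> P1_space D \<T>" "\<And>j b. b \<in> nodes \<Longrightarrow> hat j b = (if b = e j then 1 else 0)"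
    by metis
  define \<Phi> where "\<Phi> c = (\<lambda>x. \<Sum>j<m. c j * hat j x)" for c :: "nat \<Rightarrow> real"
  have hatL: "hat j \<in> L2_space D" for j using hat(1) by (rule P1_L2)
  have \<Phi>P: "\<Phi> c \<in> P1_space D \<T>" for c
  proof -
    have "(\<lambda>x. \<Sum>j<k. c j * hat j x) \<in> P1_space D \<T>" for k
    proof (induction k)
      case 0
      then show ?case using P1_lin[OF hat(1) hat(1), of 0 0 0 0] by simp
    next
      case (Suc k)
      then show ?case using P1_lin[OF Suc hat(1)[of k], of 1 "c k"] by simp
    qed
    then show ?thesis by (simp add: \<Phi>_def)
  qed
  have \<Phi>U: "\<Phi> (\<lambda>j. U \<omega> (e j)) = U \<omega>" if \<omega>: "\<omega> \<in> space A" for \<omega>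
  proof (rule P1_eqI[OF \<Phi>P U(1)[OF \<omega>]])
    fix a assume a: "a \<in> nodes"
    then have "a \<in> e ` {..<m}" using e by (simp add: bij_betw_def m_def)
    then obtain j where j: "j < m" "e j = a" by blast
    have "\<Phi> (\<lambda>j. U \<omega> (e j)) a = (\<Sum>i<m. if i = j then U \<omega> (e j) else 0)"
      unfolding \<Phi>_def
    proof (rule sum.cong[OF refl])
      fix i assume "i \<in> {..<m}"
      then have "e i = e j \<longleftrightarrow> i = j" using e j(1) by (auto simp: bij_betw_def m_def inj_on_def)
      then show "U \<omega> (e i) * hat i a = (if i = j then U \<omega> (e j) else 0)"
        using hat(2)[OF a, of i] j(2) by auto
    qed
    then show "\<Phi> (\<lambda>j. U \<omega> (e j)) a = U \<omega> a" using j by simp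
  qed
  have "continuous_on UNIV (\<lambda>c. \<Psi> (\<Phi> c))"
    unfolding continuous_on_def
  proof
    fix c :: "nat \<Rightarrow> real"
    define d where "d c' = (\<Sum>j<m. \<bar>c' j - c j\<bar> * l2_norm D (hat j))" for c'
    have "((\<lambda>c'. c' j) \<longlongrightarrow> c j) (at c within UNIV)" for j
    proof -
      have "continuous_on UNIV (\<lambda>c' :: nat \<Rightarrow> real. c' j)" by (rule continuous_on_product_coordinates)
      then show ?thesis unfolding continuous_on_def by blast
    qed
    then have "(d \<longlongrightarrow> (\<Sum>j<m. \<bar>c j - c j\<bar> * l2_norm D (hat j))) (at c within UNIV)"
      unfolding d_def[abs_def] by (intro tendsto_intros)
    then have d0: "(d \<longlongrightarrow> 0) (at c within UNIV)" by simp
    have dn: "l2_norm D (\<lambda>x. \<Phi> c' x - \<Phi> c x) \<le> d c'" for c'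
    proof -
      have diff: "(\<lambda>x. \<Phi> c' x - \<Phi> c x) = (\<lambda>x. \<Sum>j<m. (c' j - c j) * hat j x)"
        by (simp add: \<Phi>_def sum_subtractf left_diff_distrib)
      have "l2_norm D (\<lambda>x. \<Sum>j<m. (c' j - c j) * hat j x) \<le> (\<Sum>j<m. l2_norm D (\<lambda>x. (c' j - c j) * hat j x))"
        by (intro l2_norm_sum_le L2_cmult hatL) auto
      then show ?thesis by (simp add: diff d_def l2_norm_cmult)
    qed
    have bound: "\<bar>\<Psi> (\<Phi> c') - \<Psi> (\<Phi> c)\<bar> \<le> K * (1 + (d c' + l2_norm D (\<Phi> c)) + l2_norm D (\<Phi> c)) * d c'" for c'
    proof -
      have L: "\<Phi> c' \<in> L2_space D" "\<Phi> c \<in> L2_space D" using \<Phi>P P1_L2 by auto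
      have "l2_norm D (\<Phi> c') \<le> d c' + l2_norm D (\<Phi> c)"
        using l2_norm_triangle_diff[OF L] dn[of c'] by linarith
      then have "K * (1 + l2_norm D (\<Phi> c') + l2_norm D (\<Phi> c)) * l2_norm D (\<lambda>x. \<Phi> c' x - \<Phi> c x)
        \<le> K * (1 + (d c' + l2_norm D (\<Phi> c)) + l2_norm D (\<Phi> c)) * d c'"
        using K dn[of c'] order_trans[OF l2_norm_nonneg dn[of c']] l2_norm_nonneg[of D "\<Phi> c"]
        by (intro mult_mono mult_nonneg_nonneg) auto
      then show ?thesis using lip[OF L] by linarith
    qed
    have "((\<lambda>c'. K * (1 + (d c' + l2_norm D (\<Phi> c)) + l2_norm D (\<Phi> c)) * d c') \<longlongrightarrow>
      K * (1 + (0 + l2_norm D (\<Phi> c)) + l2_norm D (\<Phi> c)) * 0) (at c within UNIV)"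
      by (intro tendsto_intros d0)
    then have g0: "((\<lambda>c'. K * (1 + (d c' + l2_norm D (\<Phi> c)) + l2_norm D (\<Phi> c)) * d c') \<longlongrightarrow> 0) (at c within UNIV)"
      by (simp only: mult_zero_right)
    have "((\<lambda>c'. \<Psi> (\<Phi> c') - \<Psi> (\<Phi> c)) \<longlongrightarrow> 0) (at c within UNIV)"
    proof (rule Lim_null_comparison[OF _ g0])
      show "\<forall>\<^sub>F c' in at c within UNIV. norm (\<Psi> (\<Phi> c') - \<Psi> (\<Phi> c))
          \<le> K * (1 + (d c' + l2_norm D (\<Phi> c)) + l2_norm D (\<Phi> c)) * d c'"
        unfolding real_norm_def by (intro always_eventually allI bound)
    qed
    then show "((\<lambda>c'. \<Psi> (\<Phi> c')) \<longlongrightarrow> \<Psi> (\<Phi> c)) (at c within UNIV)" by (subst Lim_null)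
  qed
  then have "(\<lambda>c. \<Psi> (\<Phi> c)) \<in> borel_measurable borel" by (rule borel_measurable_continuous_onI)
  moreover have "(\<lambda>\<omega> j. U \<omega> (e j)) \<in> borel_measurable A"
    by (rule measurable_coordinatewise_then_product) (rule U(2))
  ultimately have "(\<lambda>\<omega>. \<Psi> (\<Phi> (\<lambda>j. U \<omega> (e j)))) \<in> borel_measurable A"
    by (rule measurable_compose[rotated])
  then show ?thesis using \<Phi>U by (simp cong: measurable_cong)
qed

lemma l2_functional_lipschitz:
  assumes C: "0 \<le> C" and F: "\<And>v. v \<in> L2_space D \<Longrightarrow> F v \<in> L2_space D"
    "\<And>v. v \<in> L2_space D \<Longrightarrow> l2_norm D (F v) \<le> C * (1 + l2_norm D v)"
    "\<And>v w. v \<in> L2_space D \<Longrightarrow> w \<in> L2_space D \<Longrightarrow> l2_norm D (\<lambda>x. F v x - F w x) \<le> C * l2_norm D (\<lambda>x. v x - w x)"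
    and v: "v \<in> L2_space D" and w: "w \<in> L2_space D"
  shows "\<bar>l2_inner D (F v) v - l2_inner D (F w) w\<bar> \<le> C * (1 + l2_norm D v + l2_norm D w) * l2_norm D (\<lambda>x. v x - w x)"
proof -
  have "l2_inner D (F v) v - l2_inner D (F w) w = l2_inner D (\<lambda>x. F v x - F w x) v + l2_inner D (F w) (\<lambda>x. v x - w x)"
    using v w F(1) by (simp add: l2_inner_diff_left l2_inner_diff_right)
  also have "\<bar>\<dots>\<bar> \<le> l2_norm D (\<lambda>x. F v x - F w x) * l2_norm D v + l2_norm D (F w) * l2_norm D (\<lambda>x. v x - w x)"
    using l2_Cauchy_Schwarz[OF L2_diff[OF F(1)[OF v] F(1)[OF w]] v] l2_Cauchy_Schwarz[OF F(1)[OF w] L2_diff[OF v w]]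
    by linarith
  also have "\<dots> \<le> (C * l2_norm D (\<lambda>x. v x - w x)) * l2_norm D v + (C * (1 + l2_norm D w)) * l2_norm D (\<lambda>x. v x - w x)"
    using F v w by (intro add_mono mult_right_mono) auto
  finally show ?thesis by (simp add: algebra_simps)
qed

text \<open>For the second-order coefficient \<open>DG v (G v)\<close> the difference splits into
  \<open>DG v (G v - G w)\<close>, controlled by the bound on \<open>DG\<close>, and \<open>(DG v - DG w) (G w)\<close>, which is the last of
  the noise assumptions. Linearity of \<open>DG v\<close> holds up to null functions only.\<close>

lemma noise_L2_bounds:
  assumes "noise_assumptions (L2_space D) (l2_norm D) (L2_space D) (l2_norm D) G DG D2G"
  obtains C where "0 < C" "\<And>v. v \<in> L2_space D \<Longrightarrow> G v \<in> L2_space D"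
    "\<And>v. v \<in> L2_space D \<Longrightarrow> l2_norm D (G v) \<le> C * (1 + l2_norm D v)"
    "\<And>v w. v \<in> L2_space D \<Longrightarrow> w \<in> L2_space D \<Longrightarrow> l2_norm D (\<lambda>x. G v x - G w x) \<le> C * l2_norm D (\<lambda>x. v x - w x)"
    "\<And>v. v \<in> L2_space D \<Longrightarrow> DG v (G v) \<in> L2_space D"
    "\<And>v. v \<in> L2_space D \<Longrightarrow> l2_norm D (DG v (G v)) \<le> C * (1 + l2_norm D v)"
    "\<And>v w. v \<in> L2_space D \<Longrightarrow> w \<in> L2_space D \<Longrightarrow> l2_norm D (\<lambda>x. DG v (G v) x - DG w (G w) x) \<le> C * l2_norm D (\<lambda>x. v x - w x)"
proof -
  let ?H = "L2_space D" and ?n = "l2_norm D"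
  have GH: "\<And>v. v \<in> ?H \<Longrightarrow> G v \<in> ?H" and gd: "has_gateaux_derivative ?H ?H ?n G DG"
    using assms by (auto simp: noise_assumptions_def)
  have "\<exists>C>0. (\<forall>v\<in>?H. \<forall>w\<in>?H. ?n (\<lambda>x. G v x - G w x) \<le> C * ?n (\<lambda>x. v x - w x)) \<and>
        (\<forall>v\<in>?H. ?n (G v) \<le> C * (?n v + 1)) \<and>
        (\<exists>A\<ge>0. \<exists>B\<ge>0. A + B \<le> C \<and>
           (\<forall>u\<in>?H. \<forall>f\<in>?H. ?n (DG u f) \<le> A * ?n f) \<and>
           (\<forall>u\<in>?H. \<forall>f\<in>?H. \<forall>g\<in>?H. ?n (D2G u f g) \<le> B * ?n f * ?n g)) \<and>
        (\<forall>v\<in>?H. \<forall>w\<in>?H. ?n (\<lambda>x. DG v (G w) x - DG w (G w) x) \<le> C * ?n (\<lambda>x. v x - w x))"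
    using assms unfolding noise_assumptions_def by (elim conjE)
  then obtain C A B where C: "0 < C" "\<forall>v\<in>?H. \<forall>w\<in>?H. ?n (\<lambda>x. G v x - G w x) \<le> C * ?n (\<lambda>x. v x - w x)"
    "\<forall>v\<in>?H. ?n (G v) \<le> C * (?n v + 1)"
    and A: "0 \<le> B" "A + B \<le> C" "\<forall>u\<in>?H. \<forall>f\<in>?H. ?n (DG u f) \<le> A * ?n f"
    and DC: "\<forall>v\<in>?H. \<forall>w\<in>?H. ?n (\<lambda>x. DG v (G w) x - DG w (G w) x) \<le> C * ?n (\<lambda>x. v x - w x)"
    by (elim exE conjE) (rule that, assumption+)
  have lin: "linear_map_on ?H ?H ?n (DG u)" if "u \<in> ?H" for u using gd that by (auto simp: has_gateaux_derivative_def)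
  have DGH: "DG u f \<in> ?H" if "u \<in> ?H" "f \<in> ?H" for u f using lin[OF that(1)] that(2) by (auto simp: linear_map_on_def)
  have DGb: "?n (DG u f) \<le> C * ?n f" if "u \<in> ?H" "f \<in> ?H" for u f
  proof -
    have "A \<le> C" using A by simp
    have "?n (DG u f) \<le> A * ?n f" using A(3) that by blast
    also have "\<dots> \<le> C * ?n f" using \<open>A \<le> C\<close> by (intro mult_right_mono) auto
    finally show ?thesis .
  qed
  have DGd: "?n (\<lambda>x. DG u f x - DG u g x) \<le> C * ?n (\<lambda>x. f x - g x)" if "u \<in> ?H" "f \<in> ?H" "g \<in> ?H" for u f g
  proof -
    have n0: "?n (\<lambda>x. DG u (\<lambda>y. 1 * f y + (- 1) * g y) x - (1 * DG u f x + (- 1) * DG u g x)) = 0"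
      using lin[OF that(1)] that(2,3) unfolding linear_map_on_def by blast
    have fg: "(\<lambda>x. f x - g x) \<in> ?H" using that by (intro L2_diff)
    have "?n (\<lambda>x. DG u f x - DG u g x) \<le> ?n (\<lambda>x. (DG u f x - DG u g x) - DG u (\<lambda>y. f y - g y) x) + ?n (DG u (\<lambda>y. f y - g y))"
      using that DGH fg by (intro l2_norm_triangle_diff L2_diff)
    also have "?n (\<lambda>x. (DG u f x - DG u g x) - DG u (\<lambda>y. f y - g y) x) = 0"
      using n0 l2_norm_minus_commute[of D "DG u (\<lambda>y. f y - g y)" "\<lambda>x. DG u f x - DG u g x"] by simp
    finally show ?thesis using DGb[OF that(1) fg] by simp
  qed
  define C' where "C' = C + C * C"
  have C': "0 < C'" "C \<le> C'" "C * C \<le> C'" using C(1) by (auto simp: C'_def add_pos_pos)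
  show ?thesis
  proof (rule that[of C'])
    show "0 < C'" by fact
    show "G v \<in> ?H" if "v \<in> ?H" for v using GH[OF that] .
    show "DG v (G v) \<in> ?H" if "v \<in> ?H" for v using DGH[OF that GH[OF that]] .
    show "?n (G v) \<le> C' * (1 + ?n v)" if "v \<in> ?H" for v
      using C(3) that mult_right_mono[OF C'(2), of "1 + ?n v"] by (fastforce simp: add.commute)
    show "?n (\<lambda>x. G v x - G w x) \<le> C' * ?n (\<lambda>x. v x - w x)" if "v \<in> ?H" "w \<in> ?H" for v w
      using C(2) that mult_right_mono[OF C'(2), of "?n (\<lambda>x. v x - w x)"] by fastforce
    show "?n (DG v (G v)) \<le> C' * (1 + ?n v)" if v: "v \<in> ?H" for v
    proof -
      have "?n (DG v (G v)) \<le> C * ?n (G v)" using DGb v GH by simp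
      also have "\<dots> \<le> C * (C * (?n v + 1))" using C v by (intro mult_left_mono) auto
      also have "\<dots> = (C * C) * (1 + ?n v)" by (simp add: algebra_simps)
      also have "\<dots> \<le> C' * (1 + ?n v)" using C'(3) by (intro mult_right_mono) auto
      finally show ?thesis .
    qed
    show "?n (\<lambda>x. DG v (G v) x - DG w (G w) x) \<le> C' * ?n (\<lambda>x. v x - w x)" if v: "v \<in> ?H" and w: "w \<in> ?H" for v w
    proof -
      note m = DGH[OF v GH[OF v]] DGH[OF v GH[OF w]] DGH[OF w GH[OF w]]
      have "?n (\<lambda>x. DG v (G v) x - DG w (G w) x) = ?n (\<lambda>x. (DG v (G v) x - DG v (G w) x) + (DG v (G w) x - DG w (G w) x))" by simp
      also have "\<dots> \<le> ?n (\<lambda>x. DG v (G v) x - DG v (G w) x) + ?n (\<lambda>x. DG v (G w) x - DG w (G w) x)"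
        using m by (intro l2_norm_triangle L2_diff)
      also have "\<dots> \<le> C * ?n (\<lambda>x. G v x - G w x) + C * ?n (\<lambda>x. v x - w x)"
        using DGd[OF v GH[OF v] GH[OF w]] DC v w by (intro add_mono) auto
      also have "\<dots> \<le> C * (C * ?n (\<lambda>x. v x - w x)) + C * ?n (\<lambda>x. v x - w x)"
        using C v w by (intro add_right_mono mult_left_mono) auto
      also have "\<dots> = C' * ?n (\<lambda>x. v x - w x)" by (simp add: C'_def algebra_simps)
      finally show ?thesis .
    qed
  qed
qed

section \<open>One step of the moment recursion\<close>

lemma sum_power_le:
  fixes x y :: real assumes "0 \<le> x" "0 \<le> y" shows "(x + y) ^ k \<le> 2 ^ k * (x ^ k + y ^ k)"
proof -
  have "(x + y) ^ k \<le> (2 * max x y) ^ k" using assms by (intro power_mono) auto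
  also have "\<dots> = 2 ^ k * max x y ^ k" by (simp add: power_mult_distrib)
  also have "max x y ^ k \<le> x ^ k + y ^ k" using assms by (auto simp: max_def)
  finally show ?thesis by simp
qed

text \<open>Powers \<open>\<xi>^k\<close> with \<open>2 \<le> k \<le> m\<close> are of order at least \<open>\<rho>\<close> for small \<open>\<rho>\<close> and at most \<open>\<rho>^(2 m)\<close> for large
  \<open>\<rho>\<close>. In the application \<open>\<rho>\<close> is \<open>\<Delta>W\<^sup>2 + \<tau>\<close>, so that both have expectation of order \<open>\<tau>\<close>; only the linear term
  needs cancellation.\<close>

lemma power_one_plus_le:
  fixes \<xi> \<rho> B :: real
  assumes m: "1 \<le> m" and \<rho>: "0 \<le> \<rho>" and B: "0 \<le> B" and \<xi>: "\<bar>\<xi>\<bar> \<le> B * (sqrt \<rho> + 2 * \<rho> + \<rho>\<^sup>2)"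
  shows "(1 + \<xi>) ^ m \<le> 1 + real m * \<xi> + (1 + 4 * B) ^ m * (\<rho> + \<rho> ^ (2 * m))"
proof -
  define s where "s = \<rho> + \<rho> ^ (2 * m)"
  have s: "0 \<le> s" using \<rho> by (simp add: s_def)
  have k: "\<xi> ^ k \<le> (4 * B) ^ k * s" if k: "2 \<le> k" "k \<le> m" for k
  proof -
    define M where "M = max (sqrt \<rho>) (\<rho>\<^sup>2)"
    have M0: "0 \<le> M" using \<rho> by (simp add: M_def le_max_iff_disj)
    have "\<rho> \<le> M"
    proof (cases "\<rho> \<le> 1")
      case True
      then have "\<rho> \<le> sqrt \<rho>" using \<rho> by (intro real_le_rsqrt) (simp add: power2_eq_square mult_left_le)
      then show ?thesis by (simp add: M_def)
    next
      case False
      then have "\<rho> \<le> \<rho>\<^sup>2" by (simp add: power2_eq_square)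
      then show ?thesis by (simp add: M_def)
    qed
    then have "sqrt \<rho> + 2 * \<rho> + \<rho>\<^sup>2 \<le> 4 * M" unfolding M_def by linarith
    then have "\<bar>\<xi>\<bar> \<le> B * (4 * M)" using mult_left_mono[OF _ B] \<xi> order_trans by blast
    then have "\<bar>\<xi>\<bar> ^ k \<le> (B * (4 * M)) ^ k" by (intro power_mono) auto
    also have "\<dots> = (4 * B) ^ k * M ^ k" by (simp add: power_mult_distrib mult_ac)
    also have "M ^ k \<le> s"
    proof (cases "\<rho> \<le> 1")
      case True
      then have "\<rho>\<^sup>2 \<le> \<rho>" using \<rho> by (simp add: power2_eq_square mult_left_le)
      moreover have "\<rho> \<le> sqrt \<rho>" using \<rho> True by (intro real_le_rsqrt) (simp add: power2_eq_square mult_left_le)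
      ultimately have "M = sqrt \<rho>" by (simp add: M_def)
      then have "M ^ k = sqrt \<rho> ^ (2 + (k - 2))" by (simp only: le_add_diff_inverse[OF k(1)])
      also have "\<dots> = sqrt \<rho> ^ 2 * sqrt \<rho> ^ (k - 2)" by (rule power_add)
      also have "\<dots> \<le> sqrt \<rho> ^ 2 * 1" using \<rho> True by (intro mult_left_mono power_le_one) auto
      finally show ?thesis using \<rho> by (simp add: s_def add_increasing2)
    next
      case False
      have "\<rho> \<le> \<rho>\<^sup>2" "1 \<le> \<rho>" using False by (auto simp: power2_eq_square)
      moreover have "sqrt \<rho> \<le> \<rho>" using False by (intro real_le_lsqrt) (auto simp: power2_eq_square)
      ultimately have "M = \<rho>\<^sup>2" by (simp add: M_def)
      then have "M ^ k = \<rho> ^ (2 * k)" by (simp add: power_mult)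
      also have "\<dots> \<le> \<rho> ^ (2 * m)" using False k by (intro power_increasing) auto
      finally show ?thesis using \<rho> by (simp add: s_def add_increasing)
    qed
    finally have "\<bar>\<xi>\<bar> ^ k \<le> (4 * B) ^ k * s" using B by (simp add: mult_left_mono)
    moreover have "\<xi> ^ k \<le> \<bar>\<xi>\<bar> ^ k" using abs_ge_self[of "\<xi> ^ k"] by (simp add: power_abs)
    ultimately show ?thesis by linarith
  qed
  have "(1 + \<xi>) ^ m = (\<Sum>k\<le>m. real (m choose k) * \<xi> ^ k)"
    using binomial_ring[of \<xi> 1 m] by (simp add: add.commute)
  also have "\<dots> = (\<Sum>k\<in>{..m} - {0, 1}. real (m choose k) * \<xi> ^ k) + (\<Sum>k\<in>{0, 1}. real (m choose k) * \<xi> ^ k)"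
    using m by (intro sum.subset_diff) auto
  also have "(\<Sum>k\<in>{..m} - {0, 1}. real (m choose k) * \<xi> ^ k) \<le> (\<Sum>k\<in>{..m} - {0, 1}. real (m choose k) * ((4 * B) ^ k * s))"
    using k by (intro sum_mono mult_left_mono) auto
  also have "\<dots> \<le> (\<Sum>k\<le>m. real (m choose k) * ((4 * B) ^ k * s))"
    using B s by (intro sum_mono2) auto
  also have "\<dots> = (1 + 4 * B) ^ m * s"
  proof -
    have "(1 + 4 * B) ^ m = (\<Sum>k\<le>m. real (m choose k) * (4 * B) ^ k)"
      using binomial_ring[of "4 * B" 1 m] by (simp add: add.commute)
    then show ?thesis by (simp only: sum_distrib_right mult.assoc)
  qed
  finally show ?thesis by (simp add: s_def)
qed

lemma normal_moments:
  assumes M: "prob_space M" and d: "distributed M lborel z (normal_density 0 (sqrt \<tau>))" and \<tau>: "0 < \<tau>"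
  shows "integrable M (\<lambda>\<omega>. z \<omega> ^ (2 * k))" "(\<integral>\<omega>. z \<omega> ^ (2 * k) \<partial>M) = fact (2 * k) / (2 ^ k * fact k) * \<tau> ^ k"
    "integrable M z" "(\<integral>\<omega>. z \<omega> \<partial>M) = 0"
proof -
  have s: "0 < sqrt \<tau>" using \<tau> by simp
  have e: "has_bochner_integral lborel (\<lambda>x. normal_density 0 (sqrt \<tau>) x * x ^ (2 * k)) (fact (2 * k) / ((2 / \<tau>) ^ k * fact k))"
    using normal_moment_even[OF s, of 0 k] \<tau> by simp
  have o: "has_bochner_integral lborel (\<lambda>x. normal_density 0 (sqrt \<tau>) x * x) 0"
    using normal_moment_odd[OF s, of 0 0] by simp
  show "integrable M (\<lambda>\<omega>. z \<omega> ^ (2 * k))"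
    using e by (subst distributed_integrable[OF d, symmetric]) (auto simp: has_bochner_integral_iff)
  have "(\<integral>\<omega>. z \<omega> ^ (2 * k) \<partial>M) = fact (2 * k) / ((2 / \<tau>) ^ k * fact k)"
    using e by (subst distributed_integral[OF d, symmetric]) (auto simp: has_bochner_integral_iff)
  also have "\<dots> = fact (2 * k) / (2 ^ k * fact k) * \<tau> ^ k" using \<tau> by (simp add: power_divide field_simps)
  finally show "(\<integral>\<omega>. z \<omega> ^ (2 * k) \<partial>M) = fact (2 * k) / (2 ^ k * fact k) * \<tau> ^ k" .
  show "integrable M z"
    using o by (subst distributed_integrable[OF d, of "\<lambda>x. x", symmetric]) (auto simp: has_bochner_integral_iff)
  show "(\<integral>\<omega>. z \<omega> \<partial>M) = 0"
    using o by (subst distributed_integral[OF d, of "\<lambda>x. x", symmetric]) (auto simp: has_bochner_integral_iff)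
qed

lemma expectation_mult_indep:
  fixes X z :: "'w \<Rightarrow> real"
  assumes M: "prob_space M" and A: "subalgebra M A"
    and ind: "prob_space.indep_set M (sets A) (sets (vimage_algebra (space M) z borel))"
    and z: "z \<in> borel_measurable M" and X: "X \<in> borel_measurable A" and f: "f \<in> borel_measurable borel"
    and i: "integrable M X" "integrable M (\<lambda>\<omega>. f (z \<omega>) :: real)"
  shows "integrable M (\<lambda>\<omega>. X \<omega> * f (z \<omega>))" "(\<integral>\<omega>. X \<omega> * f (z \<omega>) \<partial>M) = (\<integral>\<omega>. X \<omega> \<partial>M) * (\<integral>\<omega>. f (z \<omega>) \<partial>M)"
proof -
  interpret prob_space M by fact
  have sp: "space A = space M" "sets A \<subseteq> sets M" using A by (auto simp: subalgebra_def)
  have XM: "X \<in> borel_measurable M" using measurable_from_subalg[OF A X] .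
  have fz: "(\<lambda>\<omega>. f (z \<omega>)) \<in> borel_measurable M" using z f by measurable
  let ?V = "vimage_algebra (space M) z borel"
  have fzV: "(\<lambda>\<omega>. f (z \<omega>)) \<in> borel_measurable ?V"
    using measurable_compose[OF measurable_vimage_algebra1 f, of z "space M"] by simp
  have "indep_var borel X borel (\<lambda>\<omega>. f (z \<omega>))"
    unfolding indep_var_eq
  proof (intro conjI XM fz)
    have 1: "sigma_sets (space M) {X -` B \<inter> space M |B. B \<in> sets borel} \<subseteq> sets A"
      using measurable_sets[OF X] sp(1) by (intro sets.sigma_sets_subset[of _ A, unfolded sp(1)]) auto
    have 2: "sigma_sets (space M) {(\<lambda>\<omega>. f (z \<omega>)) -` B \<inter> space M |B. B \<in> sets borel} \<subseteq> sets ?V"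
      using measurable_sets[OF fzV] by (intro sets.sigma_sets_subset[of _ ?V, simplified]) auto
    show "indep_set (sigma_sets (space M) {X -` B \<inter> space M |B. B \<in> sets borel})
        (sigma_sets (space M) {(\<lambda>\<omega>. f (z \<omega>)) -` B \<inter> space M |B. B \<in> sets borel})"
      using ind unfolding indep_set_def
      by (rule indep_sets_mono_sets) (use 1 2 in \<open>auto split: bool.split\<close>)
  qed
  then show "integrable M (\<lambda>\<omega>. X \<omega> * f (z \<omega>))" "(\<integral>\<omega>. X \<omega> * f (z \<omega>) \<partial>M) = (\<integral>\<omega>. X \<omega> \<partial>M) * (\<integral>\<omega>. f (z \<omega>) \<partial>M)"
    using i by (auto intro: indep_var_integrable indep_var_lebesgue_integral)
qed

text \<open>The first factor collects the coefficients of \<open>\<rho> + \<rho>^(2 m)\<close> with \<open>\<rho> = \<Delta>W\<^sup>2 + \<tau>\<close>; the second one, times \<open>\<tau>\<close>,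
  bounds the expectation of this expression, the fraction being the Gaussian moment of order \<open>4 m\<close>.\<close>

definition moment_growth :: "nat \<Rightarrow> real \<Rightarrow> real \<Rightarrow> real" where
  "moment_growth m K T = (2 * real m * K + (1 + 4 * K) ^ m) *
     (2 + 2 ^ (2 * m) * (fact (4 * m) / (2 ^ (2 * m) * fact (2 * m)) + 1) * T ^ (2 * m - 1))"

lemma moment_growth_nonneg: "0 \<le> K \<Longrightarrow> 0 \<le> T \<Longrightarrow> 0 \<le> moment_growth m K T"
  by (simp add: moment_growth_def)

text \<open>Divide by \<open>Y\<close> and expand the \<open>m\<close>-th power. The linear terms are products of an \<open>A\<close>-measurable factor with
  the increment \<open>z\<close> or with \<open>z\<^sup>2 - \<tau>\<close>, both independent of \<open>A\<close> and of mean \<open>0\<close>; the remainder is \<open>Y^m\<close>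
  times an independent factor with expectation of order \<open>\<tau>\<close>.\<close>

lemma moment_step:
  fixes Y Y' a b z :: "'w \<Rightarrow> real"
  assumes M: "prob_space M" and A: "subalgebra M A"
    and ind: "prob_space.indep_set M (sets A) (sets (vimage_algebra (space M) z borel))"
    and d: "distributed M lborel z (normal_density 0 (sqrt \<tau>))" and \<tau>: "0 < \<tau>" "\<tau> \<le> T"
    and meas: "Y \<in> borel_measurable A" "a \<in> borel_measurable A" "b \<in> borel_measurable A" "Y' \<in> borel_measurable M"
    and Y: "\<And>\<omega>. \<omega> \<in> space M \<Longrightarrow> 1 \<le> Y \<omega>" "\<And>\<omega>. \<omega> \<in> space M \<Longrightarrow> 0 \<le> Y' \<omega>"
    and K: "0 \<le> K" and a: "\<And>\<omega>. \<omega> \<in> space M \<Longrightarrow> \<bar>a \<omega>\<bar> \<le> K * Y \<omega>" and b: "\<And>\<omega>. \<omega> \<in> space M \<Longrightarrow> \<bar>b \<omega>\<bar> \<le> K * Y \<omega>"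
    and m: "1 \<le> m" and int: "integrable M (\<lambda>\<omega>. Y \<omega> ^ m)"
    and step: "AE \<omega> in M. Y' \<omega> \<le> Y \<omega> + a \<omega> * z \<omega> + b \<omega> * ((z \<omega>)\<^sup>2 - \<tau>) + K * Y \<omega> * (\<tau> + (z \<omega>)\<^sup>2 + ((z \<omega>)\<^sup>2 - \<tau>)\<^sup>2)"
  shows "integrable M (\<lambda>\<omega>. Y' \<omega> ^ m)"
    "(\<integral>\<omega>. Y' \<omega> ^ m \<partial>M) \<le> (1 + moment_growth m K T * \<tau>) * (\<integral>\<omega>. Y \<omega> ^ m \<partial>M)"
proof -
  interpret prob_space M by fact
  define C1 where "C1 = 2 * real m * K + (1 + 4 * K) ^ m"
  have C1: "0 \<le> C1" using K by (simp add: C1_def)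
  define \<rho> where "\<rho> y = y\<^sup>2 + \<tau>" for y :: real
  have zM [measurable]: "z \<in> borel_measurable M" using d by (auto simp: distributed_def)
  have \<rho>m [measurable]: "\<rho> \<in> borel_measurable borel" unfolding \<rho>_def by measurable
  have MM [measurable]: "Y \<in> borel_measurable M" "a \<in> borel_measurable M" "b \<in> borel_measurable M" "Y' \<in> borel_measurable M"
    using measurable_from_subalg[OF A] meas by auto
  define Xa where "Xa \<omega> = Y \<omega> ^ (m - 1) * a \<omega>" for \<omega>
  define Xb where "Xb \<omega> = Y \<omega> ^ (m - 1) * b \<omega>" for \<omega>
  define R where "R y = \<rho> y + \<rho> y ^ (2 * m)" for y
  have Ym: "Y \<omega> ^ m = Y \<omega> ^ (m - 1) * Y \<omega>" for \<omega> using m by (simp add: power_eq_if mult.commute)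
  have pathwise: "AE \<omega> in M. Y' \<omega> ^ m \<le> Y \<omega> ^ m + real m * (Xa \<omega> * z \<omega>) + real m * (Xb \<omega> * ((z \<omega>)\<^sup>2 - \<tau>)) + C1 * (Y \<omega> ^ m * R (z \<omega>))"
    using step AE_space
  proof eventually_elim
    case (elim \<omega>)
    define r where "r = \<rho> (z \<omega>)"
    define \<zeta> where "\<zeta> = (a \<omega> * z \<omega> + b \<omega> * ((z \<omega>)\<^sup>2 - \<tau>)) / Y \<omega>"
    define \<eta> where "\<eta> = K * (\<tau> + (z \<omega>)\<^sup>2 + ((z \<omega>)\<^sup>2 - \<tau>)\<^sup>2)"
    have Y1: "1 \<le> Y \<omega>" using Y(1) elim by simp
    have Y\<zeta>: "Y \<omega> * \<zeta> = a \<omega> * z \<omega> + b \<omega> * ((z \<omega>)\<^sup>2 - \<tau>)" using Y1 by (simp add: \<zeta>_def)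
    have r0: "0 \<le> r" using \<tau> by (simp add: r_def \<rho>_def)
    have zr: "\<bar>z \<omega>\<bar> \<le> sqrt r" unfolding r_def \<rho>_def using \<tau> by (intro real_le_rsqrt) simp
    have zt: "\<bar>(z \<omega>)\<^sup>2 - \<tau>\<bar> \<le> r" using \<tau> by (simp add: r_def \<rho>_def abs_le_iff)
    have zt2: "((z \<omega>)\<^sup>2 - \<tau>)\<^sup>2 \<le> r\<^sup>2" using zt by (metis abs_le_square_iff abs_of_nonneg r0)
    have \<eta>: "0 \<le> \<eta>" "\<eta> \<le> K * (r + r\<^sup>2)"
      unfolding \<eta>_def using K \<tau> zt2 by (auto intro!: mult_left_mono simp: r_def \<rho>_def)
    have "\<bar>a \<omega> * z \<omega> + b \<omega> * ((z \<omega>)\<^sup>2 - \<tau>)\<bar> \<le> \<bar>a \<omega>\<bar> * \<bar>z \<omega>\<bar> + \<bar>b \<omega>\<bar> * \<bar>(z \<omega>)\<^sup>2 - \<tau>\<bar>"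
      using abs_triangle_ineq[of "a \<omega> * z \<omega>" "b \<omega> * ((z \<omega>)\<^sup>2 - \<tau>)"] by (simp only: abs_mult)
    also have "\<dots> \<le> (K * Y \<omega>) * sqrt r + (K * Y \<omega>) * r"
      using a b elim zr zt K Y1 r0 by (intro add_mono mult_mono) auto
    finally have "\<bar>\<zeta>\<bar> \<le> K * (sqrt r + r)"
      using Y1 by (simp add: \<zeta>_def abs_divide divide_le_eq algebra_simps)
    then have "\<bar>\<zeta> + \<eta>\<bar> \<le> K * (sqrt r + 2 * r + r\<^sup>2)" using \<eta> by (simp add: algebra_simps)
    from power_one_plus_le[OF m r0 K this]
    have p: "(1 + (\<zeta> + \<eta>)) ^ m \<le> 1 + real m * (\<zeta> + \<eta>) + (1 + 4 * K) ^ m * (r + r ^ (2 * m))" .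
    have "r\<^sup>2 \<le> r + r ^ (2 * m)"
    proof (cases "r \<le> 1")
      case True
      then have "r\<^sup>2 \<le> r" using r0 by (simp add: power2_eq_square mult_left_le)
      then show ?thesis using r0 by (simp add: add_increasing2)
    next
      case False
      then have "r\<^sup>2 \<le> r ^ (2 * m)" using m by (intro power_increasing) auto
      then show ?thesis using r0 by simp
    qed
    then have "r + r\<^sup>2 \<le> r + (r + r ^ (2 * m))" by (rule add_left_mono)
    also have "\<dots> \<le> (r + r ^ (2 * m)) + (r + r ^ (2 * m))"
      using zero_le_power[OF r0, of "2 * m"] by (intro add_right_mono) simp
    also have "\<dots> = 2 * (r + r ^ (2 * m))" by simp
    finally have "r + r\<^sup>2 \<le> 2 * (r + r ^ (2 * m))" .
    then have "\<eta> \<le> K * (2 * (r + r ^ (2 * m)))" using mult_left_mono[OF _ K] \<eta>(2) order_trans by blast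
    then have "real m * \<eta> \<le> real m * (K * (2 * (r + r ^ (2 * m))))" by (intro mult_left_mono) auto
    then have p': "(1 + (\<zeta> + \<eta>)) ^ m \<le> 1 + real m * \<zeta> + C1 * (r + r ^ (2 * m))"
      using p by (simp add: C1_def algebra_simps)
    have "Y' \<omega> \<le> Y \<omega> * (1 + (\<zeta> + \<eta>))"
    proof -
      have "Y \<omega> * (1 + (\<zeta> + \<eta>)) = Y \<omega> + Y \<omega> * \<zeta> + Y \<omega> * \<eta>" by (simp add: algebra_simps)
      also have "\<dots> = Y \<omega> + a \<omega> * z \<omega> + b \<omega> * ((z \<omega>)\<^sup>2 - \<tau>) + K * Y \<omega> * (\<tau> + (z \<omega>)\<^sup>2 + ((z \<omega>)\<^sup>2 - \<tau>)\<^sup>2)"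
        unfolding Y\<zeta> \<eta>_def by simp
      finally have e: "Y \<omega> * (1 + (\<zeta> + \<eta>)) = \<dots>" .
      show ?thesis unfolding e by (rule elim(1))
    qed
    then have "Y' \<omega> ^ m \<le> (Y \<omega> * (1 + (\<zeta> + \<eta>))) ^ m" using Y(2) elim by (intro power_mono) auto
    also have "\<dots> = Y \<omega> ^ m * (1 + (\<zeta> + \<eta>)) ^ m" by (simp add: power_mult_distrib)
    also have "\<dots> \<le> Y \<omega> ^ m * (1 + real m * \<zeta> + C1 * (r + r ^ (2 * m)))"
      using p' Y1 by (intro mult_left_mono) auto
    also have "\<dots> = Y \<omega> ^ m + real m * (Y \<omega> ^ m * \<zeta>) + C1 * (Y \<omega> ^ m * R (z \<omega>))"
      by (simp add: algebra_simps R_def r_def)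
    also have "Y \<omega> ^ m * \<zeta> = Xa \<omega> * z \<omega> + Xb \<omega> * ((z \<omega>)\<^sup>2 - \<tau>)"
      by (simp only: Ym Xa_def Xb_def mult.assoc Y\<zeta> distrib_left)
    finally show ?case by (simp only: distrib_left add.assoc)
  qed
  have Xm: "Xa \<in> borel_measurable A" "Xb \<in> borel_measurable A" "(\<lambda>\<omega>. Y \<omega> ^ m) \<in> borel_measurable A"
    using meas unfolding Xa_def Xb_def by measurable
  have Xi: "integrable M Xa" "integrable M Xb"
  proof -
    have Ki: "integrable M (\<lambda>\<omega>. K * Y \<omega> ^ m)" using int by simp
    have bd: "\<bar>Y \<omega> ^ (m - 1) * c\<bar> \<le> \<bar>K * Y \<omega> ^ m\<bar>" if "\<omega> \<in> space M" "\<bar>c\<bar> \<le> K * Y \<omega>" for \<omega> c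
    proof -
      have "\<bar>Y \<omega> ^ (m - 1) * c\<bar> \<le> Y \<omega> ^ (m - 1) * (K * Y \<omega>)"
        using that Y(1)[OF that(1)] by (simp add: abs_mult mult_left_mono)
      then show ?thesis using K Y(1)[OF that(1)] unfolding Ym by (simp add: mult_ac)
    qed
    show "integrable M Xa" "integrable M Xb"
    proof (rule_tac [!] Bochner_Integration.integrable_bound[OF Ki])
      show "Xa \<in> borel_measurable M" "Xb \<in> borel_measurable M" unfolding Xa_def Xb_def by measurable
      show "AE \<omega> in M. norm (Xa \<omega>) \<le> norm (K * Y \<omega> ^ m)" "AE \<omega> in M. norm (Xb \<omega>) \<le> norm (K * Y \<omega> ^ m)"
        unfolding Xa_def Xb_def real_norm_def using bd a b by (intro AE_I2; blast)+
    qed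
  qed
  note mom = normal_moments[OF M d \<tau>(1)]
  have z2: "integrable M (\<lambda>\<omega>. (z \<omega>)\<^sup>2)" "(\<integral>\<omega>. (z \<omega>)\<^sup>2 \<partial>M) = \<tau>" using mom(1,2)[of 1] by auto
  define cm where "cm = fact (4 * m) / (2 ^ (2 * m) * fact (2 * m)) + (1::real)"
  have Rint: "integrable M (\<lambda>\<omega>. R (z \<omega>))" and Rle: "(\<integral>\<omega>. R (z \<omega>) \<partial>M) \<le> (2 + 2 ^ (2 * m) * cm * T ^ (2 * m - 1)) * \<tau>"
  proof -
    let ?u = "\<lambda>\<omega>. (z \<omega>)\<^sup>2 + \<tau> + 2 ^ (2 * m) * (z \<omega> ^ (2 * (2 * m)) + \<tau> ^ (2 * m))"
    have ui: "integrable M ?u"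
      using mom(1)[of "2 * m"] z2(1) by (intro Bochner_Integration.integrable_add integrable_mult_right integrable_const) auto
    have le: "R y \<le> y\<^sup>2 + \<tau> + 2 ^ (2 * m) * (y ^ (2 * (2 * m)) + \<tau> ^ (2 * m))" for y
      using sum_power_le[of "y\<^sup>2" \<tau> "2 * m"] \<tau>(1) by (simp add: R_def \<rho>_def flip: power_mult)
    have R0: "0 \<le> R y" for y using \<tau>(1) by (simp add: R_def \<rho>_def)
    show ri: "integrable M (\<lambda>\<omega>. R (z \<omega>))"
    proof (rule Bochner_Integration.integrable_bound[OF ui])
      have [measurable]: "R \<in> borel_measurable borel" unfolding R_def by measurable
      show "(\<lambda>\<omega>. R (z \<omega>)) \<in> borel_measurable M" by measurable
      have "\<bar>R (z \<omega>)\<bar> \<le> \<bar>?u \<omega>\<bar>" for \<omega>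
        unfolding abs_of_nonneg[OF R0] by (rule order_trans[OF le abs_ge_self])
      then show "AE \<omega> in M. norm (R (z \<omega>)) \<le> norm (?u \<omega>)" unfolding real_norm_def by (intro AE_I2)
    qed
    have "(\<integral>\<omega>. R (z \<omega>) \<partial>M) \<le> (\<integral>\<omega>. ?u \<omega> \<partial>M)" using le by (intro integral_mono ri ui)
    also have "\<dots> = \<tau> + \<tau> + 2 ^ (2 * m) * ((cm - 1) * \<tau> ^ (2 * m) + \<tau> ^ (2 * m))"
      using z2 mom(1,2)[of "2 * m"] by (simp add: prob_space cm_def)
    also have "\<dots> = (2 + 2 ^ (2 * m) * cm * \<tau> ^ (2 * m - 1)) * \<tau>"
    proof -
      have pw: "\<tau> ^ (2 * m) = \<tau> ^ (2 * m - 1) * \<tau>" using power_minus_mult[of "2 * m" \<tau>] m by simp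
      show ?thesis unfolding pw by (simp add: algebra_simps)
    qed
    also have "\<dots> \<le> (2 + 2 ^ (2 * m) * cm * T ^ (2 * m - 1)) * \<tau>"
      using \<tau> by (intro mult_right_mono add_left_mono mult_left_mono power_mono) (auto simp: cm_def)
    finally show "(\<integral>\<omega>. R (z \<omega>) \<partial>M) \<le> (2 + 2 ^ (2 * m) * cm * T ^ (2 * m - 1)) * \<tau>" .
  qed
  have Rm: "R \<in> borel_measurable borel" unfolding R_def by measurable
  note E1 = expectation_mult_indep[OF M A ind zM Xm(1) _ Xi(1), of "\<lambda>y. y"]
  note E2 = expectation_mult_indep[OF M A ind zM Xm(2) _ Xi(2), of "\<lambda>y. y\<^sup>2 - \<tau>"]
  note E3 = expectation_mult_indep[OF M A ind zM Xm(3) Rm int Rint]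
  have e1: "integrable M (\<lambda>\<omega>. Xa \<omega> * z \<omega>)" "(\<integral>\<omega>. Xa \<omega> * z \<omega> \<partial>M) = 0"
    using E1 mom(3,4) by auto
  have e2: "integrable M (\<lambda>\<omega>. Xb \<omega> * ((z \<omega>)\<^sup>2 - \<tau>))" "(\<integral>\<omega>. Xb \<omega> * ((z \<omega>)\<^sup>2 - \<tau>) \<partial>M) = 0"
    using E2 z2 by (auto simp: prob_space)
  let ?B = "\<lambda>\<omega>. Y \<omega> ^ m + real m * (Xa \<omega> * z \<omega>) + real m * (Xb \<omega> * ((z \<omega>)\<^sup>2 - \<tau>)) + C1 * (Y \<omega> ^ m * R (z \<omega>))"
  have Bi: "integrable M ?B"
    using int e1(1) e2(1) E3(1) by (intro Bochner_Integration.integrable_add integrable_mult_right) auto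
  show Y'i: "integrable M (\<lambda>\<omega>. Y' \<omega> ^ m)"
  proof (rule Bochner_Integration.integrable_bound[OF Bi])
    show "AE \<omega> in M. norm (Y' \<omega> ^ m) \<le> norm (?B \<omega>)"
      using pathwise AE_space
    proof eventually_elim
      case (elim \<omega>)
      then show ?case using Y(2)[of \<omega>] by simp
    qed
  qed simp
  have EY: "0 \<le> (\<integral>\<omega>. Y \<omega> ^ m \<partial>M)" using Y(1) by (intro integral_nonneg_AE AE_I2 zero_le_power order_trans[OF zero_le_one])
  have "(\<integral>\<omega>. Y' \<omega> ^ m \<partial>M) \<le> (\<integral>\<omega>. ?B \<omega> \<partial>M)" by (rule integral_mono_AE[OF Y'i Bi pathwise])
  also have "\<dots> = (\<integral>\<omega>. Y \<omega> ^ m \<partial>M) + C1 * ((\<integral>\<omega>. Y \<omega> ^ m \<partial>M) * (\<integral>\<omega>. R (z \<omega>) \<partial>M))"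
    using int e1 e2 E3 by simp
  also have "\<dots> \<le> (\<integral>\<omega>. Y \<omega> ^ m \<partial>M) + C1 * ((\<integral>\<omega>. Y \<omega> ^ m \<partial>M) * ((2 + 2 ^ (2 * m) * cm * T ^ (2 * m - 1)) * \<tau>))"
    using Rle EY C1 by (intro add_left_mono mult_left_mono)
  also have "\<dots> = (1 + moment_growth m K T * \<tau>) * (\<integral>\<omega>. Y \<omega> ^ m \<partial>M)"
    by (simp add: moment_growth_def C1_def cm_def algebra_simps)
  finally show "(\<integral>\<omega>. Y' \<omega> ^ m \<partial>M) \<le> (1 + moment_growth m K T * \<tau>) * (\<integral>\<omega>. Y \<omega> ^ m \<partial>M)" .
qed

section \<open>Stability of the scheme\<close>

text \<open>The scheme tested with the new iterate \<open>u'\<close>. In the noise terms \<open>u'\<close> is replaced by \<open>u + (u' - u)\<close>: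
  the part with \<open>u\<close> is kept because its expectation will vanish, and the part with \<open>u' - u\<close> is absorbed by
  Young's inequality into the term \<open>\<parallel>u' - u\<parallel>\<^sup>2\<close> on the left.\<close>

lemma l2_energy_step:
  assumes L2: "u \<in> L2_space D" "u' \<in> L2_space D" "g \<in> L2_space D" "h \<in> L2_space D"
    and \<tau>: "0 \<le> \<tau>" and gr: "0 \<le> \<gamma>"
    and eq: "l2_inner D (\<lambda>x. u' x - u x) u' + \<tau> * \<gamma> = \<tau> * r + l2_inner D g u' * z + 1 / 2 * l2_inner D (\<lambda>x. h x * c) u'"
    and r: "r \<le> R"
  shows "(l2_norm D u')\<^sup>2 \<le> (l2_norm D u)\<^sup>2 + 2 * l2_inner D g u * z + l2_inner D h u * c
    + 2 * \<tau> * R + 2 * (l2_norm D g)\<^sup>2 * z\<^sup>2 + (l2_norm D h)\<^sup>2 * c\<^sup>2 / 2"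
proof -
  define d where "d = (\<lambda>x. u' x - u x)"
  have dL: "d \<in> L2_space D" unfolding d_def using L2 by (intro L2_diff)
  have u'd: "u' = (\<lambda>x. u x + d x)" by (auto simp: d_def)
  have right: "l2_inner D f u' = l2_inner D f u + l2_inner D f d" if "f \<in> L2_space D" for f
    using l2_inner_lin_right[OF L2(1) dL that, of 1 1] by (simp add: u'd)
  have n': "(l2_norm D u')\<^sup>2 = (l2_norm D u)\<^sup>2 + 2 * l2_inner D u d + (l2_norm D d)\<^sup>2"
    unfolding u'd using l2_norm_add_square[OF L2(1) dL] .
  have hc: "l2_inner D (\<lambda>x. h x * c) u' = c * (l2_inner D h u + l2_inner D h d)"
    using l2_inner_cmult_left[of D c h u'] right[OF L2(4)] by (simp add: mult.commute)
  have young: "x * y \<le> (l2_norm D d)\<^sup>2 / 4 + n\<^sup>2 * y\<^sup>2" if x: "\<bar>x\<bar> \<le> n * l2_norm D d" for x y n :: real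
  proof -
    have "x * y \<le> \<bar>x\<bar> * \<bar>y\<bar>" by (metis abs_ge_self abs_mult)
    also have "\<dots> \<le> (n * l2_norm D d) * \<bar>y\<bar>" using x by (intro mult_right_mono) auto
    also have "\<dots> \<le> (l2_norm D d)\<^sup>2 / 4 + n\<^sup>2 * y\<^sup>2"
      using zero_le_power2[of "l2_norm D d / 2 - n * \<bar>y\<bar>"] by (simp add: power2_diff power_mult_distrib power_divide algebra_simps)
    finally show ?thesis .
  qed
  have y1: "l2_inner D g d * z \<le> (l2_norm D d)\<^sup>2 / 4 + (l2_norm D g)\<^sup>2 * z\<^sup>2"
    by (rule young[OF l2_Cauchy_Schwarz[OF L2(3) dL]])
  have y2: "l2_inner D h d * (c / 2) \<le> (l2_norm D d)\<^sup>2 / 4 + (l2_norm D h)\<^sup>2 * (c / 2)\<^sup>2"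
    by (rule young[OF l2_Cauchy_Schwarz[OF L2(4) dL]])
  have e: "l2_inner D d u + (l2_norm D d)\<^sup>2 + \<tau> * \<gamma>
      = \<tau> * r + (l2_inner D g u + l2_inner D g d) * z + 1 / 2 * (c * (l2_inner D h u + l2_inner D h d))"
    using eq unfolding hc right[OF L2(3)] d_def[symmetric] right[OF dL] by (simp add: l2_norm_square)
  have "0 \<le> \<tau> * \<gamma>" "\<tau> * r \<le> \<tau> * R" using \<tau> gr r by (auto intro: mult_left_mono)
  then have "2 * l2_inner D u d + 2 * (l2_norm D d)\<^sup>2 \<le> 2 * \<tau> * R + 2 * l2_inner D g u * z + 2 * (l2_inner D g d * z)
      + l2_inner D h u * c + 2 * (l2_inner D h d * (c / 2))"
    using e by (simp add: l2_inner_commute[of D d u] algebra_simps)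
  moreover have "l2_inner D h d * (c / 2) \<le> (l2_norm D d)\<^sup>2 / 4 + (l2_norm D h)\<^sup>2 * c\<^sup>2 / 4"
    using y2 by (simp add: power_divide)
  ultimately show ?thesis using y1 n' by linarith
qed

lemma (in mesh) V_h_boundary_zero:
  assumes "D = cube L" "0 < L" "u \<in> V_h D \<T>" "x \<notin> D" shows "u x = 0"
proof (cases "x \<in> closure D")
  case True
  then show ?thesis
    using H10_continuous_zero_on_boundary[of u L x] P1_continuous[of u] assms by (auto simp: V_h_def)
next
  case False
  then show ?thesis using assms(3) by (auto simp: V_h_def P1_space_def)
qed

text \<open>The constants \<open>C\<close> of the noise and \<open>R\<close> of the reaction are fixed in advance, so that the final bound
  visibly depends on neither \<open>N\<close> nor the triangulation. Measurability of the coefficients at time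
  \<open>t\<^sub>n\<close>, needed for independence of the next increment, comes from \<open>l2_functional_measurable\<close>.\<close>

lemma scheme_moment_bound:
  fixes L T p :: real and u\<^sub>0 :: "real ^ 'n \<Rightarrow> real" and M :: "'w measure"
    and u :: "nat \<Rightarrow> 'w \<Rightarrow> real ^ 'n \<Rightarrow> real"
  defines "D \<equiv> cube L :: (real ^ 'n) set"
  assumes LT: "0 < L" "0 < T"
    and dim: "CARD('n) = 2 \<and> q \<ge> 3 \<and> odd q \<or> CARD('n) = 3 \<and> q \<in> {3, 5}"
    and FM: "filtered_prob_space M F" and W: "wiener_process M F W"
    and u0: "u\<^sub>0 \<in> L2_space D"
    and C: "0 < C" "\<And>v. v \<in> L2_space D \<Longrightarrow> G v \<in> L2_space D"
    "\<And>v. v \<in> L2_space D \<Longrightarrow> l2_norm D (G v) \<le> C * (1 + l2_norm D v)"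
    "\<And>v w. v \<in> L2_space D \<Longrightarrow> w \<in> L2_space D \<Longrightarrow> l2_norm D (\<lambda>x. G v x - G w x) \<le> C * l2_norm D (\<lambda>x. v x - w x)"
    "\<And>v. v \<in> L2_space D \<Longrightarrow> DG v (G v) \<in> L2_space D"
    "\<And>v. v \<in> L2_space D \<Longrightarrow> l2_norm D (DG v (G v)) \<le> C * (1 + l2_norm D v)"
    "\<And>v w. v \<in> L2_space D \<Longrightarrow> w \<in> L2_space D \<Longrightarrow> l2_norm D (\<lambda>x. DG v (G v) x - DG w (G w) x) \<le> C * l2_norm D (\<lambda>x. v x - w x)"
    and R: "0 \<le> R" "\<And>(C :: (real ^ 'n) set) f. card C = CARD('n) + 1 \<Longrightarrow> mass_form C (\<lambda>a. f a - f a ^ q) f \<le> R"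
    and m: "1 \<le> m" and N: "1 \<le> N" and tri: "triangulation_of D \<T>"
    and sol: "scheme_solution D \<T> T N q u\<^sub>0 G DG M F W u"
    and K: "K = 4 * C + 4 * C\<^sup>2 + 2 * (R * measure lebesgue D)"
    and n: "n \<le> N"
  shows "integrable M (\<lambda>\<omega>. (1 + (l2_norm D (u n \<omega>))\<^sup>2) ^ m)" (is ?I)
    "(\<integral>\<omega>. (1 + (l2_norm D (u n \<omega>))\<^sup>2) ^ m \<partial>M) \<le> exp (moment_growth m K T * T) * (1 + (l2_norm D u\<^sub>0)\<^sup>2) ^ m" (is ?E)
proof -
  interpret prob_space M using FM by (simp add: filtered_prob_space_def)
  interpret mesh D \<T> unfolding D_def by (rule mesh_cube[OF tri[unfolded D_def]])
  define \<tau> where "\<tau> = T / real N"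
  define t where "t n = real n * \<tau>" for n :: nat
  define z where "z n \<omega> = W (t (Suc n)) \<omega> - W (t n) \<omega>" for n \<omega>
  have \<tau>: "0 < \<tau>" "\<tau> \<le> T" using LT N by (auto simp: \<tau>_def divide_le_eq mult_le_cancel_left1)
  have t: "0 \<le> t n" "t n < t (Suc n)" "t (Suc n) - t n = \<tau>" for n
    using \<tau> by (auto simp: t_def algebra_simps)
  have sub: "subalgebra M (F (t n))" for n using FM t(1) by (simp add: filtered_prob_space_def)
  have sp: "space (F (t n)) = space M" for n using sub[of n] by (simp add: subalgebra_def)
  have uV: "u n \<omega> \<in> V_h D \<T>" if "n \<le> N" "\<omega> \<in> space M" for n \<omega>
    using sol that by (simp add: scheme_solution_def Let_def)
  have um: "(\<lambda>\<omega>. u n \<omega> x) \<in> borel_measurable (F (t n))" if "n \<le> N" for n x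
    using sol that by (simp add: scheme_solution_def Let_def t_def \<tau>_def)
  have u00: "AE \<omega> in M. u 0 \<omega> = P_h D \<T> u\<^sub>0"
    using sol by (simp add: scheme_solution_def Let_def)
  have all: "\<forall>n<N. AE \<omega> in M. \<forall>v \<in> V_h D \<T>.
            l2_inner D (\<lambda>x. u (Suc n) \<omega> x - u n \<omega> x) v + \<tau> * grad_inner D (u (Suc n) \<omega>) v
            = \<tau> * l2_inner D (I_h D \<T> (\<lambda>x. u (Suc n) \<omega> x - (u (Suc n) \<omega> x) ^ q)) v
              + l2_inner D (G (u n \<omega>)) v * z n \<omega>
              + 1 / 2 * l2_inner D (\<lambda>x. DG (u n \<omega>) (G (u n \<omega>)) x * ((z n \<omega>)\<^sup>2 - \<tau>)) v"
    using sol unfolding scheme_solution_def Let_def z_def t_def \<tau>_def by (elim conjE)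
  note eq = all[rule_format]
  have VP: "v \<in> P1_space D \<T>" if "v \<in> V_h D \<T>" for v using that by (simp add: V_h_def)
  have uL: "u n \<omega> \<in> L2_space D" if "n \<le> N" "\<omega> \<in> space M" for n \<omega>
    using P1_L2[OF VP[OF uV[OF that]]] .
  define Y where "Y n \<omega> = 1 + (l2_norm D (u n \<omega>))\<^sup>2" for n \<omega>
  define a where "a n \<omega> = 2 * l2_inner D (G (u n \<omega>)) (u n \<omega>)" for n \<omega>
  define b where "b n \<omega> = l2_inner D (DG (u n \<omega>) (G (u n \<omega>))) (u n \<omega>)" for n \<omega>
  define R0 where "R0 = R * measure lebesgue D"
  have R0: "0 \<le> R0" using R by (simp add: R0_def)
  have K0: "0 \<le> K" using C(1) R0 by (simp add: K R0_def)
  have Y1: "1 \<le> Y n \<omega>" for n \<omega> by (simp add: Y_def)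
  have meas: "(\<lambda>\<omega>. l2_inner D (\<Phi> (u n \<omega>)) (u n \<omega>)) \<in> borel_measurable (F (t n))"
    if n: "n \<le> N" and \<Phi>: "0 \<le> B" "\<And>v. v \<in> L2_space D \<Longrightarrow> \<Phi> v \<in> L2_space D"
      "\<And>v. v \<in> L2_space D \<Longrightarrow> l2_norm D (\<Phi> v) \<le> B * (1 + l2_norm D v)"
      "\<And>v w. v \<in> L2_space D \<Longrightarrow> w \<in> L2_space D \<Longrightarrow> l2_norm D (\<lambda>x. \<Phi> v x - \<Phi> w x) \<le> B * l2_norm D (\<lambda>x. v x - w x)"
    for \<Phi> B n
  proof (rule l2_functional_measurable[where \<Psi>="\<lambda>v. l2_inner D (\<Phi> v) v" and U="u n" and K=B])
    show "u n \<omega> \<in> P1_space D \<T>" if "\<omega> \<in> space (F (t n))" for \<omega> using that uV[OF n] VP by (simp add: sp)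
    show "(\<lambda>\<omega>. u n \<omega> x) \<in> borel_measurable (F (t n))" for x using um[OF n] .
    show "\<bar>l2_inner D (\<Phi> v) v - l2_inner D (\<Phi> w) w\<bar> \<le> B * (1 + l2_norm D v + l2_norm D w) * l2_norm D (\<lambda>x. v x - w x)"
      if "v \<in> L2_space D" "w \<in> L2_space D" for v w
      using l2_functional_lipschitz[of B D \<Phi> v w] \<Phi> that by blast
  qed (rule \<Phi>(1))
  have Ym: "Y n \<in> borel_measurable (F (t n))" if "n \<le> N" for n
  proof -
    have "(\<lambda>\<omega>. l2_inner D (u n \<omega>) (u n \<omega>)) \<in> borel_measurable (F (t n))"
      using meas[OF that, of 1 "\<lambda>v. v"] by simp
    then show ?thesis unfolding Y_def[abs_def] l2_norm_square by measurable
  qed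
  have am: "a n \<in> borel_measurable (F (t n))" if "n \<le> N" for n
  proof -
    have "(\<lambda>\<omega>. l2_inner D (G (u n \<omega>)) (u n \<omega>)) \<in> borel_measurable (F (t n))"
      by (rule meas[OF that less_imp_le[OF C(1)]]) (use C in auto)
    then show ?thesis unfolding a_def[abs_def] by measurable
  qed
  have bm: "b n \<in> borel_measurable (F (t n))" if "n \<le> N" for n
    unfolding b_def[abs_def] by (rule meas[OF that less_imp_le[OF C(1)], of "\<lambda>v. DG v (G v)"]) (use C in auto)
  have s2: "(1 + s) * s \<le> 2 * (1 + s\<^sup>2)" "(1 + s)\<^sup>2 \<le> 2 * (1 + s\<^sup>2)" for s :: real
  proof -
    have h: "2 * s \<le> 1 + s\<^sup>2" "0 \<le> s\<^sup>2" using zero_le_power2[of "s - 1"] by (simp_all add: power2_diff)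
    have "(1 + s) * s = s + s\<^sup>2" by (simp add: power2_eq_square algebra_simps)
    also have "\<dots> \<le> 2 + 2 * s\<^sup>2" using h by linarith
    finally show "(1 + s) * s \<le> 2 * (1 + s\<^sup>2)" by (simp only: distrib_left mult_1_right)
    have "(1 + s)\<^sup>2 = 1 + 2 * s + s\<^sup>2" by (simp add: power2_sum)
    also have "\<dots> \<le> 2 + 2 * s\<^sup>2" using h by linarith
    finally show "(1 + s)\<^sup>2 \<le> 2 * (1 + s\<^sup>2)" by (simp only: distrib_left mult_1_right)
  qed
  have inner_bound: "\<bar>l2_inner D f v\<bar> \<le> 2 * C * (1 + (l2_norm D v)\<^sup>2)"
    if "f \<in> L2_space D" "v \<in> L2_space D" "l2_norm D f \<le> C * (1 + l2_norm D v)" for f v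
  proof -
    have "\<bar>l2_inner D f v\<bar> \<le> l2_norm D f * l2_norm D v" using that by (intro l2_Cauchy_Schwarz)
    also have "\<dots> \<le> C * ((1 + l2_norm D v) * l2_norm D v)"
      using that(3) by (subst mult.assoc[symmetric]) (intro mult_right_mono, auto)
    also have "\<dots> \<le> C * (2 * (1 + (l2_norm D v)\<^sup>2))" using C(1) s2(1) by (intro mult_left_mono) auto
    finally show ?thesis by (simp only: mult_ac)
  qed
  have norm_bound: "(l2_norm D f)\<^sup>2 \<le> 2 * C\<^sup>2 * (1 + (l2_norm D v)\<^sup>2)"
    if "l2_norm D f \<le> C * (1 + l2_norm D v)" for f v
  proof -
    have "(l2_norm D f)\<^sup>2 \<le> (C * (1 + l2_norm D v))\<^sup>2" using that by (intro power_mono) auto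
    also have "\<dots> = C\<^sup>2 * (1 + l2_norm D v)\<^sup>2" by (rule power_mult_distrib)
    also have "\<dots> \<le> C\<^sup>2 * (2 * (1 + (l2_norm D v)\<^sup>2))" using s2(2) by (intro mult_left_mono) auto
    finally show ?thesis by (simp only: mult_ac)
  qed
  have KC: "4 * C \<le> K" "2 * C \<le> K" "2 * R0 \<le> K" "4 * C\<^sup>2 \<le> K" "C\<^sup>2 \<le> K"
    using C(1) R0 zero_le_power2[of C] by (simp_all add: K R0_def)
  have ab: "\<bar>a n \<omega>\<bar> \<le> K * Y n \<omega>" "\<bar>b n \<omega>\<bar> \<le> K * Y n \<omega>" if "n \<le> N" "\<omega> \<in> space M" for n \<omega>
  proof -
    note v = uL[OF that]
    have "\<bar>a n \<omega>\<bar> \<le> 4 * C * Y n \<omega>"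
      using inner_bound[OF C(2)[OF v] v C(3)[OF v]] by (simp add: a_def Y_def abs_mult)
    also have "\<dots> \<le> K * Y n \<omega>" using KC(1) Y1[of n \<omega>] by (intro mult_right_mono) auto
    finally show "\<bar>a n \<omega>\<bar> \<le> K * Y n \<omega>" .
    have "\<bar>b n \<omega>\<bar> \<le> 2 * C * Y n \<omega>"
      using inner_bound[OF C(5)[OF v] v C(6)[OF v]] by (simp add: b_def Y_def)
    also have "\<dots> \<le> K * Y n \<omega>" using KC(2) Y1[of n \<omega>] by (intro mult_right_mono) auto
    finally show "\<bar>b n \<omega>\<bar> \<le> K * Y n \<omega>" .
  qed
  have step: "AE \<omega> in M. Y (Suc n) \<omega> \<le> Y n \<omega> + a n \<omega> * z n \<omega> + b n \<omega> * ((z n \<omega>)\<^sup>2 - \<tau>)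
      + K * Y n \<omega> * (\<tau> + (z n \<omega>)\<^sup>2 + ((z n \<omega>)\<^sup>2 - \<tau>)\<^sup>2)" if n: "n < N" for n
    using eq[OF n] AE_space
  proof eventually_elim
    case (elim \<omega>)
    let ?v = "u n \<omega>" and ?v' = "u (Suc n) \<omega>" and ?c = "(z n \<omega>)\<^sup>2 - \<tau>"
    have v: "?v \<in> L2_space D" and v': "?v' \<in> L2_space D" using uL n elim(2) by auto
    have v'V: "?v' \<in> V_h D \<T>" using uV n elim(2) by auto
    have "0 \<le> grad_inner D ?v' ?v'" unfolding grad_inner_def by (intro sum_nonneg) simp
    moreover have "l2_inner D (I_h D \<T> (\<lambda>x. ?v' x - ?v' x ^ q)) ?v' \<le> R0"
      unfolding R0_def by (rule reaction_bound[OF dim R VP[OF v'V] V_h_boundary_zero[OF meta_eq_to_obj_eq[OF D_def] LT(1) v'V]])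
    ultimately have "(l2_norm D ?v')\<^sup>2 \<le> (l2_norm D ?v)\<^sup>2 + 2 * l2_inner D (G ?v) ?v * z n \<omega> + l2_inner D (DG ?v (G ?v)) ?v * ?c
      + 2 * \<tau> * R0 + 2 * (l2_norm D (G ?v))\<^sup>2 * (z n \<omega>)\<^sup>2 + (l2_norm D (DG ?v (G ?v)))\<^sup>2 * ?c\<^sup>2 / 2"
      using bspec[OF elim(1) v'V] \<tau>(1) by (intro l2_energy_step v v' C(2)[OF v] C(5)[OF v]) auto
    moreover have "2 * \<tau> * R0 \<le> K * Y n \<omega> * \<tau>"
    proof -
      have "2 * R0 * 1 \<le> K * Y n \<omega>" using KC(3) Y1 R0 K0 by (intro mult_mono) auto
      from mult_right_mono[OF this less_imp_le[OF \<tau>(1)]] show ?thesis by (simp add: mult_ac)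
    qed
    moreover have "2 * (l2_norm D (G ?v))\<^sup>2 * (z n \<omega>)\<^sup>2 \<le> K * Y n \<omega> * (z n \<omega>)\<^sup>2"
    proof (rule mult_right_mono)
      have "2 * (l2_norm D (G ?v))\<^sup>2 \<le> 4 * C\<^sup>2 * Y n \<omega>" using norm_bound[OF C(3)[OF v]] by (simp add: Y_def)
      also have "\<dots> \<le> K * Y n \<omega>" using KC(4) Y1[of n \<omega>] by (intro mult_right_mono) auto
      finally show "2 * (l2_norm D (G ?v))\<^sup>2 \<le> K * Y n \<omega>" .
    qed simp
    moreover have "(l2_norm D (DG ?v (G ?v)))\<^sup>2 * ?c\<^sup>2 / 2 \<le> K * Y n \<omega> * ?c\<^sup>2"
    proof -
      have "(l2_norm D (DG ?v (G ?v)))\<^sup>2 / 2 \<le> C\<^sup>2 * Y n \<omega>" using norm_bound[OF C(6)[OF v]] by (simp add: Y_def)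
      also have "\<dots> \<le> K * Y n \<omega>" using KC(5) Y1[of n \<omega>] by (intro mult_right_mono) auto
      finally have "(l2_norm D (DG ?v (G ?v)))\<^sup>2 / 2 * ?c\<^sup>2 \<le> K * Y n \<omega> * ?c\<^sup>2" by (rule mult_right_mono) simp
      then show ?thesis by simp
    qed
    ultimately show ?case unfolding a_def b_def distrib_left Y_def[of "Suc n"] Y_def[of n] by linarith
  qed
  define \<kappa> where "\<kappa> = moment_growth m K T"
  have \<kappa>: "0 \<le> \<kappa>" unfolding \<kappa>_def using K0 LT by (intro moment_growth_nonneg) auto
  define y0 where "y0 = 1 + (l2_norm D u\<^sub>0)\<^sup>2"
  have induct: "integrable M (\<lambda>\<omega>. Y n \<omega> ^ m) \<and> (\<integral>\<omega>. Y n \<omega> ^ m \<partial>M) \<le> (1 + \<kappa> * \<tau>) ^ n * y0 ^ m" if "n \<le> N" for n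
    using that
  proof (induction n)
    case 0
    have "l2_norm D (P_h D \<T> u\<^sub>0) \<le> l2_norm D u\<^sub>0"
      unfolding D_def by (rule P_h_l2_norm_le[OF tri[unfolded D_def] u0[unfolded D_def]])
    then have P: "1 + (l2_norm D (P_h D \<T> u\<^sub>0))\<^sup>2 \<le> y0" by (simp add: y0_def power_mono)
    have le: "AE \<omega> in M. Y 0 \<omega> ^ m \<le> y0 ^ m"
      using u00 by eventually_elim (use P in \<open>auto simp: Y_def intro!: power_mono add_nonneg_nonneg\<close>)
    have Y0m: "Y 0 \<in> borel_measurable M" using measurable_from_subalg[OF sub Ym] by simp
    have i: "integrable M (\<lambda>\<omega>. Y 0 \<omega> ^ m)"
    proof (rule integrable_const_bound[of _ "y0 ^ m"])
      show "AE \<omega> in M. norm (Y 0 \<omega> ^ m) \<le> y0 ^ m"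
        using le by eventually_elim (simp add: Y_def)
    qed (use Y0m in measurable)
    have "(\<integral>\<omega>. Y 0 \<omega> ^ m \<partial>M) \<le> (\<integral>\<omega>. y0 ^ m \<partial>M)" by (intro integral_mono_AE i le) simp
    then show ?case using i by (simp add: prob_space)
  next
    case (Suc n)
    then have n: "n < N" and IH: "integrable M (\<lambda>\<omega>. Y n \<omega> ^ m)" "(\<integral>\<omega>. Y n \<omega> ^ m \<partial>M) \<le> (1 + \<kappa> * \<tau>) ^ n * y0 ^ m"
      by auto
    have "\<forall>s\<ge>0. \<forall>t>s. distributed M lborel (\<lambda>\<omega>. W t \<omega> - W s \<omega>) (normal_density 0 (sqrt (t - s))) \<and>
        indep_set (sets (F s)) (sets (vimage_algebra (space M) (\<lambda>\<omega>. W t \<omega> - W s \<omega>) borel))"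
      using W unfolding wiener_process_def by (elim conjE)
    from this[rule_format, OF t(1) t(2), of n]
    have dist: "distributed M lborel (z n) (normal_density 0 (sqrt \<tau>))"
      and ind: "indep_set (sets (F (t n))) (sets (vimage_algebra (space M) (z n) borel))"
      unfolding z_def[abs_def] t(3) by auto
    note s = moment_step[OF prob_space_axioms sub ind dist \<tau> Ym am bm measurable_from_subalg[OF sub Ym[OF Suc.prems]]
        Y1 order_trans[OF zero_le_one Y1] K0 ab m IH(1) step[OF n]]
    have s: "integrable M (\<lambda>\<omega>. Y (Suc n) \<omega> ^ m)"
      "(\<integral>\<omega>. Y (Suc n) \<omega> ^ m \<partial>M) \<le> (1 + \<kappa> * \<tau>) * (\<integral>\<omega>. Y n \<omega> ^ m \<partial>M)"
      unfolding \<kappa>_def using n by (intro s; simp)+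
    note s(2)
    also have "(1 + \<kappa> * \<tau>) * (\<integral>\<omega>. Y n \<omega> ^ m \<partial>M) \<le> (1 + \<kappa> * \<tau>) * ((1 + \<kappa> * \<tau>) ^ n * y0 ^ m)"
      using IH(2) \<kappa> \<tau>(1) by (intro mult_left_mono) auto
    finally show ?case using s(1) by (simp add: mult.assoc)
  qed
  show ?I using induct[OF n] by (simp add: Y_def)
  have "(1 + \<kappa> * \<tau>) ^ n \<le> exp (\<kappa> * \<tau>) ^ n" using exp_ge_add_one_self \<kappa> \<tau>(1) by (intro power_mono) auto
  also have "\<dots> = exp (\<kappa> * (real n * \<tau>))" by (simp add: exp_of_nat_mult[symmetric] mult_ac)
  also have "\<dots> \<le> exp (\<kappa> * T)"
  proof -
    have "real n * \<tau> \<le> real N * \<tau>" using n \<tau>(1) by (intro mult_right_mono) auto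
    also have "\<dots> = T" using N by (simp add: \<tau>_def)
    finally show ?thesis using \<kappa> by (simp add: mult_left_mono)
  qed
  finally have "(1 + \<kappa> * \<tau>) ^ n * y0 ^ m \<le> exp (\<kappa> * T) * y0 ^ m"
    by (intro mult_right_mono) (auto simp: y0_def intro!: zero_le_power add_nonneg_nonneg)
  then show ?E using induct[OF n] by (simp add: Y_def \<kappa>_def y0_def)
qed

theorem theorem4p4:
  fixes L T p :: real and q :: nat
    and u\<^sub>0 :: "real ^ 'n \<Rightarrow> real"
    and G :: "(real ^ 'n \<Rightarrow> real) \<Rightarrow> real ^ 'n \<Rightarrow> real"
    and DG :: "(real ^ 'n \<Rightarrow> real) \<Rightarrow> (real ^ 'n \<Rightarrow> real) \<Rightarrow> real ^ 'n \<Rightarrow> real"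
    and D2G :: "(real ^ 'n \<Rightarrow> real) \<Rightarrow> (real ^ 'n \<Rightarrow> real) \<Rightarrow> (real ^ 'n \<Rightarrow> real) \<Rightarrow> real ^ 'n \<Rightarrow> real"
    and M :: "'w measure" and F :: "real \<Rightarrow> 'w measure" and W :: "real \<Rightarrow> 'w \<Rightarrow> real"
  defines "D \<equiv> cube L :: (real ^ 'n) set"
  assumes "L > 0" and "T > 0"
    and "CARD('n) = 2 \<and> q \<ge> 3 \<and> odd q \<or> CARD('n) = 3 \<and> q \<in> {3, 5}"
    and "filtered_prob_space M F" and "wiener_process M F W"
    and "u\<^sub>0 \<in> L2_space D"
    and "noise_assumptions (L2_space D) (l2_norm D) (L2_space D) (l2_norm D) G DG D2G"
    and "noise_assumptions (H10_space D) (h1_norm D) (H10_space D) (h1_norm D) G DG D2G"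
    and "p \<ge> 2"
  shows "\<exists>C>0. \<forall>N\<ge>1. \<forall>h \<T> u.
           triangulation_of D \<T> \<and> mesh_size \<T> = h \<and> mesh_condition \<T> \<and>
           scheme_solution D \<T> T N q u\<^sub>0 G DG M F W u \<longrightarrow>
             (SUP l\<in>{0..N}. \<integral>\<^sup>+ \<omega>. ennreal (l2_norm D (u l \<omega>) powr p) \<partial>M) \<le> ennreal C"
proof -
  obtain c where c: "0 < c" "\<And>v. v \<in> L2_space D \<Longrightarrow> G v \<in> L2_space D"
    "\<And>v. v \<in> L2_space D \<Longrightarrow> l2_norm D (G v) \<le> c * (1 + l2_norm D v)"
    "\<And>v w. v \<in> L2_space D \<Longrightarrow> w \<in> L2_space D \<Longrightarrow> l2_norm D (\<lambda>x. G v x - G w x) \<le> c * l2_norm D (\<lambda>x. v x - w x)"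
    "\<And>v. v \<in> L2_space D \<Longrightarrow> DG v (G v) \<in> L2_space D"
    "\<And>v. v \<in> L2_space D \<Longrightarrow> l2_norm D (DG v (G v)) \<le> c * (1 + l2_norm D v)"
    "\<And>v w. v \<in> L2_space D \<Longrightarrow> w \<in> L2_space D \<Longrightarrow> l2_norm D (\<lambda>x. DG v (G v) x - DG w (G w) x) \<le> c * l2_norm D (\<lambda>x. v x - w x)"
    by (rule noise_L2_bounds[OF assms(8)]) (rule that, assumption+)
  obtain R where R: "0 \<le> R"
    "\<And>(C :: (real ^ 'n) set) f. card C = CARD('n) + 1 \<Longrightarrow> mass_form C (\<lambda>a. f a - f a ^ q) f \<le> R"
    by (rule mass_form_reaction_bound[OF assms(4)]) (rule that, assumption+)
  \<comment> \<open>Any integer \<open>m\<close> with \<open>p \<le> 2 m\<close> works, because \<open>s powr p \<le> (1 + s\<^sup>2)^m\<close> for such \<open>m\<close>.\<close>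
  define m where "m = nat \<lceil>p\<rceil>"
  have m: "1 \<le> m" "p \<le> real (2 * m)" using assms(10) unfolding m_def by linarith+
  define K where "K = 4 * c + 4 * c\<^sup>2 + 2 * (R * measure lebesgue D)"
  define B where "B = exp (moment_growth m K T * T) * (1 + (l2_norm D u\<^sub>0)\<^sup>2) ^ m"
  have B: "0 < B" unfolding B_def by (intro mult_pos_pos zero_less_power add_pos_nonneg) auto
  have "(SUP l\<in>{0..N}. \<integral>\<^sup>+ \<omega>. ennreal (l2_norm D (u l \<omega>) powr p) \<partial>M) \<le> ennreal B"
    if N: "1 \<le> N" and tri: "triangulation_of D \<T>" and sol: "scheme_solution D \<T> T N q u\<^sub>0 G DG M F W u" for N \<T> u
  proof (rule SUP_least)
    fix l assume "l \<in> {0..N}"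
    then have l: "l \<le> N" by simp
    note bound = scheme_moment_bound[OF assms(2-6) assms(7)[unfolded D_def] c[unfolded D_def] R m(1) N tri[unfolded D_def] sol[unfolded D_def]
        K_def[unfolded D_def] l, folded D_def]
    have "(\<integral>\<^sup>+ \<omega>. ennreal (l2_norm D (u l \<omega>) powr p) \<partial>M) \<le> (\<integral>\<^sup>+ \<omega>. ennreal ((1 + (l2_norm D (u l \<omega>))\<^sup>2) ^ m) \<partial>M)"
    proof (intro nn_integral_mono ennreal_leI)
      fix \<omega>
      define s where "s = l2_norm D (u l \<omega>)"
      define y where "y = sqrt (1 + s\<^sup>2)"
      have y: "1 \<le> y" "0 \<le> s" "s \<le> y" by (auto simp: y_def s_def intro!: real_le_rsqrt)
      have "s powr p \<le> y powr p" using y assms(10) by (intro powr_mono2) auto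
      also have "\<dots> \<le> y powr real (2 * m)" using y m by (intro powr_mono) auto
      also have "\<dots> = y ^ (2 * m)" using y by (intro powr_realpow) auto
      also have "\<dots> = (1 + s\<^sup>2) ^ m" by (simp add: power_mult y_def)
      finally show "l2_norm D (u l \<omega>) powr p \<le> (1 + (l2_norm D (u l \<omega>))\<^sup>2) ^ m" by (simp add: s_def)
    qed
    also have "\<dots> = ennreal (\<integral>\<omega>. (1 + (l2_norm D (u l \<omega>))\<^sup>2) ^ m \<partial>M)"
      by (rule nn_integral_eq_integral[OF bound(1)]) (auto intro!: zero_le_power add_nonneg_nonneg)
    also have "\<dots> \<le> ennreal B" using bound(2) unfolding B_def by (rule ennreal_leI)
    finally show "(\<integral>\<^sup>+ \<omega>. ennreal (l2_norm D (u l \<omega>) powr p) \<partial>M) \<le> ennreal B" .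
  qed
  then show ?thesis using B by blast
qed

end
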